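(* Let $n$ be a positive integer, $k$ a field, $R=k[x_1,\dots,x_n]$ and $\mathfrak m=(x_1,\dots,x_n)$. Let $a$ and $b$ be positive integers with $b\ge a$, and assume that $k$ has characteristic zero or positive characteristic at least $b+n$. With $\mathbb L_a$, $\mathbb L_b$, $\mathbb X_a$, $\mathbb X_b$, $i_\infty$, $p_\infty$ and the natural surjection $\pi_{b,a}\colon\mathbb X_b\to\mathbb X_a$ as defined in the context, the chain map $$f_{b,a}=p_\infty\,\pi_{b,a}\,i_\infty\colon\mathbb L_b\to\mathbb L_a$$ is a homomorphism of dg algebras that gives a lifting of the natural surjection $R/\mathfrak m^b\to R/\mathfrak m^a$. In particular, the Koszul complex on the variables $x_1,\dots,x_n$, which is $\mathbb L_1$, is a dg algebra over $\mathbb L_b$ for every positive integer $b$ (such that $k$ has characteristic zero or at least $b+n$). Moreover, if $c\ge b\ge a$ are positive integers (and $k$ has characteristic zero or at least $c+n$), then $f_{c,a}=f_{b,a}f_{c,b}$.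
   Context: Dg algebras: a dg algebra over $R$ is a complex of $R$-modules (homologically graded) in nonnegative degrees with an associative, unitary product given by a chain map $X\otimes_RX\to X$ (so the differential satisfies $\partial(\alpha\beta)=\partial(\alpha)\beta+(-1)^{|\alpha|}\alpha\partial(\beta)$), which is strictly graded commutative: $\alpha\beta=(-1)^{|\alpha||\beta|}\beta\alpha$, and $\alpha^2=0$ for $|\alpha|$ odd. Homomorphisms of dg algebras are chain maps preserving $1$ and products. "A dg algebra over $\mathbb L_b$" means a dg algebra together with a dg algebra homomorphism from $\mathbb L_b$, here $f_{b,1}$. The complex $\mathbb S$: let $S=R[y_1,\dots,y_n]=\bigoplus_m S_m$ (graded by degree in the $y$'s) and let $\Lambda=\bigoplus_i\Lambda^i$ be the exterior algebra over $R$ on $e_1,\dots,e_n$; tensor products are over $R$. Define $$\kappa_{i,m}\colon\Lambda^i\otimes S_m\to\Lambda^{i-1}\otimes S_{m+1},\quad \kappa(e_{t_1}\wedge\cdots\wedge e_{t_i}\otimes q)=\sum_{j=1}^i(-1)^{j+1}e_{t_1}\wedge\cdots\wedge\widehat{e_{t_j}}\wedge\cdots\wedge e_{t_i}\otimes y_{t_j}q,$$ and $d_{i,m}=\mathrm{kos}_i\otimes1\colon\Lambda^i\otimes S_m\to\Lambda^{i-1}\otimes S_m$, where $\mathrm{kos}_i$ is the $i$th differential of the Koszul complex on $x_1,\dots,x_n$ over $R$. $\mathbb S$ is the totalization of the resulting anticommutative double complex $\{\Lambda^i\otimes S_m\mid i,m\ge0\}$: homological degree is the $\Lambda$-degree $i$,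 and the differential is $\kappa+d$. With multiplication $(\lambda\otimes s)(\lambda'\otimes s')=\lambda\wedge\lambda'\otimes ss'$, $\mathbb S$ is a dg algebra, and for each $c\ge1$, $\mathrm{tr}_{\ge c}(\mathbb S)=\{\Lambda^i\otimes S_m\mid m\ge c\}$ is a dg ideal. The dg algebras $\mathbb X_c$: $\mathbb X_c=\mathbb S/\mathrm{tr}_{\ge c}(\mathbb S)$, with modules $\Lambda^i\otimes S_m$, $m\le c-1$, differential $\kappa+d$ and the induced product. For $b\ge a$, $\pi_{b,a}\colon\mathbb X_b=\mathbb S/\mathrm{tr}_{\ge b}(\mathbb S)\to\mathbb S/\mathrm{tr}_{\ge a}(\mathbb S)=\mathbb X_a$ is the natural quotient map, sending $\Lambda^i\otimes S_m$ to zero for $a\le m\le b-1$; it is a homomorphism of dg algebras. The complexes $\mathbb L_c$: for $0\le i\le n-1$ let $L_{i,c}=\operatorname{im}\kappa_{i+1,c-1}=\ker\kappa_{i,c}\subseteq\Lambda^i\otimes S_c$ (so $L_{0,c}=\Lambda^0\otimes S_c\cong S_c$). Let $\varepsilon\colon\Lambda^0\otimes S_m\cong S_m\to R$ be the $R$-linear evaluation $y_j\mapsto x_j$. The maps $d$ induce maps $d\colon L_{i,c}\to L_{i-1,c}$, and $\mathbb L_c$ is the complex $$0\to L_{n-1,c}\xrightarrow{d}L_{n-2,c}\xrightarrow{d}\cdots\to L_{0,c}\xrightarrow{\varepsilon}R\to0$$ with $(\mathbb L_c)_0=R$ and $(\mathbb L_c)_{i+1}=L_{i,c}$. It is the Buchsbaum–Eisenbud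 minimal free resolution of $R/\mathfrak m^c$. The homotopy $\sigma$ (a scaled de Rham differential): $\sigma_{i,m}\colon\Lambda^i\otimes S_m\to\Lambda^{i+1}\otimes S_{m-1}$ is, for $i+m>0$, $$\sigma_{i,m}(e_{t_1}\wedge\cdots\wedge e_{t_i}\otimes y_{p_1}\cdots y_{p_m})=\frac1{i+m}\sum_{j=1}^m e_{p_j}\wedge e_{t_1}\wedge\cdots\wedge e_{t_i}\otimes y_{p_1}\cdots\widehat{y_{p_j}}\cdots y_{p_m},$$ with $\sigma_{i,m}=0$ when $m=0$ or $i=n$. The maps $i_\infty\colon\mathbb L_c\to\mathbb X_c$ and $p_\infty\colon\mathbb X_c\to\mathbb L_c$ (for each $c$, with $k$ of characteristic zero or at least $c+n$) form a homotopy equivalence with $p_\infty i_\infty=1$ and are given by $$i_\infty=\begin{cases}(1+(-\sigma d)+(-\sigma d)^2+\cdots)\,\sigma&\text{on }L_{i,c}\\ \varepsilon^{-1}\colon R\to\Lambda^0\otimes S_0&\text{on }R,\end{cases}\qquad p_\infty=\begin{cases}\kappa&\text{on }\Lambda^i\otimes S_{c-1}\text{ for }i>0\\ \varepsilon&\text{on }\Lambda^0\otimes S_j\text{ for all }j\\ 0&\text{else}\end{cases}$$ (the sum is finite). The symbols $i_\infty,p_\infty$ are used for every $c$; in $f_{b,a}$, $i_\infty$ is the map for $c=b$ and $p_\infty$ the one for $c=a$. The dg algebra structure on $\mathbb L_c$ is given by $\alpha\beta=p_\infty(i_\infty(\alpha)\,i_\infty(\beta))$, with the product inside the parentheses taken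 in $\mathbb X_c$; for it $i_\infty$ is a homomorphism of dg algebras.
   Formalization: The differential of L_c is taken as −d on L_{i,c} (i ≥ 1) and (−1)^{c+1}ε on L_{0,c}: with d and ε as displayed, f_{b,a} is not a chain map (n=1, a=1, b=2). The signed complex is isomorphic to the displayed one; i_∞, p_∞, f and the product formula are unchanged. *)

theory Defs
  imports
    Complex_Main
    "HOL-Library.Cardinality"
    "HOL-Library.Poly_Mapping"
    "HOL-Library.Product_Plus"
    "HOL-Library.Function_Algebras"
begin

section \<open>Dg algebras\<close>

text \<open>
  The graded pieces of a dg algebra are submodules of one ambient module
  \<open>'x\<close>; only homogeneous elements matter, so all conditions are imposed on
  the pieces.
\<close>

record ('r, 'x) dga =
  dg_comp :: "nat \<Rightarrow> 'x set"
  dg_scale :: "'r \<Rightarrow> 'x \<Rightarrow> 'x"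
  dg_diff :: "'x \<Rightarrow> 'x"
  dg_mult :: "'x \<Rightarrow> 'x \<Rightarrow> 'x"
  dg_one :: "'x"

locale dg_algebra =
  fixes A :: "('r::comm_ring_1, 'x::ab_group_add) dga"
  assumes module_scale: "module (dg_scale A)"
    and subspace_comp: "module.subspace (dg_scale A) (dg_comp A i)"
    and diff_comp: "x \<in> dg_comp A (Suc i) \<Longrightarrow> dg_diff A x \<in> dg_comp A i"
    and diff_comp_0: "x \<in> dg_comp A 0 \<Longrightarrow> dg_diff A x = 0"
    and diff_add: "x \<in> dg_comp A i \<Longrightarrow> y \<in> dg_comp A i \<Longrightarrow>
      dg_diff A (x + y) = dg_diff A x + dg_diff A y"
    and diff_scale: "x \<in> dg_comp A i \<Longrightarrow>
      dg_diff A (dg_scale A r x) = dg_scale A r (dg_diff A x)"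
    and diff_diff: "x \<in> dg_comp A i \<Longrightarrow> dg_diff A (dg_diff A x) = 0"
    and mult_comp: "x \<in> dg_comp A i \<Longrightarrow> y \<in> dg_comp A j \<Longrightarrow>
      dg_mult A x y \<in> dg_comp A (i + j)"
    and mult_add_left: "x \<in> dg_comp A i \<Longrightarrow> y \<in> dg_comp A i \<Longrightarrow> z \<in> dg_comp A j \<Longrightarrow>
      dg_mult A (x + y) z = dg_mult A x z + dg_mult A y z"
    and mult_add_right: "x \<in> dg_comp A i \<Longrightarrow> y \<in> dg_comp A j \<Longrightarrow> z \<in> dg_comp A j \<Longrightarrow>
      dg_mult A x (y + z) = dg_mult A x y + dg_mult A x z"
    and mult_scale_left: "x \<in> dg_comp A i \<Longrightarrow> y \<in> dg_comp A j \<Longrightarrow>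
      dg_mult A (dg_scale A r x) y = dg_scale A r (dg_mult A x y)"
    and mult_scale_right: "x \<in> dg_comp A i \<Longrightarrow> y \<in> dg_comp A j \<Longrightarrow>
      dg_mult A x (dg_scale A r y) = dg_scale A r (dg_mult A x y)"
    and mult_assoc: "x \<in> dg_comp A i \<Longrightarrow> y \<in> dg_comp A j \<Longrightarrow> z \<in> dg_comp A l \<Longrightarrow>
      dg_mult A (dg_mult A x y) z = dg_mult A x (dg_mult A y z)"
    and one_comp: "dg_one A \<in> dg_comp A 0"
    and one_mult: "x \<in> dg_comp A i \<Longrightarrow> dg_mult A (dg_one A) x = x"
    and mult_one: "x \<in> dg_comp A i \<Longrightarrow> dg_mult A x (dg_one A) = x"
    and leibniz: "x \<in> dg_comp A i \<Longrightarrow> y \<in> dg_comp A j \<Longrightarrow>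
      dg_diff A (dg_mult A x y) =
        dg_mult A (dg_diff A x) y + dg_scale A ((-1) ^ i) (dg_mult A x (dg_diff A y))"
    and graded_comm: "x \<in> dg_comp A i \<Longrightarrow> y \<in> dg_comp A j \<Longrightarrow>
      dg_mult A x y = dg_scale A ((-1) ^ (i * j)) (dg_mult A y x)"
    and odd_square: "x \<in> dg_comp A i \<Longrightarrow> odd i \<Longrightarrow> dg_mult A x x = 0"

locale dg_algebra_hom = source: dg_algebra A + target: dg_algebra B
  for A :: "('r::comm_ring_1, 'x::ab_group_add) dga"
    and B :: "('r, 'y::ab_group_add) dga" +
  fixes f :: "'x \<Rightarrow> 'y"
  assumes hom_comp: "x \<in> dg_comp A i \<Longrightarrow> f x \<in> dg_comp B i"
    and hom_add: "x \<in> dg_comp A i \<Longrightarrow> y \<in> dg_comp A i \<Longrightarrow> f (x + y) = f x + f y"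
    and hom_scale: "x \<in> dg_comp A i \<Longrightarrow> f (dg_scale A r x) = dg_scale B r (f x)"
    and hom_diff: "x \<in> dg_comp A i \<Longrightarrow> f (dg_diff A x) = dg_diff B (f x)"
    and hom_one: "f (dg_one A) = dg_one B"
    and hom_mult: "x \<in> dg_comp A i \<Longrightarrow> y \<in> dg_comp A j \<Longrightarrow>
      f (dg_mult A x y) = dg_mult B (f x) (f y)"

definition dg_algebra_iso ::
  "('r::comm_ring_1, 'x::ab_group_add) dga \<Rightarrow> ('r, 'y::ab_group_add) dga \<Rightarrow> ('x \<Rightarrow> 'y) \<Rightarrow> bool"
  where "dg_algebra_iso A B f \<longleftrightarrow>
    dg_algebra_hom A B f \<and> (\<forall>i. bij_betw f (dg_comp A i) (dg_comp B i))"

text \<open>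
  \<open>augmented_to A \<eta> M\<close>: the map \<open>\<eta>\<close> from the degree 0 piece onto \<open>M\<close>
  has exactly the boundaries as kernel, i.e. it identifies
  \<open>H\<^sub>0(A)\<close> with \<open>M\<close>.
  \<open>lifts f \<phi>\<close> says that \<open>f\<close> induces \<open>\<phi>\<close> under these identifications.
\<close>

definition augmented_to ::
  "('r, 'x::ab_group_add) dga \<Rightarrow> ('x \<Rightarrow> 'm) \<Rightarrow> 'm set \<Rightarrow> bool"
  where "augmented_to A \<eta> M \<longleftrightarrow>
    \<eta> ` dg_comp A 0 = M \<and>
    (\<forall>x\<in>dg_comp A 0. \<forall>y\<in>dg_comp A 0. \<eta> x = \<eta> y \<longleftrightarrow> x - y \<in> dg_diff A ` dg_comp A 1)"

definition lifts ::
  "('r, 'x::ab_group_add) dga \<Rightarrow> ('x \<Rightarrow> 'm) \<Rightarrow> 'm set \<Rightarrow>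
   ('r, 'y::ab_group_add) dga \<Rightarrow> ('y \<Rightarrow> 'l) \<Rightarrow> 'l set \<Rightarrow>
   ('x \<Rightarrow> 'y) \<Rightarrow> ('m \<Rightarrow> 'l) \<Rightarrow> bool"
  where "lifts A \<eta> M B \<theta> N f \<phi> \<longleftrightarrow>
    augmented_to A \<eta> M \<and> augmented_to B \<theta> N \<and>
    (\<forall>i. \<forall>x\<in>dg_comp A i. f x \<in> dg_comp B i \<and> f (dg_diff A x) = dg_diff B (f x)) \<and>
    (\<forall>x\<in>dg_comp A 0. \<theta> (f x) = \<phi> (\<eta> x))"


section \<open>Ideals and residue class rings\<close>

definition ideal_gen :: "'r::comm_ring_1 set \<Rightarrow> 'r set"
  where "ideal_gen G = module.span (*) G"

primrec ideal_power :: "'r::comm_ring_1 set \<Rightarrow> nat \<Rightarrow> 'r set"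
  where
    "ideal_power I 0 = UNIV"
  | "ideal_power I (Suc c) = ideal_gen {u * v | u v. u \<in> I \<and> v \<in> ideal_power I c}"

definition residue :: "'r::comm_ring_1 set \<Rightarrow> 'r \<Rightarrow> 'r set"
  where "residue I r = {r + u | u. u \<in> I}"

definition residues :: "'r::comm_ring_1 set \<Rightarrow> 'r set set"
  where "residues I = residue I ` UNIV"

text \<open>For ideals \<open>J \<subseteq> I\<close> this sends \<open>r + J\<close> to \<open>(r + J) + I = r + I\<close>.\<close>

definition nat_surj :: "'r::comm_ring_1 set \<Rightarrow> 'r set \<Rightarrow> 'r set"
  where "nat_surj I C = {x + u | x u. x \<in> C \<and> u \<in> I}"


section \<open>Exterior algebras and Koszul differentials\<close>

text \<open>
  An element of the exterior algebra over \<open>'c\<close> on generators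
  \<open>e\<^sub>t\<close>, \<open>t :: 'n\<close>, is given by its coordinates in the basis
  \<open>e\<^sub>T = e\<^sub>t\<^sub>1 \<and> \<dots> \<and> e\<^sub>t\<^sub>i\<close> for
  \<open>T = {t\<^sub>1 < \<dots> < t\<^sub>i}\<close>.
\<close>

type_synonym ('c, 'n) ext = "'n set \<Rightarrow> 'c"

definition ext_basis :: "'n set \<Rightarrow> 'c::zero \<Rightarrow> ('c, 'n) ext"
  where "ext_basis T q = (\<lambda>U. if U = T then q else 0)"

definition shuffle_sign :: "'n::linorder set \<Rightarrow> 'n set \<Rightarrow> 'c::comm_ring_1"
  where "shuffle_sign T U = (-1) ^ card {(t, u). t \<in> T \<and> u \<in> U \<and> u < t}"

definition ext_mult ::
  "('c::comm_ring_1, 'n::{finite,linorder}) ext \<Rightarrow> ('c, 'n) ext \<Rightarrow> ('c, 'n) ext"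
  where "ext_mult \<omega> \<omega>' = (\<Sum>T\<in>UNIV. \<Sum>U\<in>UNIV.
    if T \<inter> U = {} then ext_basis (T \<union> U) (shuffle_sign T U * \<omega> T * \<omega>' U) else 0)"

text \<open>
  The Koszul differential of a family \<open>z\<close>. The sign is the usual
  \<open>(-1)^(j+1)\<close> for \<open>t = t\<^sub>j\<close>, since exactly \<open>j - 1\<close> elements of \<open>T\<close> precede
  \<open>t\<^sub>j\<close>.
\<close>

definition koszul_diff ::
  "('n \<Rightarrow> 'c::comm_ring_1) \<Rightarrow> ('c, 'n::{finite,linorder}) ext \<Rightarrow> ('c, 'n) ext"
  where "koszul_diff z \<omega> =
    (\<Sum>T\<in>UNIV. \<Sum>t\<in>T. ext_basis (T - {t}) ((-1) ^ card {s\<in>T. s < t} * z t * \<omega> T))"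

definition ext_comp :: "nat \<Rightarrow> ('c::zero, 'n) ext set"
  where "ext_comp i = {\<omega>. \<forall>T. \<omega> T \<noteq> 0 \<longrightarrow> card T = i}"


section \<open>Polynomial rings\<close>

text \<open>
  \<open>R = k[x]\<close> and \<open>S = R[y]\<close>, with both families of variables indexed by \<open>'n\<close>
  (so \<open>n = CARD('n)\<close>), as monoid algebras on the monomials \<open>'n \<Rightarrow>\<^sub>0 nat\<close>.
  Consequently \<open>\<Lambda> \<otimes>\<^sub>R S\<close> is the exterior algebra over \<open>S\<close>.
\<close>

type_synonym ('k, 'n) R = "('n \<Rightarrow>\<^sub>0 nat) \<Rightarrow>\<^sub>0 'k"
type_synonym ('k, 'n) S = "('n \<Rightarrow>\<^sub>0 nat) \<Rightarrow>\<^sub>0 ('k, 'n) R"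
type_synonym ('k, 'n) LS = "(('k, 'n) S, 'n) ext"

definition const :: "'c::zero \<Rightarrow> ('n \<Rightarrow>\<^sub>0 nat) \<Rightarrow>\<^sub>0 'c"
  where "const r = Poly_Mapping.single 0 r"

definition var :: "'n \<Rightarrow> ('n \<Rightarrow>\<^sub>0 nat) \<Rightarrow>\<^sub>0 'c::zero_neq_one"
  where "var v = Poly_Mapping.single (Poly_Mapping.single v 1) 1"

definition deg :: "('n::finite \<Rightarrow>\<^sub>0 nat) \<Rightarrow> nat"
  where "deg \<mu> = (\<Sum>v\<in>UNIV. Poly_Mapping.lookup \<mu> v)"

definition poly_part ::
  "(nat \<Rightarrow> bool) \<Rightarrow> (('n::finite \<Rightarrow>\<^sub>0 nat) \<Rightarrow>\<^sub>0 'c::comm_monoid_add) \<Rightarrow> ('n \<Rightarrow>\<^sub>0 nat) \<Rightarrow>\<^sub>0 'c"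
  where "poly_part P q =
    (\<Sum>\<mu> | \<mu> \<in> Poly_Mapping.keys q \<and> P (deg \<mu>). Poly_Mapping.single \<mu> (Poly_Mapping.lookup q \<mu>))"

definition max_ideal :: "('k::field, 'n::finite) R set"
  where "max_ideal = ideal_gen (var ` UNIV)"

definition eps :: "('k::field, 'n::finite) S \<Rightarrow> ('k, 'n) R"
  where "eps q = (\<Sum>\<mu>\<in>Poly_Mapping.keys q.
    Poly_Mapping.lookup q \<mu> * (\<Prod>v\<in>UNIV. var v ^ Poly_Mapping.lookup \<mu> v))"


section \<open>The algebra \<open>\<Lambda> \<otimes> S\<close> and its truncations\<close>

definition kappa :: "('k::field, 'n::{finite,linorder}) LS \<Rightarrow> ('k, 'n) LS"
  where "kappa = koszul_diff var"

text \<open>This is \<open>kos \<otimes> 1\<close>.\<close>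

definition dkos :: "('k::field, 'n::{finite,linorder}) LS \<Rightarrow> ('k, 'n) LS"
  where "dkos = koszul_diff (\<lambda>v. const (var v))"

text \<open>
  The scaled de Rham differential. For a monomial \<open>y\<^sub>p\<^sub>1 \<dots> y\<^sub>p\<^sub>m\<close> with
  exponent vector \<open>\<mu>\<close>, the summands with \<open>p\<^sub>j = v\<close> all agree, and there are \<open>\<mu> v\<close> of
  them.
\<close>

definition sigma :: "('k::field, 'n::{finite,linorder}) LS \<Rightarrow> ('k, 'n) LS"
  where "sigma \<omega> =
    (\<Sum>T\<in>UNIV. \<Sum>\<mu>\<in>Poly_Mapping.keys (\<omega> T). \<Sum>v\<in>Poly_Mapping.keys \<mu>.
      ext_mult (ext_basis {v} 1)
        (ext_basis T (Poly_Mapping.single (\<mu> - Poly_Mapping.single v 1)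
          (const (of_nat (Poly_Mapping.lookup \<mu> v) / of_nat (card T + deg \<mu>))
            * Poly_Mapping.lookup (\<omega> T) \<mu>))))"

definition LS_comp :: "nat \<Rightarrow> nat \<Rightarrow> ('k::field, 'n::finite) LS set"
  where "LS_comp i m =
    {\<omega> \<in> ext_comp i. \<forall>T. \<forall>\<mu>\<in>Poly_Mapping.keys (\<omega> T). deg \<mu> = m}"

definition trunc :: "nat \<Rightarrow> ('k::field, 'n::finite) LS \<Rightarrow> ('k, 'n) LS"
  where "trunc c \<omega> = (\<lambda>T. poly_part (\<lambda>m. m < c) (\<omega> T))"

text \<open>
  The quotient of \<open>\<Lambda> \<otimes> S\<close> by the dg ideal of \<open>y\<close>-degrees \<open>\<ge> c\<close>, every class being
  represented by its unique member without terms of \<open>y\<close>-degree \<open>\<ge> c\<close>; thus \<open>trunc c\<close>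
  is the quotient map.
\<close>

definition X_dga :: "nat \<Rightarrow> (('k::field, 'n::{finite,linorder}) R, ('k, 'n) LS) dga"
  where "X_dga c = \<lparr>
    dg_comp = (\<lambda>i. {\<omega> \<in> ext_comp i. \<forall>T. \<forall>\<mu>\<in>Poly_Mapping.keys (\<omega> T). deg \<mu> < c}),
    dg_scale = (\<lambda>r \<omega> T. const r * \<omega> T),
    dg_diff = (\<lambda>\<omega>. trunc c (kappa \<omega> + dkos \<omega>)),
    dg_mult = (\<lambda>\<omega> \<omega>'. trunc c (ext_mult \<omega> \<omega>')),
    dg_one = ext_basis {} 1 \<rparr>"

definition pi_map :: "nat \<Rightarrow> nat \<Rightarrow> ('k::field, 'n::finite) LS \<Rightarrow> ('k, 'n) LS"
  where "pi_map b a = trunc a"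


section \<open>The complexes \<open>L\<^sub>c\<close>\<close>

text \<open>
  Elements of \<open>L\<^sub>c\<close> live in \<open>R \<times> (\<Lambda> \<otimes> S)\<close>: degree 0 is the first factor and degree
  \<open>i + 1\<close> is \<open>L_mod i c\<close> inside the second one. \<open>L_mod i c\<close> is zero for \<open>i \<ge> n\<close>.
\<close>

definition L_mod :: "nat \<Rightarrow> nat \<Rightarrow> ('k::field, 'n::{finite,linorder}) LS set"
  where "L_mod i c = kappa ` LS_comp (i + 1) (c - 1)"

text \<open>The sum in \<open>i_inf\<close> stops at \<open>c\<close> because \<open>sigma\<close> lowers the \<open>y\<close>-degree by one.\<close>

definition i_inf ::
  "nat \<Rightarrow> ('k::field, 'n::{finite,linorder}) R \<times> ('k, 'n) LS \<Rightarrow> ('k, 'n) LS"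
  where "i_inf c = (\<lambda>(r, \<alpha>).
    ext_basis {} (const r) + (\<Sum>j<c. ((\<lambda>\<omega>. - sigma (dkos \<omega>)) ^^ j) (sigma \<alpha>)))"

text \<open>
  Here \<open>\<omega> {}\<close> is the \<open>\<Lambda>\<^sup>0\<close>-component of \<open>\<omega>\<close>, and \<open>kappa\<close> vanishes on that
  component.
\<close>

definition p_inf ::
  "nat \<Rightarrow> ('k::field, 'n::{finite,linorder}) LS \<Rightarrow> ('k, 'n) R \<times> ('k, 'n) LS"
  where "p_inf c \<omega> = (eps (\<omega> {}), kappa (\<lambda>T. poly_part (\<lambda>m. m = c - 1) (\<omega> T)))"

text \<open>
  Signs. The underlying complex is \<open>L\<^sub>n\<^sub>-\<^sub>1 \<rightarrow> \<dots> \<rightarrow> L\<^sub>0 \<rightarrow> R\<close> with maps induced by \<open>dkos\<close> and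
  \<open>eps\<close>, except that these maps carry the signs \<open>-1\<close> and \<open>(-1)^(c+1)\<close>, respectively.
  This is the only choice making \<open>i_inf c\<close> commute with the differentials: as \<open>kappa\<close>
  and \<open>dkos\<close> anticommute, \<open>i_inf\<close> anticommutes with \<open>dkos\<close> on \<open>L_mod i c\<close> for
  \<open>i > 0\<close>, and the differential of \<open>X_dga c\<close> sends \<open>i_inf c (0, \<alpha>)\<close> to
  \<open>(-1)^(c-1) * eps (\<alpha> {})\<close> for \<open>\<alpha>\<close> in \<open>L_mod 0 c\<close>. Without the signs the product
  violates the Leibniz rule (already for \<open>c = 1\<close> and two variables). The complex with
  signs is isomorphic to the one without by rescaling each \<open>L_mod i c\<close> by
  \<open>(-1)^(c+1+i)\<close>.
\<close>

definition L_dga ::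
  "nat \<Rightarrow> (('k::field, 'n::{finite,linorder}) R, ('k, 'n) R \<times> ('k, 'n) LS) dga"
  where "L_dga c = \<lparr>
    dg_comp = (\<lambda>i. case i of 0 \<Rightarrow> UNIV \<times> {0} | Suc j \<Rightarrow> {0} \<times> L_mod j c),
    dg_scale = (\<lambda>r (s, \<alpha>). (r * s, \<lambda>T. const r * \<alpha> T)),
    dg_diff = (\<lambda>(r, \<alpha>). ((-1) ^ (c + 1) * eps (\<alpha> {}), - dkos \<alpha>)),
    dg_mult = (\<lambda>x y. p_inf c (dg_mult (X_dga c) (i_inf c x) (i_inf c y))),
    dg_one = (1, 0) \<rparr>"

definition L_aug ::
  "nat \<Rightarrow> ('k::field, 'n::{finite,linorder}) R \<times> ('k, 'n) LS \<Rightarrow> ('k, 'n) R set"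
  where "L_aug c x = residue (ideal_power max_ideal c) (fst x)"

definition f_map ::
  "nat \<Rightarrow> nat \<Rightarrow> ('k::field, 'n::{finite,linorder}) R \<times> ('k, 'n) LS
    \<Rightarrow> ('k, 'n) R \<times> ('k, 'n) LS"
  where "f_map b a = p_inf a \<circ> pi_map b a \<circ> i_inf b"


section \<open>The Koszul complex on the variables\<close>

definition koszul_dga :: "(('k::field, 'n::{finite,linorder}) R, (('k, 'n) R, 'n) ext) dga"
  where "koszul_dga = \<lparr>
    dg_comp = ext_comp,
    dg_scale = (\<lambda>r \<omega> T. r * \<omega> T),
    dg_diff = koszul_diff var,
    dg_mult = ext_mult,
    dg_one = ext_basis {} 1 \<rparr>"

text \<open>
  \<open>i_inf 1\<close> takes values in \<open>\<Lambda> \<otimes> S\<^sub>0\<close>, which is identified with \<open>\<Lambda>\<close> by taking constant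
  coefficients.
\<close>

definition L1_to_koszul ::
  "('k::field, 'n::{finite,linorder}) R \<times> ('k, 'n) LS \<Rightarrow> (('k, 'n) R, 'n) ext"
  where "L1_to_koszul x = (\<lambda>T. Poly_Mapping.lookup (i_inf 1 x T) 0)"

end

theory Submission
  imports Defs
begin

text \<open>
  Let \<open>\<delta>\<close> be the unscaled de Rham differential on \<open>\<Lambda> \<otimes> S\<close>. It is a derivation with
  \<open>\<kappa>\<delta> + \<delta>\<kappa> = i + m\<close> on \<open>\<Lambda>\<^sup>i \<otimes> S\<^sub>m\<close>, and it lowers the \<open>y\<close>-degree by one; so the
  truncation of a closed form is closed. Hence
  \<open>Z\<^sub>c = {\<omega> \<in> X\<^sub>c. \<delta>\<omega> = 0 \<and> \<delta>(\<partial>\<omega>) = 0}\<close> is a sub dg algebra of \<open>X\<^sub>c\<close>, and the quotient map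
  \<open>X\<^sub>b \<rightarrow> X\<^sub>a\<close> carries \<open>Z\<^sub>b\<close> into \<open>Z\<^sub>a\<close>. In components, \<open>\<omega> \<in> Z\<^sub>c\<close> of positive degree means that
  \<open>\<omega>\<^sub>m\<^sub>-\<^sub>1 = - \<sigma>d \<omega>\<^sub>m\<close>, which is the recursion solved by \<open>i\<^sub>\<infinity>\<close>. Therefore \<open>i\<^sub>\<infinity>\<close> and \<open>p\<^sub>\<infinity>\<close> restrict to mutually
  inverse isomorphisms between \<open>L\<^sub>c\<close> and \<open>Z\<^sub>c\<close>, and \<open>f\<^sub>b\<^sub>,\<^sub>a\<close> is the restriction of \<open>\<pi>\<^sub>b\<^sub>,\<^sub>a\<close> to \<open>Z\<^sub>b\<close>:
  both multiplicativity and functoriality become evident.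
\<close>

text \<open>The detour through closed forms is forced because \<open>p_inf\<close> is not
  multiplicative on all of \<open>X_dga c\<close>: for c = 2 and n at least 2 it kills e_1 \<otimes>
  1, but not its product with e_2 \<otimes> y_1. No dg algebra axiom is presupposed for L_c either;
  associativity, the Leibniz rule and the rest are inherited from Z_c, hence from X_c, which is a
  truncated Koszul algebra. Two facts make Z_c exactly as large as L_c. On closed forms
  \<delta>\<kappa> is multiplication by i + m, so \<kappa> loses nothing; and the truncation
  discards \<kappa> of the component of y-degree c - 1, so this component is bound by closedness
  alone and the others follow from it. In exterior degree 0, where \<kappa> vanishes, the same
  factor kills every component of positive y-degree and leaves R. The integers to be inverted are
  total degrees i + m of nonzero bihomogeneous forms in X_c or of their images under \<kappa>, so at
  most n + c - 1. This is the origin of the bound on the characteristic.\<close>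

lemma sum_fun_apply: "(\<Sum>a\<in>A. f a) x = (\<Sum>a\<in>A. f a x)"
  by (induction A rule: infinite_finite_induct) auto

section \<open>Exterior algebras\<close>

text \<open>
  The induction methods leave goals in eta-long form, in which these simplification rules unfold the
  additive operations on functions.
\<close>

lemmas fun_apply_simps = plus_fun_apply zero_fun_apply minus_apply uminus_apply

definition ext_scale :: "'c::comm_ring_1 \<Rightarrow> ('c, 'n) ext \<Rightarrow> ('c, 'n) ext"
  where "ext_scale q \<omega> = (\<lambda>T. q * \<omega> T)"

text \<open>The sign of moving e_v past the factors of e_T that precede it. It does not depend on
  whether v lies in T, so the same sign serves for adjoining v and for deleting it.\<close>

definition pre_sign :: "'n::linorder \<Rightarrow> 'n set \<Rightarrow> 'c::comm_ring_1"
  where "pre_sign v T = (-1) ^ card {s\<in>T. s < v}"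

definition wedge :: "'n::linorder \<Rightarrow> ('c::comm_ring_1, 'n) ext \<Rightarrow> ('c, 'n) ext"
  where "wedge v \<omega> = (\<lambda>T. if v \<in> T then pre_sign v T * \<omega> (T - {v}) else 0)"

text \<open>The grading involution, equal to (-1)^i on \<Lambda>^i. It gives the Leibniz rules a
  form that is meaningful for inhomogeneous elements, as an induction by \<open>ext_induct\<close>
  demands.\<close>

definition parity :: "('c::comm_ring_1, 'n) ext \<Rightarrow> ('c, 'n) ext"
  where "parity \<omega> = (\<lambda>T. (-1) ^ card T * \<omega> T)"

lemma pre_sign_square [simp]: "pre_sign v T * (pre_sign v T * q) = (q::'c::comm_ring_1)"
    "pre_sign v T * pre_sign v T = (1::'c::comm_ring_1)"
  by (simp_all add: pre_sign_def mult.assoc[symmetric] power_add[symmetric])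

lemma pre_sign_empty [simp]: "pre_sign v {} = 1"
  by (simp add: pre_sign_def)

lemma pre_sign_insert:
  fixes T :: "'n::{finite,linorder} set"
  assumes "w \<notin> T"
  shows "pre_sign v (insert w T) = (if w < v then - pre_sign v T else pre_sign v T :: 'c::comm_ring_1)"
proof -
  have "{s \<in> insert w T. s < v} = (if w < v then insert w {s\<in>T. s < v} else {s\<in>T. s < v})"
    by auto
  then show ?thesis using assms by (simp add: pre_sign_def)
qed

lemma pre_sign_remove:
  fixes T :: "'n::{finite,linorder} set"
  assumes "w \<in> T"
  shows "pre_sign v (T - {w}) = (if w < v then - pre_sign v T else pre_sign v T :: 'c::comm_ring_1)"
  using pre_sign_insert[of w "T - {w}" v, where 'c = 'c] assms
  by (simp add: insert_absorb split: if_splits)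

section \<open>Coordinate formulas for products and Koszul differentials\<close>

lemma ext_mult_apply:
  "ext_mult \<omega> \<omega>' W = (\<Sum>T\<in>Pow W. shuffle_sign T (W - T) * \<omega> T * \<omega>' (W - T))"
proof -
  have "(\<Sum>U\<in>UNIV. (if T \<inter> U = {} then ext_basis (T \<union> U) (shuffle_sign T U * \<omega> T * \<omega>' U) else 0) W)
      = (if T \<in> Pow W then shuffle_sign T (W - T) * \<omega> T * \<omega>' (W - T) else 0)" for T
  proof -
    have "(\<Sum>U\<in>UNIV. (if T \<inter> U = {} then ext_basis (T \<union> U) (shuffle_sign T U * \<omega> T * \<omega>' U) else 0) W)
      = (\<Sum>U\<in>UNIV. if U = W - T then (if T \<in> Pow W then shuffle_sign T (W - T) * \<omega> T * \<omega>' (W - T) else 0) else 0)"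
      by (rule sum.cong) (auto simp: ext_basis_def)
    then show ?thesis by simp
  qed
  then have "ext_mult \<omega> \<omega>' W = (\<Sum>T\<in>UNIV. if T \<in> Pow W then shuffle_sign T (W - T) * \<omega> T * \<omega>' (W - T) else 0)"
    by (simp only: ext_mult_def sum_fun_apply)
  then show ?thesis by (simp add: sum.If_cases Pow_def)
qed

lemma koszul_diff_apply:
  "koszul_diff z \<omega> W = (\<Sum>t\<in>- W. z t * pre_sign t W * \<omega> (insert t W))"
proof -
  have *: "(\<Sum>t\<in>T. ext_basis (T - {t}) ((-1) ^ card {s\<in>T. s < t} * z t * \<omega> T) W)
      = (\<Sum>t\<in>UNIV. if T = insert t W \<and> t \<notin> W then z t * pre_sign t W * \<omega> (insert t W) else 0)" for T
  proof -
    have "(\<Sum>t\<in>T. ext_basis (T - {t}) ((-1) ^ card {s\<in>T. s < t} * z t * \<omega> T) W)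
      = (\<Sum>t\<in>T. if T = insert t W \<and> t \<notin> W then z t * pre_sign t W * \<omega> (insert t W) else 0)"
    proof (rule sum.cong)
      fix t assume t: "t \<in> T"
      have "(W = T - {t}) = (T = insert t W \<and> t \<notin> W)" using t by auto
      moreover have "{s. (s = t \<or> s \<in> W) \<and> s < t} = {s\<in>W. s < t}" for W by auto
      ultimately show "ext_basis (T - {t}) ((-1) ^ card {s\<in>T. s < t} * z t * \<omega> T) W
        = (if T = insert t W \<and> t \<notin> W then z t * pre_sign t W * \<omega> (insert t W) else 0)"
        by (auto simp: ext_basis_def pre_sign_def algebra_simps)
    qed simp
    also have "\<dots> = (\<Sum>t\<in>UNIV. if T = insert t W \<and> t \<notin> W then z t * pre_sign t W * \<omega> (insert t W) else 0)"
      by (rule sum.mono_neutral_left) auto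
    finally show ?thesis .
  qed
  have "koszul_diff z \<omega> W = (\<Sum>t\<in>UNIV. \<Sum>T\<in>UNIV. if T = insert t W \<and> t \<notin> W then z t * pre_sign t W * \<omega> (insert t W) else 0)"
    unfolding koszul_diff_def sum_fun_apply * by (rule sum.swap)
  also have "\<dots> = (\<Sum>t\<in>UNIV. if t \<in> - W then z t * pre_sign t W * \<omega> (insert t W) else 0)"
  proof (rule sum.cong)
    fix t
    show "(\<Sum>T\<in>UNIV. if T = insert t W \<and> t \<notin> W then z t * pre_sign t W * \<omega> (insert t W) else 0)
      = (if t \<in> - W then z t * pre_sign t W * \<omega> (insert t W) else 0)"
      by (cases "t \<in> W") auto
  qed simp
  finally show ?thesis by (simp add: sum.If_cases Compl_eq)
qed

lemma shuffle_sign_singleton: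
  "v \<in> W \<Longrightarrow> shuffle_sign {v} (W - {v}) = (pre_sign v W :: 'c::comm_ring_1)"
proof -
  have "{(t, u). t \<in> {v} \<and> u \<in> W - {v} \<and> u < t} = Pair v ` {s\<in>W. s < v}" by auto
  then show ?thesis
    by (simp add: shuffle_sign_def pre_sign_def card_image inj_on_def del: singleton_iff)
qed

lemma ext_mult_generator: "ext_mult (ext_basis {v} q) \<omega> = ext_scale q (wedge v \<omega>)"
proof
  fix W
  have "ext_mult (ext_basis {v} q) \<omega> W
    = (\<Sum>T\<in>Pow W. if T = {v} then shuffle_sign {v} (W - {v}) * q * \<omega> (W - {v}) else 0)"
    unfolding ext_mult_apply by (rule sum.cong) (auto simp: ext_basis_def)
  then show "ext_mult (ext_basis {v} q) \<omega> W = ext_scale q (wedge v \<omega>) W"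
    by (simp add: sum.delta ext_scale_def wedge_def shuffle_sign_singleton algebra_simps)
qed

lemma ext_mult_scalar: "ext_mult (ext_basis {} q) \<omega> = ext_scale q \<omega>"
proof
  fix W
  have "ext_mult (ext_basis {} q) \<omega> W
    = (\<Sum>T\<in>Pow W. if T = {} then q * \<omega> W else 0)"
    unfolding ext_mult_apply by (rule sum.cong) (auto simp: ext_basis_def shuffle_sign_def)
  then show "ext_mult (ext_basis {} q) \<omega> W = ext_scale q \<omega> W"
    by (simp add: sum.delta ext_scale_def)
qed

lemma ext_mult_add_left: "ext_mult (\<omega> + \<eta>) \<theta> = ext_mult \<omega> \<theta> + ext_mult \<eta> \<theta>"
  by (rule ext) (simp add: ext_mult_apply algebra_simps sum.distrib)

lemma ext_mult_add_right: "ext_mult \<theta> (\<omega> + \<eta>) = ext_mult \<theta> \<omega> + ext_mult \<theta> \<eta>"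
  by (rule ext) (simp add: ext_mult_apply algebra_simps sum.distrib)

lemma ext_mult_zero_left [simp]: "ext_mult 0 \<omega> = 0"
  and ext_mult_zero_right [simp]: "ext_mult \<omega> 0 = 0"
  by (rule ext, simp add: ext_mult_apply)+

lemma ext_mult_scale_left: "ext_mult (ext_scale q \<omega>) \<theta> = ext_scale q (ext_mult \<omega> \<theta>)"
  by (rule ext) (simp add: ext_mult_apply ext_scale_def sum_distrib_left algebra_simps)

lemma ext_mult_scale_right: "ext_mult \<omega> (ext_scale q \<theta>) = ext_scale q (ext_mult \<omega> \<theta>)"
  by (rule ext) (simp add: ext_mult_apply ext_scale_def sum_distrib_left algebra_simps)

lemma ext_mult_diff_left: "ext_mult (\<omega> - \<eta>) \<theta> = ext_mult \<omega> \<theta> - ext_mult \<eta> \<theta>"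
  by (rule ext) (simp add: ext_mult_apply algebra_simps sum_subtractf)

lemma ext_mult_minus_left: "ext_mult (- \<omega>) \<theta> = - ext_mult \<omega> \<theta>"
  by (rule ext) (simp add: ext_mult_apply sum_negf)

section \<open>Associativity, graded commutativity and squares of odd elements\<close>

lemma card_inversions_Un:
  fixes T :: "'n::{finite,linorder} set"
  assumes "T \<inter> U = {}"
  shows "card {(t, u). t \<in> T \<union> U \<and> u \<in> V \<and> u < t}
      = card {(t, u). t \<in> T \<and> u \<in> V \<and> u < t} + card {(t, u). t \<in> U \<and> u \<in> V \<and> u < t}"
    and "card {(t, u). t \<in> V \<and> u \<in> T \<union> U \<and> u < t}
      = card {(t, u). t \<in> V \<and> u \<in> T \<and> u < t} + card {(t, u). t \<in> V \<and> u \<in> U \<and> u < t}"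
  by (subst card_Un_disjoint[symmetric]; use assms in \<open>auto intro!: arg_cong[where f = card]\<close>)+

lemma shuffle_sign_Un:
  fixes T :: "'n::{finite,linorder} set"
  assumes "T \<inter> U = {}"
  shows "shuffle_sign (T \<union> U) V = (shuffle_sign T V * shuffle_sign U V :: 'c::comm_ring_1)"
    and "shuffle_sign V (T \<union> U) = (shuffle_sign V T * shuffle_sign V U :: 'c::comm_ring_1)"
  using card_inversions_Un[OF assms, of V] by (simp_all add: shuffle_sign_def power_add)

text \<open>Both sides run over the ordered partitions of \<open>W\<close> into three blocks.
  Shuffle signs are multiplicative in each argument, so either bracketing produces the product of
  the three pairwise signs.\<close>

lemma ext_mult_assoc:
  fixes \<omega> :: "('c::comm_ring_1, 'n::{finite,linorder}) ext"
  shows "ext_mult (ext_mult \<omega> \<eta>) \<theta> = ext_mult \<omega> (ext_mult \<eta> \<theta>)"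
proof
  fix W
  have "ext_mult (ext_mult \<omega> \<eta>) \<theta> W = (\<Sum>T\<in>Pow W. \<Sum>U\<in>Pow T.
      shuffle_sign T (W - T) * (shuffle_sign U (T - U) * \<omega> U * \<eta> (T - U)) * \<theta> (W - T))"
    by (simp add: ext_mult_apply sum_distrib_left sum_distrib_right)
  also have "\<dots> = (\<Sum>(T, U)\<in>(SIGMA T:Pow W. Pow T).
      shuffle_sign T (W - T) * (shuffle_sign U (T - U) * \<omega> U * \<eta> (T - U)) * \<theta> (W - T))"
    by (rule sum.Sigma) auto
  also have "\<dots> = (\<Sum>(U, V)\<in>(SIGMA U:Pow W. Pow (W - U)).
      shuffle_sign U (W - U) * \<omega> U * (shuffle_sign V (W - U - V) * \<eta> V * \<theta> (W - U - V)))"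
  proof (rule sum.reindex_bij_witness[where i = "\<lambda>(U, V). (U \<union> V, U)" and j = "\<lambda>(T, U). (U, T - U)"])
    fix p :: "'n set \<times> 'n set" assume p: "p \<in> (SIGMA T:Pow W. Pow T)"
    obtain T U where TU: "p = (T, U)" by force
    have T: "T = U \<union> (T - U)" and W: "W - U = (T - U) \<union> (W - T)" and W': "W - U - (T - U) = W - T"
      using p TU by auto
    have "shuffle_sign U (W - U) = (shuffle_sign U (T - U) * shuffle_sign U (W - T) :: 'c)"
      by (subst W) (rule shuffle_sign_Un, auto)
    moreover have "shuffle_sign T (W - T) = (shuffle_sign U (W - T) * shuffle_sign (T - U) (W - T) :: 'c)"
      by (subst (1) T) (rule shuffle_sign_Un, auto)
    ultimately show "(case (case p of (T, U) \<Rightarrow> (U, T - U)) of (U, V) \<Rightarrow>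
        shuffle_sign U (W - U) * \<omega> U * (shuffle_sign V (W - U - V) * \<eta> V * \<theta> (W - U - V)))
      = (case p of (T, U) \<Rightarrow>
        shuffle_sign T (W - T) * (shuffle_sign U (T - U) * \<omega> U * \<eta> (T - U)) * \<theta> (W - T))"
      by (simp add: TU W' algebra_simps)
  qed auto
  also have "\<dots> = (\<Sum>U\<in>Pow W. \<Sum>V\<in>Pow (W - U).
      shuffle_sign U (W - U) * \<omega> U * (shuffle_sign V (W - U - V) * \<eta> V * \<theta> (W - U - V)))"
    by (rule sum.Sigma[symmetric]) auto
  also have "\<dots> = ext_mult \<omega> (ext_mult \<eta> \<theta>) W"
    by (simp add: ext_mult_apply sum_distrib_left)
  finally show "ext_mult (ext_mult \<omega> \<eta>) \<theta> W = ext_mult \<omega> (ext_mult \<eta> \<theta>) W" .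
qed

text \<open>Every pair in \<open>T \<times> U\<close> is an inversion for exactly one of the two
  orders, so the two inversion counts add up to the product of the cardinalities.\<close>

lemma shuffle_sign_commute:
  fixes T :: "'n::{finite,linorder} set"
  assumes "T \<inter> U = {}"
  shows "shuffle_sign T U = ((-1) ^ (card T * card U) * shuffle_sign U T :: 'c::comm_ring_1)"
proof -
  let ?A = "{(t, u). t \<in> T \<and> u \<in> U \<and> u < t}" and ?B = "{(u, t). u \<in> U \<and> t \<in> T \<and> t < u}"
  have "T \<times> U = ?A \<union> prod.swap ` ?B" using assms by (auto simp: image_iff)
  moreover have "?A \<inter> prod.swap ` ?B = {}" by auto
  ultimately have "card (T \<times> U) = card ?A + card (prod.swap ` ?B)"
    by (simp only: card_Un_disjoint[OF finite finite])
  then have "card T * card U = card ?A + card (prod.swap ` ?B)"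
    by (simp only: card_cartesian_product)
  also have "card (prod.swap ` ?B) = card ?B" by (simp add: card_image)
  finally have *: "card T * card U = card ?A + card ?B" .
  have "((-1) ^ card ?B * (-1) ^ card ?B :: 'c) = 1"
    by (simp add: power_mult_distrib[symmetric])
  then show ?thesis unfolding shuffle_sign_def * power_add by (simp add: mult.assoc)
qed

lemma ext_mult_graded_commute:
  fixes \<omega> :: "('c::comm_ring_1, 'n::{finite,linorder}) ext"
  assumes "\<omega> \<in> ext_comp i" "\<eta> \<in> ext_comp j"
  shows "ext_mult \<omega> \<eta> = ext_scale ((-1) ^ (i * j)) (ext_mult \<eta> \<omega>)"
proof
  fix W
  have "ext_mult \<omega> \<eta> W = (\<Sum>T\<in>Pow W. (-1) ^ (i * j) * (shuffle_sign T (W - T) * \<eta> T * \<omega> (W - T)))"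
    unfolding ext_mult_apply
  proof (rule sum.reindex_bij_witness[where i = "\<lambda>T. W - T" and j = "\<lambda>T. W - T"])
    fix T assume "T \<in> Pow W"
    then have W: "W - (W - T) = T" by auto
    have "shuffle_sign T (W - T) = ((-1) ^ (card T * card (W - T)) * shuffle_sign (W - T) T :: 'c)"
      by (rule shuffle_sign_commute) auto
    then show "(-1) ^ (i * j) * (shuffle_sign (W - T) (W - (W - T)) * \<eta> (W - T) * \<omega> (W - (W - T)))
        = shuffle_sign T (W - T) * \<omega> T * \<eta> (W - T)"
      using assms unfolding W ext_comp_def
      by (cases "\<omega> T = 0 \<or> \<eta> (W - T) = 0") auto
  qed auto
  then show "ext_mult \<omega> \<eta> W = ext_scale ((-1) ^ (i * j)) (ext_mult \<eta> \<omega>) W"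
    by (simp add: ext_scale_def ext_mult_apply sum_distrib_left)
qed

lemma ext_mult_comp:
  assumes "\<omega> \<in> ext_comp i" "\<eta> \<in> ext_comp j"
  shows "ext_mult \<omega> \<eta> \<in> ext_comp (i + j)"
  unfolding ext_comp_def
proof (clarify)
  fix W assume "ext_mult \<omega> \<eta> W \<noteq> 0"
  then obtain T where T: "T \<subseteq> W" "shuffle_sign T (W - T) * \<omega> T * \<eta> (W - T) \<noteq> 0"
    unfolding ext_mult_apply by (meson PowD sum.not_neutral_contains_not_neutral)
  then have "\<omega> T \<noteq> 0" "\<eta> (W - T) \<noteq> 0" by auto
  then have "card T = i" "card (W - T) = j" using assms by (auto simp: ext_comp_def)
  moreover have "card W = card T + card (W - T)" using T(1)
    by (metis card_Diff_subset card_mono finite le_add_diff_inverse)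
  ultimately show "card W = i + j" by simp
qed

lemma ext_mult_basis_self: "T \<noteq> {} \<Longrightarrow> ext_mult (ext_basis T q) (ext_basis T r) = 0"
  by (rule ext) (auto simp: ext_mult_apply ext_basis_def intro!: sum.neutral split: if_splits)

text \<open>Graded commutativity only says that twice the square is 0, which is too weak in the
  presence of 2-torsion. Expanding in the basis instead, the mixed products cancel in pairs and each
  diagonal product repeats a generator.\<close>

lemma ext_mult_odd_square:
  assumes "\<omega> \<in> ext_comp i" "odd i"
  shows "ext_mult \<omega> \<omega> = 0"
proof -
  have "ext_mult (\<lambda>T. if T \<in> F then \<omega> T else 0) (\<lambda>T. if T \<in> F then \<omega> T else 0) = 0" (is "ext_mult (?r F) (?r F) = 0")
    if "finite F" for F
    using that
  proof (induction F)
    case empty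
    then show ?case by (simp flip: zero_fun_def)
  next
    case (insert T F)
    let ?b = "ext_basis T (\<omega> T)"
    have split: "?r (insert T F) = ?b + ?r F" using insert by (auto simp: ext_basis_def)
    have c: "?r F \<in> ext_comp i" "?b \<in> ext_comp i" using assms by (auto simp: ext_comp_def ext_basis_def)
    have "ext_mult ?b (?r F) = - ext_mult (?r F) ?b"
      using ext_mult_graded_commute[OF c(2,1)] \<open>odd i\<close> by (simp add: ext_scale_def fun_eq_iff)
    moreover have "ext_mult ?b ?b = 0"
    proof (cases "\<omega> T = 0")
      case True
      then show ?thesis by (auto simp: ext_mult_apply ext_basis_def fun_eq_iff intro!: sum.neutral)
    next
      case False
      \<comment> \<open>The empty set is the only index whose basis element has a nonzero square;
        its cardinality is even.\<close>
      then have "T \<noteq> {}" using assms by (auto simp: ext_comp_def)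
      then show ?thesis by (rule ext_mult_basis_self)
    qed
    ultimately show ?case using insert.IH
      unfolding split by (simp del: fun_apply_simps add: ext_mult_add_left ext_mult_add_right)
  qed
  from this[of UNIV] show ?thesis by simp
qed

section \<open>Left multiplication by generators, and induction along it\<close>

lemma ext_basis_sum: "\<omega> = (\<Sum>T\<in>UNIV. ext_basis T (\<omega> (T::'n::finite set)))"
  by (rule ext) (simp add: sum_fun_apply ext_basis_def)

lemma wedge_basis:
  fixes q :: "'c::comm_ring_1"
  assumes "v \<notin> T" "\<And>t. t \<in> T \<Longrightarrow> v < t"
  shows "wedge v (ext_basis T q) = ext_basis (insert v T) q"
proof -
  have "{s \<in> insert v T. s < v} = {}" using assms by fastforce
  then have "pre_sign v (insert v T) = (1 :: 'c)" unfolding pre_sign_def by (simp only: card.empty power_0)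
  moreover have "(v \<in> U \<and> U - {v} = T) = (U = insert v T)" for U using assms by auto
  ultimately show ?thesis by (auto simp: wedge_def ext_basis_def fun_eq_iff)
qed

text \<open>Scalars and repeated left multiplications by generators span the exterior algebra
  additively. An identity between additive operators thus reduces to their commutation rules with
  \<open>wedge\<close>.\<close>

lemma ext_induct [case_names scalar wedge add]:
  fixes \<omega> :: "('c::comm_ring_1, 'n::{finite,linorder}) ext"
  assumes scalar: "\<And>q. P (ext_basis {} q)"
    and wedge: "\<And>v \<omega>. P \<omega> \<Longrightarrow> P (wedge v \<omega>)"
    and add: "\<And>\<omega> \<eta>. P \<omega> \<Longrightarrow> P \<eta> \<Longrightarrow> P (\<omega> + \<eta>)"
  shows "P \<omega>"
proof -
  have basis: "P (ext_basis T q)" for T q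
  proof (induction T rule: finite_linorder_min_induct[OF finite])
    case 1
    show ?case by (rule scalar)
  next
    \<comment> \<open>The new index lies below all of \<open>T\<close>, so that e_v \<and> e_T is a
      basis element without a sign.\<close>
    case (2 v T)
    then have "wedge v (ext_basis T q) = ext_basis (insert v T) q"
      by (intro wedge_basis) auto
    then show ?case using wedge[OF 2(3), of v] by simp
  qed
  have zero: "P 0" using scalar[of 0] by (simp add: ext_basis_def flip: zero_fun_def)
  have "P (\<Sum>T\<in>F. ext_basis T (\<omega> T))" if "finite F" for F
    using that by (induction F) (auto simp del: fun_apply_simps intro: zero add basis)
  then show ?thesis by (subst ext_basis_sum) simp
qed

lemma wedge_add: "wedge v (\<omega> + \<eta>) = wedge v \<omega> + wedge v \<eta>"
  by (rule ext) (simp add: wedge_def algebra_simps)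

lemma wedge_minus: "wedge v (- \<omega>) = - wedge v \<omega>"
  by (rule ext) (simp add: wedge_def)

lemma wedge_zero [simp]: "wedge v 0 = 0"
  by (rule ext) (simp add: wedge_def)

lemma wedge_scale: "wedge v (ext_scale q \<omega>) = ext_scale q (wedge v \<omega>)"
  by (rule ext) (simp add: wedge_def ext_scale_def algebra_simps)

lemma wedge_self: "wedge v (wedge v \<omega>) = 0"
  by (rule ext) (simp add: wedge_def)

text \<open>Deleting the smaller of the two indices flips the sign attached to the larger one, while
  deleting the larger leaves the sign of the smaller alone.\<close>

lemma wedge_anticommute:
  fixes \<omega> :: "('c::comm_ring_1, 'n::{finite,linorder}) ext"
  shows "wedge v (wedge w \<omega>) = - wedge w (wedge v \<omega>)"
proof (cases "v = w")
  case False
  show ?thesis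
  proof
    fix W
    show "wedge v (wedge w \<omega>) W = (- wedge w (wedge v \<omega>)) W"
    proof (cases "v \<in> W \<and> w \<in> W")
      case True
      have "W - {w} - {v} = W - {v} - {w}" by auto
      then have "wedge v (wedge w \<omega>) W = pre_sign v W * (pre_sign w (W - {v}) * \<omega> (W - {v} - {w}))"
        "wedge w (wedge v \<omega>) W = pre_sign w W * (pre_sign v (W - {w}) * \<omega> (W - {v} - {w}))"
        using True False by (simp_all only: wedge_def) auto
      then show ?thesis using False True
        by (cases v w rule: linorder_cases) (simp_all add: pre_sign_remove mult_ac order_less_not_sym)
    qed (auto simp: wedge_def)
  qed
qed (simp add: wedge_self)

lemma wedge_mult: "wedge v (ext_mult \<omega> \<eta>) = ext_mult (wedge v \<omega>) \<eta>"
  using ext_mult_assoc[of "ext_basis {v} 1" \<omega> \<eta>] by (simp add: ext_mult_generator ext_scale_def)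

section \<open>Koszul differentials as antiderivations\<close>

lemma koszul_diff_add: "koszul_diff z (\<omega> + \<eta>) = koszul_diff z \<omega> + koszul_diff z \<eta>"
  by (rule ext) (simp add: koszul_diff_apply algebra_simps sum.distrib)

lemma koszul_diff_diff: "koszul_diff z (\<omega> - \<eta>) = koszul_diff z \<omega> - koszul_diff z \<eta>"
  by (rule ext) (simp add: koszul_diff_apply algebra_simps sum_subtractf)

lemma koszul_diff_minus: "koszul_diff z (- \<omega>) = - koszul_diff z \<omega>"
  by (rule ext) (simp add: koszul_diff_apply sum_negf)

lemma koszul_diff_zero [simp]: "koszul_diff z 0 = 0"
  by (rule ext) (simp add: koszul_diff_apply)

lemma koszul_diff_scale: "koszul_diff z (ext_scale q \<omega>) = ext_scale q (koszul_diff z \<omega>)"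
  by (rule ext) (simp add: koszul_diff_apply ext_scale_def sum_distrib_left algebra_simps)

lemma koszul_diff_scalar [simp]: "koszul_diff z (ext_basis {} q) = 0"
  by (rule ext) (simp add: koszul_diff_apply ext_basis_def)

lemma koszul_diff_plus: "koszul_diff (\<lambda>v. z v + w v) \<omega> = koszul_diff z \<omega> + koszul_diff w \<omega>"
  by (rule ext) (simp add: koszul_diff_apply algebra_simps sum.distrib)

lemma koszul_diff_comp_Suc:
  assumes "\<omega> \<in> ext_comp (Suc i)" shows "koszul_diff z \<omega> \<in> ext_comp i"
  unfolding ext_comp_def
proof (clarify)
  fix W assume "koszul_diff z \<omega> W \<noteq> 0"
  then obtain t where t: "t \<notin> W" "\<omega> (insert t W) \<noteq> 0"
    unfolding koszul_diff_apply
    by (metis (no_types, lifting) ComplD mult_zero_right sum.not_neutral_contains_not_neutral)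
  then have "card (insert t W) = Suc i" using assms unfolding ext_comp_def by blast
  with t show "card W = i" by simp
qed

lemma koszul_diff_comp_0:
  assumes "\<omega> \<in> ext_comp 0" shows "koszul_diff z \<omega> = 0"
proof
  fix W
  have "\<omega> (insert t W) = 0" for t
  proof (rule ccontr)
    assume "\<omega> (insert t W) \<noteq> 0"
    then have "card (insert t W) = 0" using assms unfolding ext_comp_def by blast
    then show False by simp
  qed
  then show "koszul_diff z \<omega> W = 0 W" by (simp add: koszul_diff_apply)
qed

text \<open>Contraction with a linear form is an antiderivation. The anticommutation, square-zero
  and Leibniz rules below follow from this single commutation rule through
  \<open>ext_induct\<close>.\<close>

lemma koszul_diff_wedge:
  "koszul_diff z (wedge v \<omega>) = ext_scale (z v) \<omega> - wedge v (koszul_diff z \<omega>)"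
proof
  fix W
  show "koszul_diff z (wedge v \<omega>) W = (ext_scale (z v) \<omega> - wedge v (koszul_diff z \<omega>)) W"
  proof (cases "v \<in> W")
    case False
    \<comment> \<open>As v is missing from \<open>W\<close>, a summand survives only if inserting t
      supplies v.\<close>
    have "koszul_diff z (wedge v \<omega>) W = (\<Sum>t\<in>-W. if t = v then z v * \<omega> W else 0)"
      unfolding koszul_diff_apply
    proof (rule sum.cong)
      fix t assume "t \<in> - W"
      with False show "z t * pre_sign t W * wedge v \<omega> (insert t W) = (if t = v then z v * \<omega> W else 0)"
        by (auto simp: wedge_def pre_sign_insert mult.assoc)
    qed simp
    then show ?thesis using False by (simp add: ext_scale_def wedge_def)
  next
    case True
    \<comment> \<open>Seen from \<open>W - {v}\<close>, the index v is one more summand of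
      \<open>koszul_diff z \<omega>\<close>. It yields the scalar term; the remaining summands match
      those of the left side with opposite sign.\<close>
    then have C: "- (W - {v}) = insert v (- W)" by auto
    have W: "insert v (W - {v}) = W" using True by auto
    have "pre_sign v W * koszul_diff z \<omega> (W - {v})
      = z v * \<omega> W + (\<Sum>t\<in>-W. pre_sign v W * (z t * pre_sign t (W - {v}) * \<omega> (insert t (W - {v}))))"
      using True W by (simp add: koszul_diff_apply C pre_sign_remove algebra_simps sum_distrib_left)
    also have "(\<Sum>t\<in>-W. pre_sign v W * (z t * pre_sign t (W - {v}) * \<omega> (insert t (W - {v}))))
      = (\<Sum>t\<in>-W. - (z t * pre_sign t W * wedge v \<omega> (insert t W)))"
    proof (rule sum.cong)
      fix t assume t: "t \<in> - W"
      then have "insert t W - {v} = insert t (W - {v})" "t \<noteq> v" "t \<notin> W" using True by auto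
      then have "wedge v \<omega> (insert t W) = pre_sign v (insert t W) * \<omega> (insert t (W - {v}))"
        using True by (simp add: wedge_def)
      with \<open>t \<noteq> v\<close> show "pre_sign v W * (z t * pre_sign t (W - {v}) * \<omega> (insert t (W - {v})))
        = - (z t * pre_sign t W * wedge v \<omega> (insert t W))"
        unfolding pre_sign_insert[OF \<open>t \<notin> W\<close>] pre_sign_remove[OF True]
        by (cases t v rule: linorder_cases) (simp_all add: mult_ac order_less_not_sym)
    qed simp
    finally show ?thesis using True
      by (simp add: ext_scale_def wedge_def koszul_diff_apply sum_negf)
  qed
qed

lemma ext_scale_simps:
  "ext_scale q (\<omega> + \<eta>) = ext_scale q \<omega> + ext_scale q \<eta>"
  "ext_scale q (\<omega> - \<eta>) = ext_scale q \<omega> - ext_scale q \<eta>"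
  "ext_scale q (- \<omega>) = - ext_scale q \<omega>"
  "ext_scale (q + r) \<omega> = ext_scale q \<omega> + ext_scale r \<omega>"
  "ext_scale (- q) \<omega> = - ext_scale q \<omega>"
  "ext_scale q (ext_scale r \<omega>) = ext_scale (q * r) \<omega>"
  "ext_scale 1 \<omega> = \<omega>"
  "ext_scale 0 \<omega> = 0"
  "ext_scale q 0 = 0"
  "ext_scale q (ext_basis T r) = ext_basis T (q * r)"
  by (rule ext, simp add: ext_scale_def algebra_simps ext_basis_def)+

lemma koszul_diff_anticommute:
  "koszul_diff z (koszul_diff w \<omega>) = - koszul_diff w (koszul_diff z \<omega>)"
  by (induction \<omega> rule: ext_induct)
    (simp_all del: fun_apply_simps add: koszul_diff_wedge koszul_diff_add koszul_diff_diff koszul_diff_scale wedge_minus)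

lemma koszul_diff_square: "koszul_diff z (koszul_diff z \<omega>) = 0"
  by (induction \<omega> rule: ext_induct)
    (simp_all del: fun_apply_simps add: koszul_diff_wedge koszul_diff_add koszul_diff_diff koszul_diff_scale)

lemma parity_simps [simp]:
  "parity (ext_basis {} q) = ext_basis {} q"
  "parity (\<omega> + \<eta>) = parity \<omega> + parity \<eta>"
  by (rule ext, simp add: parity_def ext_basis_def algebra_simps)+

lemma parity_wedge: "parity (wedge v \<omega>) = - wedge v (parity (\<omega> :: ('c::comm_ring_1, 'n::{finite,linorder}) ext))"
proof
  fix W :: "'n set"
  show "parity (wedge v \<omega>) W = (- wedge v (parity \<omega>)) W"
  proof (cases "v \<in> W")
    case True
    then have "(-1) ^ card W = (- ((-1) ^ card (W - {v})) :: 'c)"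
      by (metis card.remove finite mult_minus1 power_Suc)
    then show ?thesis using True by (simp add: parity_def wedge_def mult_ac del: card_Diff_singleton card_Diff_insert)
  qed (simp add: parity_def wedge_def)
qed

lemma parity_comp:
  assumes "\<omega> \<in> ext_comp i" shows "parity \<omega> = ext_scale ((-1) ^ i) \<omega>"
proof
  fix T
  show "parity \<omega> T = ext_scale ((-1) ^ i) \<omega> T"
    using assms by (cases "\<omega> T = 0") (auto simp: parity_def ext_scale_def ext_comp_def)
qed

lemma koszul_diff_leibniz_parity:
  "koszul_diff z (ext_mult \<omega> \<eta>) = ext_mult (koszul_diff z \<omega>) \<eta> + ext_mult (parity \<omega>) (koszul_diff z \<eta>)"
proof (induction \<omega> rule: ext_induct)
  case (scalar q)
  then show ?case by (simp del: fun_apply_simps add: ext_mult_scalar koszul_diff_scale)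
next
  case (wedge v \<omega>)
  have "koszul_diff z (ext_mult (wedge v \<omega>) \<eta>)
    = ext_scale (z v) (ext_mult \<omega> \<eta>) - ext_mult (wedge v (koszul_diff z \<omega>)) \<eta>
      - ext_mult (wedge v (parity \<omega>)) (koszul_diff z \<eta>)"
    by (simp del: fun_apply_simps add: wedge_mult[symmetric] koszul_diff_wedge wedge wedge_add)
  also have "\<dots> = ext_mult (koszul_diff z (wedge v \<omega>)) \<eta> + ext_mult (parity (wedge v \<omega>)) (koszul_diff z \<eta>)"
    by (simp del: fun_apply_simps add: koszul_diff_wedge parity_wedge ext_mult_minus_left ext_mult_diff_left ext_mult_scale_left)
  finally show ?case .
next
  case (add \<omega> \<theta>)
  then show ?case by (simp del: fun_apply_simps add: koszul_diff_add ext_mult_add_left add_ac)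
qed

lemma koszul_diff_leibniz:
  "\<omega> \<in> ext_comp i \<Longrightarrow> koszul_diff z (ext_mult \<omega> \<eta>)
    = ext_mult (koszul_diff z \<omega>) \<eta> + ext_scale ((-1) ^ i) (ext_mult \<omega> (koszul_diff z \<eta>))"
  by (simp del: fun_apply_simps add: koszul_diff_leibniz_parity parity_comp ext_mult_scale_left)

section \<open>Polynomials\<close>

lemma poly_sum_single: "q = (\<Sum>\<mu>\<in>Poly_Mapping.keys q. Poly_Mapping.single \<mu> (Poly_Mapping.lookup q \<mu>))"
  by (rule poly_mapping_eqI) (simp add: lookup_sum lookup_single when_def in_keys_iff)

lemma poly_induct [case_names single add]:
  fixes q :: "'a \<Rightarrow>\<^sub>0 'c::comm_monoid_add"
  assumes single: "\<And>\<mu> a. P (Poly_Mapping.single \<mu> a)"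
    and add: "\<And>p q. P p \<Longrightarrow> P q \<Longrightarrow> P (p + q)"
  shows "P q"
proof -
  have zero: "P 0" using single[of undefined 0] by simp
  have "P (\<Sum>\<mu>\<in>F. Poly_Mapping.single \<mu> (Poly_Mapping.lookup q \<mu>))" if "finite F" for F
    using that by (induction F) (auto intro: zero single add)
  then show ?thesis by (subst poly_sum_single) simp
qed

lemma deg_add: "deg (\<mu> + \<nu>) = deg \<mu> + deg \<nu>"
  by (simp add: deg_def lookup_add sum.distrib)

lemma deg_zero [simp]: "deg 0 = 0"
  by (simp add: deg_def)

lemma deg_single [simp]: "deg (Poly_Mapping.single v k) = k"
  by (simp add: deg_def lookup_single when_def)

lemma deg_eq_0_iff: "deg \<mu> = 0 \<longleftrightarrow> \<mu> = 0"
  by (auto simp: deg_def intro: poly_mapping_eqI)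

lemma monomial_minus_add:
  "Poly_Mapping.lookup \<mu> v \<noteq> 0 \<Longrightarrow> \<mu> - Poly_Mapping.single v (1::nat) + Poly_Mapping.single v 1 = \<mu>"
  by (rule poly_mapping_eqI) (auto simp: lookup_add lookup_minus lookup_single when_def)

lemma deg_minus_single:
  assumes "Poly_Mapping.lookup \<mu> v \<noteq> 0"
  shows "deg \<mu> = Suc (deg (\<mu> - Poly_Mapping.single v 1))"
  using deg_add[of "\<mu> - Poly_Mapping.single v 1" "Poly_Mapping.single v 1"]
  unfolding monomial_minus_add[OF assms] by simp

lemma lookup_poly_part:
  "Poly_Mapping.lookup (poly_part P q) \<mu> = (if P (deg \<mu>) then Poly_Mapping.lookup q \<mu> else 0)"
  by (auto simp: poly_part_def lookup_sum lookup_single when_def in_keys_iff)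

lemma keys_poly_part: "Poly_Mapping.keys (poly_part P q) = {\<mu> \<in> Poly_Mapping.keys q. P (deg \<mu>)}"
  by (auto simp: in_keys_iff lookup_poly_part split: if_splits)

lemma poly_part_id: "(\<And>\<mu>. \<mu> \<in> Poly_Mapping.keys q \<Longrightarrow> P (deg \<mu>)) \<Longrightarrow> poly_part P q = q"
  by (rule poly_mapping_eqI) (auto simp: lookup_poly_part in_keys_iff)

lemma poly_part_none: "(\<And>\<mu>. \<mu> \<in> Poly_Mapping.keys q \<Longrightarrow> \<not> P (deg \<mu>)) \<Longrightarrow> poly_part P q = 0"
  by (rule poly_mapping_eqI) (auto simp: lookup_poly_part in_keys_iff)

lemma poly_part_part: "poly_part P (poly_part Q q) = poly_part (\<lambda>m. P m \<and> Q m) q"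
  by (rule poly_mapping_eqI) (auto simp: lookup_poly_part)

lemma poly_part_add: "poly_part P (p + q) = poly_part P p + poly_part P q"
  by (rule poly_mapping_eqI) (auto simp: lookup_poly_part lookup_add)

lemma poly_part_minus: "poly_part P (- q) = - poly_part P (q :: _ \<Rightarrow>\<^sub>0 'c::ab_group_add)"
  by (rule poly_mapping_eqI) (auto simp: lookup_poly_part)

lemma poly_part_zero [simp]: "poly_part P 0 = 0"
  by (rule poly_mapping_eqI) (auto simp: lookup_poly_part)

lemma poly_part_sum: "poly_part P (\<Sum>a\<in>A. q a) = (\<Sum>a\<in>A. poly_part P (q a))"
  by (induction A rule: infinite_finite_induct) (auto simp: poly_part_add)

lemma poly_part_single:
  "poly_part P (Poly_Mapping.single \<mu> a) = (if P (deg \<mu>) then Poly_Mapping.single \<mu> a else 0)"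
  by (rule poly_mapping_eqI) (auto simp: lookup_poly_part lookup_single when_def)

lemma poly_part_const_mult: "poly_part P (const (r::'c::comm_ring_1) * q) = const r * poly_part P q"
  by (induction q rule: poly_induct) (simp_all add: poly_part_single const_def mult_single poly_part_add distrib_left)

lemma poly_part_var_mult:
  "poly_part P (var v * (q :: _ \<Rightarrow>\<^sub>0 'c::comm_ring_1)) = var v * poly_part (\<lambda>m. P (Suc m)) q"
  by (induction q rule: poly_induct)
    (simp_all add: poly_part_single var_def mult_single poly_part_add distrib_left deg_add)

lemma keys_mult_deg:
  fixes p q :: "('n::finite \<Rightarrow>\<^sub>0 nat) \<Rightarrow>\<^sub>0 'c::comm_ring_1"
  assumes "\<mu> \<in> Poly_Mapping.keys (p * q)"
  obtains \<nu> \<rho> where "\<nu> \<in> Poly_Mapping.keys p" "\<rho> \<in> Poly_Mapping.keys q" "deg \<mu> = deg \<nu> + deg \<rho>"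
  using keys_mult[of p q] assms by (force simp: deg_add)

text \<open>The polynomials without terms of degree below \<open>c\<close> form an ideal, so cutting
  such terms off a factor does not change the product below degree \<open>c\<close>.\<close>

lemma poly_part_less_mult:
  fixes p q :: "('n::finite \<Rightarrow>\<^sub>0 nat) \<Rightarrow>\<^sub>0 'c::comm_ring_1"
  shows "poly_part (\<lambda>m. m < c) (poly_part (\<lambda>m. m < c) p * q) = poly_part (\<lambda>m. m < c) (p * q)"
proof -
  have p: "p = poly_part (\<lambda>m. m < c) p + poly_part (\<lambda>m. c \<le> m) p"
    by (rule poly_mapping_eqI) (auto simp: lookup_poly_part lookup_add)
  have "poly_part (\<lambda>m. m < c) (poly_part (\<lambda>m. c \<le> m) p * q) = 0"
    by (rule poly_part_none) (force elim!: keys_mult_deg simp: keys_poly_part)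
  then have "poly_part (\<lambda>m. m < c) ((poly_part (\<lambda>m. m < c) p + poly_part (\<lambda>m. c \<le> m) p) * q)
    = poly_part (\<lambda>m. m < c) (poly_part (\<lambda>m. m < c) p * q)"
    by (simp add: distrib_right poly_part_add)
  then show ?thesis using p by simp
qed

subsection \<open>Partial derivatives\<close>

text \<open>Where v does not occur in \<mu>, the truncated subtraction leaves \<mu> as it is, and
  the coefficient 0 removes the term.\<close>

definition partial :: "'n \<Rightarrow> (('n \<Rightarrow>\<^sub>0 nat) \<Rightarrow>\<^sub>0 'c::comm_ring_1) \<Rightarrow> ('n \<Rightarrow>\<^sub>0 nat) \<Rightarrow>\<^sub>0 'c"
  where "partial v q = (\<Sum>\<mu>\<in>Poly_Mapping.keys q. Poly_Mapping.single (\<mu> - Poly_Mapping.single v 1)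
    (of_nat (Poly_Mapping.lookup \<mu> v) * Poly_Mapping.lookup q \<mu>))"

lemma partial_superset:
  assumes "finite A" "Poly_Mapping.keys q \<subseteq> A"
  shows "partial v q = (\<Sum>\<mu>\<in>A. Poly_Mapping.single (\<mu> - Poly_Mapping.single v 1)
    (of_nat (Poly_Mapping.lookup \<mu> v) * Poly_Mapping.lookup q \<mu>))"
  unfolding partial_def by (rule sum.mono_neutral_left) (use assms in \<open>auto simp: in_keys_iff\<close>)

lemma partial_single:
  "partial v (Poly_Mapping.single \<mu> a)
    = Poly_Mapping.single (\<mu> - Poly_Mapping.single v 1) (of_nat (Poly_Mapping.lookup \<mu> v) * a)"
  by (subst partial_superset[of "{\<mu>}"]) auto

lemma partial_add: "partial v (p + q) = partial v p + partial v q"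
proof -
  let ?A = "Poly_Mapping.keys p \<union> Poly_Mapping.keys q"
  have "partial v r = (\<Sum>\<mu>\<in>?A. Poly_Mapping.single (\<mu> - Poly_Mapping.single v 1)
    (of_nat (Poly_Mapping.lookup \<mu> v) * Poly_Mapping.lookup r \<mu>))" if "r \<in> {p, q, p + q}" for r
    using that keys_add[of p q] by (intro partial_superset) auto
  then show ?thesis by (simp add: lookup_add distrib_left single_add sum.distrib)
qed

lemma partial_zero [simp]: "partial v 0 = 0"
  by (simp add: partial_def)

lemma partial_minus: "partial v (- q) = - partial v q"
  using partial_add[of v q "- q"] by (simp add: eq_neg_iff_add_eq_0 add.commute)

lemma partial_const [simp]: "partial v (const r) = 0"
  by (simp add: const_def partial_single)

lemma partial_one [simp]: "partial v 1 = 0"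
  using partial_const[of v 1] by (simp add: const_def)

lemma partial_var: "partial v (var w) = (if v = w then 1 else 0)"
  by (simp add: var_def partial_single lookup_single when_def)

lemma partial_commute: "partial v (partial w q) = partial w (partial v q)"
proof (cases "v = w")
  case False
  then show ?thesis
  proof (induction q rule: poly_induct)
    case (single \<mu> a)
    have "\<mu> - Poly_Mapping.single w 1 - Poly_Mapping.single v 1
        = \<mu> - Poly_Mapping.single v 1 - Poly_Mapping.single w (1::nat)"
      by (rule poly_mapping_eqI) (simp add: lookup_minus)
    then show ?case using False
      by (simp add: partial_single lookup_minus lookup_single when_def mult_ac)
  qed (simp add: partial_add)
qed simp

lemma partial_mult: "partial v (p * q) = partial v p * q + p * partial v q"
proof (induction p rule: poly_induct)
  case (single \<mu> a)
  show ?case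
  proof (induction q rule: poly_induct)
    case (single \<nu> b)
    have "Poly_Mapping.single (\<mu> - Poly_Mapping.single v 1 + \<nu>) (of_nat (Poly_Mapping.lookup \<mu> v) * a * b)
      = Poly_Mapping.single (\<mu> + \<nu> - Poly_Mapping.single v 1) (of_nat (Poly_Mapping.lookup \<mu> v) * a * b)"
    \<comment> \<open>For exponent 0 the truncated subtraction need not commute with adding \<nu>,
      so the two monomials may differ; the coefficient vanishes then.\<close>
    proof (cases "Poly_Mapping.lookup \<mu> v = 0")
      case False
      then have "\<mu> - Poly_Mapping.single v 1 + \<nu> = \<mu> + \<nu> - Poly_Mapping.single v 1"
        by (intro poly_mapping_eqI) (auto simp: lookup_minus lookup_add lookup_single when_def)
      then show ?thesis by simp
    qed simp
    moreover have "Poly_Mapping.single (\<mu> + (\<nu> - Poly_Mapping.single v 1)) (a * (of_nat (Poly_Mapping.lookup \<nu> v) * b))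
      = Poly_Mapping.single (\<mu> + \<nu> - Poly_Mapping.single v 1) (a * (of_nat (Poly_Mapping.lookup \<nu> v) * b))"
    proof (cases "Poly_Mapping.lookup \<nu> v = 0")
      case False
      then have "\<mu> + (\<nu> - Poly_Mapping.single v 1) = \<mu> + \<nu> - Poly_Mapping.single v 1"
        by (intro poly_mapping_eqI) (auto simp: lookup_minus lookup_add lookup_single when_def)
      then show ?thesis by simp
    qed simp
    ultimately show ?case
      by (simp add: partial_single mult_single lookup_add algebra_simps flip: single_add)
  qed (simp add: partial_add algebra_simps)
qed (simp add: partial_add algebra_simps)

text \<open>Differentiation lowers the degree by one and kills constants, which is why the value of
  \<open>Q\<close> at 0 is left free. Truncation below \<open>c\<close> can therefore be matched
  with truncation below \<open>c - 1\<close> without a case distinction.\<close>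

lemma poly_part_partial:
  assumes "\<And>m. Q (Suc m) = P m"
  shows "poly_part P (partial v q) = partial v (poly_part Q q)"
proof (induction q rule: poly_induct)
  case (single \<mu> a)
  show ?case
  proof (cases "Poly_Mapping.lookup \<mu> v = 0")
    case False
    then show ?thesis by (simp add: partial_single poly_part_single deg_minus_single assms)
  qed (simp add: partial_single poly_part_single)
qed (simp add: partial_add poly_part_add)

definition euler :: "(('n::finite \<Rightarrow>\<^sub>0 nat) \<Rightarrow>\<^sub>0 'c::comm_ring_1) \<Rightarrow> ('n \<Rightarrow>\<^sub>0 nat) \<Rightarrow>\<^sub>0 'c"
  where "euler q = (\<Sum>v\<in>UNIV. var v * partial v q)"

lemma euler_add: "euler (p + q) = euler p + euler q"
  by (simp add: euler_def partial_add distrib_left sum.distrib)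

lemma euler_zero [simp]: "euler 0 = 0"
  by (simp add: euler_def)

lemma euler_single: "euler (Poly_Mapping.single \<mu> a) = of_nat (deg \<mu>) * Poly_Mapping.single \<mu> a"
proof -
  have "var v * partial v (Poly_Mapping.single \<mu> a) = of_nat (Poly_Mapping.lookup \<mu> v) * Poly_Mapping.single \<mu> a" for v
  proof (cases "Poly_Mapping.lookup \<mu> v = 0")
    case False
    then show ?thesis
      using monomial_minus_add[OF False]
      by (simp add: var_def partial_single mult_single add.commute flip: single_of_nat)
  qed (simp add: partial_single)
  then show ?thesis by (simp add: euler_def deg_def sum_distrib_right)
qed

lemma euler_homogeneous:
  fixes q :: "('n::finite \<Rightarrow>\<^sub>0 nat) \<Rightarrow>\<^sub>0 'c::comm_ring_1"
  assumes "\<And>\<mu>. \<mu> \<in> Poly_Mapping.keys q \<Longrightarrow> deg \<mu> = m"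
  shows "euler q = of_nat m * q"
proof -
  have sum: "euler (\<Sum>\<mu>\<in>F. f \<mu>) = (\<Sum>\<mu>\<in>F. euler (f \<mu>))" if "finite F" for F and f :: "('n \<Rightarrow>\<^sub>0 nat) \<Rightarrow> ('n \<Rightarrow>\<^sub>0 nat) \<Rightarrow>\<^sub>0 'c"
    using that by (induction F) (auto simp: euler_add)
  have "euler q = (\<Sum>\<mu>\<in>Poly_Mapping.keys q. euler (Poly_Mapping.single \<mu> (Poly_Mapping.lookup q \<mu>)))"
    by (subst (1) poly_sum_single) (simp add: sum)
  also have "\<dots> = of_nat m * (\<Sum>\<mu>\<in>Poly_Mapping.keys q. Poly_Mapping.single \<mu> (Poly_Mapping.lookup q \<mu>))"
    by (simp add: euler_single assms sum_distrib_left)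
  finally show ?thesis by (simp flip: poly_sum_single)
qed

section \<open>The de Rham differential\<close>

definition ext_partial ::
  "'n \<Rightarrow> (('n \<Rightarrow>\<^sub>0 nat) \<Rightarrow>\<^sub>0 'c::comm_ring_1, 'n) ext \<Rightarrow> (('n \<Rightarrow>\<^sub>0 nat) \<Rightarrow>\<^sub>0 'c, 'n) ext"
  where "ext_partial v \<omega> = (\<lambda>T. partial v (\<omega> T))"

definition de_rham ::
  "(('n::{finite,linorder} \<Rightarrow>\<^sub>0 nat) \<Rightarrow>\<^sub>0 'c::comm_ring_1, 'n) ext \<Rightarrow> (('n \<Rightarrow>\<^sub>0 nat) \<Rightarrow>\<^sub>0 'c, 'n) ext"
  where "de_rham \<omega> = (\<Sum>v\<in>UNIV. wedge v (ext_partial v \<omega>))"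

lemma ext_partial_add: "ext_partial v (\<omega> + \<eta>) = ext_partial v \<omega> + ext_partial v \<eta>"
  by (rule ext) (simp add: ext_partial_def partial_add)

lemma ext_partial_zero [simp]: "ext_partial v 0 = 0"
  by (rule ext) (simp add: ext_partial_def)

lemma ext_partial_sum: "ext_partial v (\<Sum>a\<in>A. f a) = (\<Sum>a\<in>A. ext_partial v (f a))"
  by (induction A rule: infinite_finite_induct) (auto simp: ext_partial_add simp del: fun_apply_simps)

lemma ext_partial_minus: "ext_partial v (- \<omega>) = - ext_partial v \<omega>"
  by (rule ext) (simp add: ext_partial_def partial_minus)

lemma ext_basis_zero [simp]: "ext_basis T 0 = 0"
  by (rule ext) (simp add: ext_basis_def)

lemma ext_partial_basis: "ext_partial v (ext_basis T q) = ext_basis T (partial v q)"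
  by (rule ext) (simp add: ext_partial_def ext_basis_def)

lemma pre_sign_cases: "pre_sign v T = (1::'c) \<or> pre_sign v T = (-1::'c::comm_ring_1)"
  by (cases "even (card {s\<in>T. s < v})") (simp_all add: pre_sign_def)

lemma ext_partial_wedge:
  fixes \<omega> :: "(('n::{finite,linorder} \<Rightarrow>\<^sub>0 nat) \<Rightarrow>\<^sub>0 'c::comm_ring_1, 'n) ext"
  shows "ext_partial v (wedge w \<omega>) = wedge w (ext_partial v \<omega>)"
proof
  fix T
  show "ext_partial v (wedge w \<omega>) T = wedge w (ext_partial v \<omega>) T"
    using pre_sign_cases[of w T, where 'c = "('n \<Rightarrow>\<^sub>0 nat) \<Rightarrow>\<^sub>0 'c"]
    by (auto simp: ext_partial_def wedge_def partial_minus)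
qed

lemma ext_partial_scale: "ext_partial v (ext_scale q \<omega>) = ext_scale (partial v q) \<omega> + ext_scale q (ext_partial v \<omega>)"
  by (rule ext) (simp add: ext_partial_def ext_scale_def partial_mult)

lemma wedge_sum: "wedge v (\<Sum>a\<in>A. f a) = (\<Sum>a\<in>A. wedge v (f a))"
  by (induction A rule: infinite_finite_induct) (auto simp: wedge_add simp del: fun_apply_simps)

lemma koszul_diff_sum: "koszul_diff z (\<Sum>a\<in>A. f a) = (\<Sum>a\<in>A. koszul_diff z (f a))"
  by (induction A rule: infinite_finite_induct) (auto simp: koszul_diff_add simp del: fun_apply_simps)

lemma ext_mult_sum_left: "ext_mult (\<Sum>a\<in>A. f a) \<omega> = (\<Sum>a\<in>A. ext_mult (f a) \<omega>)"
  by (induction A rule: infinite_finite_induct) (auto simp: ext_mult_add_left simp del: fun_apply_simps)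

lemma ext_scale_sum: "ext_scale q (\<Sum>a\<in>A. f a) = (\<Sum>a\<in>A. ext_scale q (f a))"
  by (induction A rule: infinite_finite_induct) (auto simp: ext_scale_simps simp del: fun_apply_simps)

lemma de_rham_add: "de_rham (\<omega> + \<eta>) = de_rham \<omega> + de_rham \<eta>"
  by (simp add: de_rham_def ext_partial_add wedge_add sum.distrib)

lemma de_rham_zero [simp]: "de_rham 0 = 0"
  by (simp add: de_rham_def)

lemma de_rham_minus: "de_rham (- \<omega>) = - de_rham \<omega>"
  by (simp add: de_rham_def ext_partial_minus wedge_minus sum_negf)

lemma de_rham_diff: "de_rham (\<omega> - \<eta>) = de_rham \<omega> - de_rham \<eta>"
  using de_rham_add[of \<omega> "- \<eta>"] by (simp add: de_rham_minus)

lemma de_rham_sum: "de_rham (\<Sum>a\<in>A. f a) = (\<Sum>a\<in>A. de_rham (f a))"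
  by (induction A rule: infinite_finite_induct) (auto simp: de_rham_add simp del: fun_apply_simps)

lemma de_rham_wedge: "de_rham (wedge v \<omega>) = - wedge v (de_rham \<omega>)"
proof -
  have "de_rham (wedge v \<omega>) = (\<Sum>w\<in>UNIV. - wedge v (wedge w (ext_partial w \<omega>)))"
    unfolding de_rham_def ext_partial_wedge by (rule sum.cong[OF refl wedge_anticommute])
  then show ?thesis by (simp add: de_rham_def sum_negf wedge_sum)
qed

lemma de_rham_scalar: "de_rham (ext_basis {} q) = (\<Sum>v\<in>UNIV. wedge v (ext_basis {} (partial v q)))"
  by (simp add: de_rham_def ext_partial_basis)

lemma de_rham_scale: "de_rham (ext_scale q \<omega>) = ext_mult (de_rham (ext_basis {} q)) \<omega> + ext_scale q (de_rham \<omega>)"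
  by (simp add: de_rham_def ext_partial_basis ext_partial_scale wedge_add sum.distrib ext_mult_sum_left
      ext_scale_sum wedge_scale ext_mult_scalar flip: wedge_mult)

lemma de_rham_scale_const:
  fixes \<omega> :: "(('n::{finite,linorder} \<Rightarrow>\<^sub>0 nat) \<Rightarrow>\<^sub>0 'c::comm_ring_1, 'n) ext"
  shows "de_rham (ext_scale (const r) \<omega>) = ext_scale (const r) (de_rham \<omega>)"
proof -
  have "de_rham (ext_basis {} (const r) :: (('n \<Rightarrow>\<^sub>0 nat) \<Rightarrow>\<^sub>0 'c, 'n) ext) = 0"
    by (simp add: de_rham_scalar)
  then show ?thesis by (simp add: de_rham_scale)
qed

lemma de_rham_scale_var:
  fixes \<omega> :: "(('n::{finite,linorder} \<Rightarrow>\<^sub>0 nat) \<Rightarrow>\<^sub>0 'c::comm_ring_1, 'n) ext"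
  shows "de_rham (ext_scale (var v) \<omega>) = wedge v \<omega> + ext_scale (var v) (de_rham \<omega>)"
proof -
  have "wedge w (ext_basis {} (partial w (var v))) = (if w = v then wedge v (ext_basis {} 1) else 0 :: (('n \<Rightarrow>\<^sub>0 nat) \<Rightarrow>\<^sub>0 'c, 'n) ext)" for w
    by (simp add: partial_var)
  then have "de_rham (ext_basis {} (var v)) = (wedge v (ext_basis {} 1) :: (('n \<Rightarrow>\<^sub>0 nat) \<Rightarrow>\<^sub>0 'c, 'n) ext)"
    unfolding de_rham_scalar by simp
  then show ?thesis by (simp add: de_rham_scale ext_mult_scalar ext_scale_simps flip: wedge_mult)
qed

lemma de_rham_derivation:
  "de_rham (ext_mult \<omega> \<eta>) = ext_mult (de_rham \<omega>) \<eta> + ext_mult (parity \<omega>) (de_rham \<eta>)"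
proof (induction \<omega> rule: ext_induct)
  case (scalar q)
  show ?case by (simp del: fun_apply_simps add: ext_mult_scalar de_rham_scale)
next
  case (wedge v \<omega>)
  then show ?case
    by (simp del: fun_apply_simps add: de_rham_wedge parity_wedge ext_mult_minus_left wedge_add flip: wedge_mult)
next
  case (add \<omega> \<theta>)
  then show ?case by (simp del: fun_apply_simps add: de_rham_add ext_mult_add_left add_ac)
qed

text \<open>Off the diagonal the terms cancel in pairs. Antisymmetry alone would make a diagonal
  term only 2-torsion, hence the separate assumption on \<open>f v v\<close>.\<close>

lemma sum_alternating:
  fixes f :: "'a \<Rightarrow> 'a \<Rightarrow> 'b::ab_group_add"
  assumes "finite A" "\<And>v. f v v = 0" "\<And>v w. f v w = - f w v"
  shows "(\<Sum>v\<in>A. \<Sum>w\<in>A. f v w) = 0"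
  using assms(1)
proof (induction A)
  case (insert v A)
  have "(\<Sum>w\<in>A. f w v) = - (\<Sum>w\<in>A. f v w)" unfolding sum_negf[symmetric] using assms(3) by metis
  then show ?case using insert assms(2) by (simp add: sum.distrib)
qed simp

text \<open>On scalars this is the interplay of commuting partial derivatives with anticommuting
  generators; \<open>de_rham_wedge\<close> carries it to all forms.\<close>

lemma de_rham_square:
  fixes \<omega> :: "(('n::{finite,linorder} \<Rightarrow>\<^sub>0 nat) \<Rightarrow>\<^sub>0 'c::comm_ring_1, 'n) ext"
  shows "de_rham (de_rham \<omega>) = 0"
proof (induction \<omega> rule: ext_induct)
  case (scalar q)
  have "de_rham (de_rham (ext_basis {} q))
    = (\<Sum>w\<in>UNIV. \<Sum>v\<in>UNIV. wedge w (wedge v (ext_basis {} (partial w (partial v q)))))"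
    by (simp add: de_rham_scalar) (simp add: de_rham_def ext_partial_sum ext_partial_wedge ext_partial_basis wedge_sum)
  also have "\<dots> = 0"
  proof (rule sum_alternating)
    fix v w :: 'n
    show "wedge v (wedge w (ext_basis {} (partial v (partial w q))))
      = - wedge w (wedge v (ext_basis {} (partial w (partial v q))))"
      by (subst wedge_anticommute) (simp add: partial_commute)
  qed (auto simp: wedge_self)
  finally show ?case .
qed (simp_all del: fun_apply_simps add: de_rham_wedge de_rham_minus de_rham_add)

text \<open>This is Cartan's formula for the Euler vector field: \<open>koszul_diff var\<close>
  contracts with it, and the Lie derivative along it counts the exterior degree plus the
  y-degree.\<close>

lemma koszul_de_rham_homotopy:
  fixes \<omega> :: "(('n::{finite,linorder} \<Rightarrow>\<^sub>0 nat) \<Rightarrow>\<^sub>0 'c::comm_ring_1, 'n) ext"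
  shows "koszul_diff var (de_rham \<omega>) + de_rham (koszul_diff var \<omega>)
    = (\<lambda>T. of_nat (card T) * \<omega> T + euler (\<omega> T))"
proof (induction \<omega> rule: ext_induct)
  case (scalar q)
  have "koszul_diff var (de_rham (ext_basis {} q)) = ext_basis {} (euler q)"
  proof -
    have "koszul_diff var (de_rham (ext_basis {} q)) = (\<Sum>v\<in>UNIV. ext_basis {} (var v * partial v q))"
      by (simp add: de_rham_scalar koszul_diff_sum koszul_diff_wedge ext_scale_simps)
    also have "\<dots> = ext_basis {} (euler q)"
      by (rule ext) (simp add: sum_fun_apply ext_basis_def euler_def)
    finally show ?thesis .
  qed
  moreover have "(\<lambda>T :: 'n set. of_nat (card T) * ext_basis {} q T + euler (ext_basis {} q T)) = ext_basis {} (euler q)"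
    by (rule ext) (simp add: ext_basis_def euler_def)
  ultimately show ?case
    by (simp only: koszul_diff_scalar de_rham_zero add_0_right)
next
  case (wedge v \<omega>)
  \<comment> \<open>The two terms y_v \<delta>\<omega> cancel. The extra \<omega> comes from
    differentiating the factor y_v in \<delta>(y_v \<omega>) and accounts for the exterior degree
    being one higher.\<close>
  have "koszul_diff var (de_rham (wedge v \<omega>)) + de_rham (koszul_diff var (wedge v \<omega>))
    = wedge v (\<omega> + (koszul_diff var (de_rham \<omega>) + de_rham (koszul_diff var \<omega>)))"
    by (simp add: de_rham_wedge koszul_diff_wedge koszul_diff_minus de_rham_diff de_rham_scale_var wedge_add)
  also have "\<dots> = (\<lambda>T. of_nat (card T) * wedge v \<omega> T + euler (wedge v \<omega> T))"
  proof
    fix T :: "'n set"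
    show "wedge v (\<omega> + (koszul_diff var (de_rham \<omega>) + de_rham (koszul_diff var \<omega>))) T
      = of_nat (card T) * wedge v \<omega> T + euler (wedge v \<omega> T)"
    proof (cases "v \<in> T")
      case True
      have e: "euler (pre_sign v T * p) = pre_sign v T * euler p" for p :: "('n \<Rightarrow>\<^sub>0 nat) \<Rightarrow>\<^sub>0 'c"
        using pre_sign_cases[of v T, where 'c = "('n \<Rightarrow>\<^sub>0 nat) \<Rightarrow>\<^sub>0 'c"]
        by (auto simp: euler_def partial_minus sum_negf)
      have c: "of_nat (card T) = (1 + of_nat (card (T - {v})) :: ('n \<Rightarrow>\<^sub>0 nat) \<Rightarrow>\<^sub>0 'c)"
        using True by (metis card.remove finite of_nat_Suc)
      have ih: "koszul_diff var (de_rham \<omega>) (T - {v}) + de_rham (koszul_diff var \<omega>) (T - {v})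
        = of_nat (card (T - {v})) * \<omega> (T - {v}) + euler (\<omega> (T - {v}))"
        using fun_cong[OF wedge.IH, of "T - {v}"] by simp
      have "pre_sign v T * (\<omega> (T - {v}) + (koszul_diff var (de_rham \<omega>) (T - {v}) + de_rham (koszul_diff var \<omega>) (T - {v})))
        = of_nat (card T) * (pre_sign v T * \<omega> (T - {v})) + euler (pre_sign v T * \<omega> (T - {v}))"
        unfolding e c ih by (simp only: distrib_left distrib_right mult_1_left ac_simps)
      then show ?thesis using True by (simp add: wedge_def)
    qed (simp add: wedge_def euler_def)
  qed
  finally show ?case .
next
  case (add \<omega> \<theta>)
  have "koszul_diff var (de_rham (\<omega> + \<theta>)) + de_rham (koszul_diff var (\<omega> + \<theta>))
    = (koszul_diff var (de_rham \<omega>) + de_rham (koszul_diff var \<omega>)) + (koszul_diff var (de_rham \<theta>) + de_rham (koszul_diff var \<theta>))"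
    by (simp add: de_rham_add koszul_diff_add)
  also have "\<dots> = (\<lambda>T. of_nat (card T) * (\<omega> + \<theta>) T + euler ((\<omega> + \<theta>) T))"
    unfolding add by (rule ext) (simp add: distrib_left euler_add)
  finally show ?case .
qed

section \<open>Constructions with dg algebras\<close>

lemma subspaceD:
  assumes "module s" "module.subspace s A"
  shows "0 \<in> A" "x \<in> A \<Longrightarrow> y \<in> A \<Longrightarrow> x + y \<in> A" "x \<in> A \<Longrightarrow> s r x \<in> A"
    "x \<in> A \<Longrightarrow> - x \<in> A" "x \<in> A \<Longrightarrow> y \<in> A \<Longrightarrow> x - y \<in> A"
  using module.subspace_0[OF assms] module.subspace_add[OF assms] module.subspace_scale[OF assms]
    module.subspace_neg[OF assms] module.subspace_diff[OF assms] by auto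

lemma dg_algebra_hom_compose:
  assumes "dg_algebra_hom A B f" "dg_algebra_hom B C g"
  shows "dg_algebra_hom A C (g \<circ> f)"
proof -
  interpret f: dg_algebra_hom A B f by fact
  interpret g: dg_algebra_hom B C g by fact
  show ?thesis
    by unfold_locales
      (auto simp: f.hom_add g.hom_add f.hom_scale g.hom_scale f.hom_diff f.hom_one g.hom_one f.hom_mult
        g.hom_mult f.hom_comp g.hom_comp intro: g.hom_diff[OF f.hom_comp] g.hom_add[OF f.hom_comp f.hom_comp]
        g.hom_scale[OF f.hom_comp] g.hom_mult[OF f.hom_comp f.hom_comp])
qed

text \<open>\<open>X\<close> is the quotient of \<open>E\<close> by the kernel of the idempotent
  \<open>t\<close>, realized on the fixed points of \<open>t\<close>. The last three assumptions
  express that this kernel is a dg ideal.\<close>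

lemma dg_algebra_retract:
  fixes E :: "('r::comm_ring_1, 'x::ab_group_add) dga" and X :: "('r, 'x) dga"
  assumes "dg_algebra E"
    and scale: "dg_scale X = dg_scale E"
    and comp: "\<And>i. dg_comp X i = {x \<in> dg_comp E i. t x = x}"
    and diff: "\<And>x. dg_diff X x = t (dg_diff E x)"
    and mult: "\<And>x y. dg_mult X x y = t (dg_mult E x y)"
    and one: "dg_one X = dg_one E" "t (dg_one E) = dg_one E"
    and t_comp: "\<And>i x. x \<in> dg_comp E i \<Longrightarrow> t x \<in> dg_comp E i"
    and t_idem: "\<And>x. t (t x) = t x"
    and t_add: "\<And>x y. t (x + y) = t x + t y"
    and t_scale: "\<And>r x. t (dg_scale E r x) = dg_scale E r (t x)"
    and t_diff: "\<And>x. t (dg_diff E (t x)) = t (dg_diff E x)"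
    and t_mult_left: "\<And>x y. t (dg_mult E (t x) y) = t (dg_mult E x y)"
    and t_mult_right: "\<And>x y. t (dg_mult E x (t y)) = t (dg_mult E x y)"
  shows "dg_algebra X"
proof -
  interpret E: dg_algebra E by fact
  note sub = subspaceD[OF E.module_scale E.subspace_comp]
  have t_0: "t 0 = 0" using t_add[of 0 0] by simp
  show ?thesis
  proof (rule dg_algebra.intro)
    show "module (dg_scale X)" unfolding scale by (rule E.module_scale)
    show "module.subspace (dg_scale X) (dg_comp X i)" for i
      unfolding scale comp using sub
      by (intro module.subspaceI[OF E.module_scale]) (auto simp: t_0 t_add t_scale)
    show "dg_diff X x \<in> dg_comp X i" if "x \<in> dg_comp X (Suc i)" for x i
      using that by (auto simp: comp diff t_idem intro!: t_comp E.diff_comp)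
    show "dg_diff X x = 0" if "x \<in> dg_comp X 0" for x
      using that by (auto simp: comp diff E.diff_comp_0 t_0)
    show "dg_diff X (x + y) = dg_diff X x + dg_diff X y" if "x \<in> dg_comp X i" "y \<in> dg_comp X i" for x y i
      using that by (simp add: comp diff E.diff_add[of _ i] t_add)
    show "dg_diff X (dg_scale X r x) = dg_scale X r (dg_diff X x)" if "x \<in> dg_comp X i" for r x i
      using that by (simp add: comp diff scale E.diff_scale[of _ i] t_scale)
    show "dg_diff X (dg_diff X x) = 0" if "x \<in> dg_comp X i" for x i
      using that by (simp add: comp diff t_diff E.diff_diff[of _ i] t_0)
    show "dg_mult X x y \<in> dg_comp X (i + j)" if "x \<in> dg_comp X i" "y \<in> dg_comp X j" for x y i j
      using that by (simp add: comp mult t_idem t_comp E.mult_comp)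
    show "dg_mult X (x + y) z = dg_mult X x z + dg_mult X y z"
      if "x \<in> dg_comp X i" "y \<in> dg_comp X i" "z \<in> dg_comp X j" for x y z i j
      using that by (simp add: comp mult t_add E.mult_add_left[of x i y z j])
    show "dg_mult X x (y + z) = dg_mult X x y + dg_mult X x z"
      if "x \<in> dg_comp X i" "y \<in> dg_comp X j" "z \<in> dg_comp X j" for x y z i j
      using that by (simp add: comp mult t_add E.mult_add_right[of x i y j z])
    show "dg_mult X (dg_scale X r x) y = dg_scale X r (dg_mult X x y)"
      if "x \<in> dg_comp X i" "y \<in> dg_comp X j" for r x y i j
      using that by (simp add: comp mult scale E.mult_scale_left[of x i y j] t_scale)
    show "dg_mult X x (dg_scale X r y) = dg_scale X r (dg_mult X x y)"
      if "x \<in> dg_comp X i" "y \<in> dg_comp X j" for r x y i j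
      using that by (simp add: comp mult scale E.mult_scale_right[of x i y j] t_scale)
    show "dg_mult X (dg_mult X x y) z = dg_mult X x (dg_mult X y z)"
      if "x \<in> dg_comp X i" "y \<in> dg_comp X j" "z \<in> dg_comp X l" for x y z i j l
      using that by (simp add: comp mult t_mult_left t_mult_right E.mult_assoc[of x i y j z l])
    show "dg_one X \<in> dg_comp X 0" by (simp add: comp one E.one_comp)
    show "dg_mult X (dg_one X) x = x" if "x \<in> dg_comp X i" for x i
      using that by (simp add: comp mult one E.one_mult[of _ i])
    show "dg_mult X x (dg_one X) = x" if "x \<in> dg_comp X i" for x i
      using that by (simp add: comp mult one E.mult_one[of _ i])
    show "dg_diff X (dg_mult X x y) =
        dg_mult X (dg_diff X x) y + dg_scale X ((-1) ^ i) (dg_mult X x (dg_diff X y))"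
      if "x \<in> dg_comp X i" "y \<in> dg_comp X j" for x y i j
      using that by (simp add: comp mult diff scale t_diff t_mult_left t_mult_right E.leibniz[of x i y j] t_add t_scale)
    show "dg_mult X x y = dg_scale X ((-1) ^ (i * j)) (dg_mult X y x)"
      if "x \<in> dg_comp X i" "y \<in> dg_comp X j" for x y i j
      using that by (simp add: comp mult scale E.graded_comm[of x i y j] t_scale)
    show "dg_mult X x x = 0" if "x \<in> dg_comp X i" "odd i" for x i
      using that by (simp add: comp mult E.odd_square[of x i] t_0)
  qed
qed

text \<open>
  \<open>Z\<close> consists of the graded pieces of a sub dg algebra of \<open>B\<close>, and \<open>p\<close>, \<open>g\<close> are mutually inverse
  bijections between \<open>Z\<close> and \<open>A\<close> along which the structure of \<open>A\<close> is transported.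
\<close>

locale dg_transport = B: dg_algebra B
  for B :: "('r::comm_ring_1, 'y::ab_group_add) dga" +
  fixes A :: "('r, 'x::ab_group_add) dga" and Z :: "nat \<Rightarrow> 'y set" and p :: "'y \<Rightarrow> 'x" and g :: "'x \<Rightarrow> 'y"
  assumes module_A: "module (dg_scale A)"
    and Z_comp: "w \<in> Z i \<Longrightarrow> w \<in> dg_comp B i"
    and Z_subspace: "module.subspace (dg_scale B) (Z i)"
    and Z_diff: "w \<in> Z (Suc i) \<Longrightarrow> dg_diff B w \<in> Z i"
    and Z_mult: "w \<in> Z i \<Longrightarrow> v \<in> Z j \<Longrightarrow> dg_mult B w v \<in> Z (i + j)"
    and Z_one: "dg_one B \<in> Z 0"
    and p_comp: "w \<in> Z i \<Longrightarrow> p w \<in> dg_comp A i"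
    and g_Z: "x \<in> dg_comp A i \<Longrightarrow> g x \<in> Z i"
    and p_g: "x \<in> dg_comp A i \<Longrightarrow> p (g x) = x"
    and g_p: "w \<in> Z i \<Longrightarrow> g (p w) = w"
    and p_add: "w \<in> Z i \<Longrightarrow> v \<in> Z i \<Longrightarrow> p (w + v) = p w + p v"
    and p_scale: "w \<in> Z i \<Longrightarrow> p (dg_scale B r w) = dg_scale A r (p w)"
    and p_diff: "w \<in> Z i \<Longrightarrow> p (dg_diff B w) = dg_diff A (p w)"
    and p_one: "p (dg_one B) = dg_one A"
    and mult_A: "x \<in> dg_comp A i \<Longrightarrow> y \<in> dg_comp A j \<Longrightarrow> dg_mult A x y = p (dg_mult B (g x) (g y))"
begin

lemmas Z_closed = subspaceD[OF B.module_scale Z_subspace]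

text \<open>In degree 0 the differential is 0, which lies in \<open>Z 0\<close>; so the natural
  subtraction does no harm.\<close>

lemma Z_diff': "w \<in> Z i \<Longrightarrow> dg_diff B w \<in> Z (i - 1)"
  by (cases i) (auto intro: Z_diff simp: B.diff_comp_0[OF Z_comp] Z_closed(1))

lemma p_zero: "p 0 = 0"
  using p_add[OF Z_closed(1) Z_closed(1)] by simp

lemma comp_A: "dg_comp A i = p ` Z i"
  using p_comp g_Z p_g by (auto simp: image_iff) metis

lemma subspace_A: "module.subspace (dg_scale A) (dg_comp A i)"
  unfolding comp_A
  by (rule module.subspaceI[OF module_A])
    (auto simp: p_add[symmetric] p_scale[symmetric] Z_closed p_zero[symmetric] simp del: p_zero)

lemmas A_closed = subspaceD[OF module_A subspace_A]

lemma g_add: "x \<in> dg_comp A i \<Longrightarrow> y \<in> dg_comp A i \<Longrightarrow> g (x + y) = g x + g y"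
  by (metis g_Z p_g g_p p_add Z_closed(2))

lemma g_scale: "x \<in> dg_comp A i \<Longrightarrow> g (dg_scale A r x) = dg_scale B r (g x)"
  by (metis g_Z p_g g_p p_scale Z_closed(3))

lemma diff_A: "x \<in> dg_comp A i \<Longrightarrow> dg_diff A x = p (dg_diff B (g x))"
  by (metis g_Z p_g p_diff)

lemma g_diff: "x \<in> dg_comp A i \<Longrightarrow> g (dg_diff A x) = dg_diff B (g x)"
  by (metis diff_A g_Z Z_diff' g_p)

lemma g_mult: "x \<in> dg_comp A i \<Longrightarrow> y \<in> dg_comp A j \<Longrightarrow> g (dg_mult A x y) = dg_mult B (g x) (g y)"
  by (metis mult_A g_Z Z_mult g_p)

lemma g_one: "g (dg_one A) = dg_one B"
  by (metis p_one g_p Z_one)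

lemma g_comp: "x \<in> dg_comp A i \<Longrightarrow> g x \<in> dg_comp B i"
  using g_Z Z_comp by blast

lemma diff_comp_A: "x \<in> dg_comp A i \<Longrightarrow> dg_diff A x \<in> dg_comp A (i - 1)"
  by (metis diff_A g_Z Z_diff' p_comp)

lemma mult_comp_A: "x \<in> dg_comp A i \<Longrightarrow> y \<in> dg_comp A j \<Longrightarrow> dg_mult A x y \<in> dg_comp A (i + j)"
  by (metis mult_A g_Z Z_mult p_comp)

lemma one_comp_A: "dg_one A \<in> dg_comp A 0"
  by (metis p_one p_comp Z_one)

text \<open>Each axiom is the image under \<open>p\<close> of the same axiom in \<open>B\<close>.
  The care goes into degrees: \<open>p\<close> is known to be linear only on a single piece of
  \<open>Z\<close>, so every argument of \<open>p\<close> must be placed in one.\<close>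

lemma dg_algebra_A: "dg_algebra A"
proof (rule dg_algebra.intro)
  show "module (dg_scale A)" by (rule module_A)
  show "module.subspace (dg_scale A) (dg_comp A i)" for i by (rule subspace_A)
  show "dg_diff A x \<in> dg_comp A i" if "x \<in> dg_comp A (Suc i)" for x i
    using diff_comp_A[OF that] by simp
  show "dg_diff A x = 0" if "x \<in> dg_comp A 0" for x
    using that by (simp add: diff_A B.diff_comp_0[OF g_comp] p_zero)
  show "dg_diff A (x + y) = dg_diff A x + dg_diff A y" if x: "x \<in> dg_comp A i" and y: "y \<in> dg_comp A i" for x y i
    by (simp add: diff_A[OF x] diff_A[OF y] diff_A[OF A_closed(2)[OF x y]] g_add[OF x y]
        B.diff_add[OF g_comp[OF x] g_comp[OF y]] p_add[OF Z_diff'[OF g_Z[OF x]] Z_diff'[OF g_Z[OF y]]])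
  show "dg_diff A (dg_scale A r x) = dg_scale A r (dg_diff A x)" if x: "x \<in> dg_comp A i" for r x i
    by (simp add: diff_A[OF x] diff_A[OF A_closed(3)[OF x]] g_scale[OF x] B.diff_scale[OF g_comp[OF x]]
        p_scale[OF Z_diff'[OF g_Z[OF x]]])
  show "dg_diff A (dg_diff A x) = 0" if x: "x \<in> dg_comp A i" for x i
    by (simp add: diff_A[OF diff_comp_A[OF x]] g_diff[OF x] B.diff_diff[OF g_comp[OF x]] p_zero)
  show "dg_mult A x y \<in> dg_comp A (i + j)" if "x \<in> dg_comp A i" "y \<in> dg_comp A j" for x y i j
    using that by (rule mult_comp_A)
  show "dg_mult A (x + y) z = dg_mult A x z + dg_mult A y z"
    if x: "x \<in> dg_comp A i" and y: "y \<in> dg_comp A i" and z: "z \<in> dg_comp A j" for x y z i j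
    by (simp add: mult_A[OF x z] mult_A[OF y z] mult_A[OF A_closed(2)[OF x y] z] g_add[OF x y]
        B.mult_add_left[OF g_comp[OF x] g_comp[OF y] g_comp[OF z]]
        p_add[OF Z_mult[OF g_Z[OF x] g_Z[OF z]] Z_mult[OF g_Z[OF y] g_Z[OF z]]])
  show "dg_mult A x (y + z) = dg_mult A x y + dg_mult A x z"
    if x: "x \<in> dg_comp A i" and y: "y \<in> dg_comp A j" and z: "z \<in> dg_comp A j" for x y z i j
    by (simp add: mult_A[OF x z] mult_A[OF x y] mult_A[OF x A_closed(2)[OF y z]] g_add[OF y z]
        B.mult_add_right[OF g_comp[OF x] g_comp[OF y] g_comp[OF z]]
        p_add[OF Z_mult[OF g_Z[OF x] g_Z[OF y]] Z_mult[OF g_Z[OF x] g_Z[OF z]]])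
  show "dg_mult A (dg_scale A r x) y = dg_scale A r (dg_mult A x y)"
    if x: "x \<in> dg_comp A i" and y: "y \<in> dg_comp A j" for r x y i j
    by (simp add: mult_A[OF x y] mult_A[OF A_closed(3)[OF x] y] g_scale[OF x]
        B.mult_scale_left[OF g_comp[OF x] g_comp[OF y]] p_scale[OF Z_mult[OF g_Z[OF x] g_Z[OF y]]])
  show "dg_mult A x (dg_scale A r y) = dg_scale A r (dg_mult A x y)"
    if x: "x \<in> dg_comp A i" and y: "y \<in> dg_comp A j" for r x y i j
    by (simp add: mult_A[OF x y] mult_A[OF x A_closed(3)[OF y]] g_scale[OF y]
        B.mult_scale_right[OF g_comp[OF x] g_comp[OF y]] p_scale[OF Z_mult[OF g_Z[OF x] g_Z[OF y]]])
  show "dg_mult A (dg_mult A x y) z = dg_mult A x (dg_mult A y z)"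
    if x: "x \<in> dg_comp A i" and y: "y \<in> dg_comp A j" and z: "z \<in> dg_comp A l" for x y z i j l
    by (simp add: mult_A[OF mult_comp_A[OF x y] z] mult_A[OF x mult_comp_A[OF y z]] g_mult[OF x y] g_mult[OF y z]
        B.mult_assoc[OF g_comp[OF x] g_comp[OF y] g_comp[OF z]])
  show "dg_one A \<in> dg_comp A 0" by (rule one_comp_A)
  show "dg_mult A (dg_one A) x = x" if x: "x \<in> dg_comp A i" for x i
    by (simp add: mult_A[OF one_comp_A x] g_one B.one_mult[OF g_comp[OF x]] p_g[OF x])
  show "dg_mult A x (dg_one A) = x" if x: "x \<in> dg_comp A i" for x i
    by (simp add: mult_A[OF x one_comp_A] g_one B.mult_one[OF g_comp[OF x]] p_g[OF x])
  show "dg_diff A (dg_mult A x y) =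
      dg_mult A (dg_diff A x) y + dg_scale A ((-1) ^ i) (dg_mult A x (dg_diff A y))"
    if x: "x \<in> dg_comp A i" and y: "y \<in> dg_comp A j" for x y i j
  proof -
    let ?l = "dg_mult B (dg_diff B (g x)) (g y)" and ?r = "dg_scale B ((-1) ^ i) (dg_mult B (g x) (dg_diff B (g y)))"
    \<comment> \<open>For \<open>i = 0\<close> the degrees \<open>i - 1 + j\<close> and
      \<open>i + j - 1\<close> may disagree in the natural numbers; the product is 0 in that case.
      The same happens below for \<open>j = 0\<close>.\<close>
    have l: "?l \<in> Z (i + j - 1)"
    proof (cases i)
      case 0
      then show ?thesis
        using x B.diff_comp_0[OF g_comp] B.mult_scale_left[of 0 0 "g y" j 0] Z_closed(1) B.mult_add_left[of 0 0 0 "g y" j]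
          subspaceD(1)[OF B.module_scale B.subspace_comp] g_comp[OF y] by simp
    next
      case (Suc k)
      then show ?thesis using Z_mult[OF Z_diff'[OF g_Z[OF x]] g_Z[OF y]] by simp
    qed
    have m: "dg_mult B (g x) (dg_diff B (g y)) \<in> Z (i + j - 1)"
    proof (cases j)
      case 0
      then show ?thesis
        using y B.diff_comp_0[OF g_comp] Z_closed(1) B.mult_add_right[of "g x" i 0 0 0]
          subspaceD(1)[OF B.module_scale B.subspace_comp] g_comp[OF x] by simp
    next
      case (Suc k)
      then show ?thesis using Z_mult[OF g_Z[OF x] Z_diff'[OF g_Z[OF y]]] by simp
    qed
    have "dg_diff A (dg_mult A x y) = p (?l + ?r)"
      by (simp add: diff_A[OF mult_comp_A[OF x y]] g_mult[OF x y] B.leibniz[OF g_comp[OF x] g_comp[OF y]])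
    also have "\<dots> = dg_mult A (dg_diff A x) y + dg_scale A ((-1) ^ i) (dg_mult A x (dg_diff A y))"
      by (simp add: p_add[OF l Z_closed(3)[OF m]] p_scale[OF m] mult_A[OF diff_comp_A[OF x] y]
          mult_A[OF x diff_comp_A[OF y]] g_diff[OF x] g_diff[OF y])
    finally show ?thesis .
  qed
  show "dg_mult A x y = dg_scale A ((-1) ^ (i * j)) (dg_mult A y x)"
    if x: "x \<in> dg_comp A i" and y: "y \<in> dg_comp A j" for x y i j
    by (simp add: mult_A[OF x y] mult_A[OF y x] B.graded_comm[OF g_comp[OF x] g_comp[OF y]]
        p_scale[OF Z_mult[OF g_Z[OF y] g_Z[OF x]]])
  show "dg_mult A x x = 0" if x: "x \<in> dg_comp A i" and "odd i" for x i
    by (simp add: mult_A[OF x x] B.odd_square[OF g_comp[OF x] \<open>odd i\<close>] p_zero)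
qed

lemma dg_algebra_hom_g: "dg_algebra_hom A B g"
proof -
  interpret A: dg_algebra A by (rule dg_algebra_A)
  show ?thesis
    by unfold_locales (auto intro: g_comp g_add g_scale g_diff g_one g_mult)
qed

end

text \<open>As \<open>h\<close> maps into \<open>Z'\<close>, where \<open>g' \<circ> p'\<close> is
  the identity, the product of two images in \<open>A'\<close> is computed from \<open>h\<close>
  before \<open>p'\<close> is applied. This is what passes multiplicativity on to the
  composite.\<close>

lemma dg_transport_hom:
  assumes "dg_transport B A Z p g" "dg_transport B' A' Z' p' g'" "dg_algebra_hom B B' h"
    and h: "\<And>i w. w \<in> Z i \<Longrightarrow> h w \<in> Z' i"
  shows "dg_algebra_hom A A' (p' \<circ> h \<circ> g)"
proof -
  interpret A: dg_transport B A Z p g by fact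
  interpret A': dg_transport B' A' Z' p' g' by fact
  interpret h: dg_algebra_hom B B' h by fact
  interpret dA: dg_algebra A by (rule A.dg_algebra_A)
  interpret dA': dg_algebra A' by (rule A'.dg_algebra_A)
  have hg: "h (g x) \<in> Z' i" if "x \<in> dg_comp A i" for x i
    using h A.g_Z that by blast
  show ?thesis
  proof (unfold_locales, unfold comp_def)
    show "p' (h (g x)) \<in> dg_comp A' i" if "x \<in> dg_comp A i" for x i
      using A'.p_comp[OF hg[OF that]] .
    show "p' (h (g (x + y))) = p' (h (g x)) + p' (h (g y))" if x: "x \<in> dg_comp A i" and y: "y \<in> dg_comp A i" for x y i
      by (simp add: A.g_add[OF x y] h.hom_add[OF A.g_comp[OF x] A.g_comp[OF y]] A'.p_add[OF hg[OF x] hg[OF y]])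
    show "p' (h (g (dg_scale A r x))) = dg_scale A' r (p' (h (g x)))" if x: "x \<in> dg_comp A i" for r x i
      by (simp add: A.g_scale[OF x] h.hom_scale[OF A.g_comp[OF x]] A'.p_scale[OF hg[OF x]])
    show "p' (h (g (dg_diff A x))) = dg_diff A' (p' (h (g x)))" if x: "x \<in> dg_comp A i" for x i
      by (simp add: A.g_diff[OF x] h.hom_diff[OF A.g_comp[OF x]] A'.p_diff[OF hg[OF x]])
    show "p' (h (g (dg_one A))) = dg_one A'"
      by (simp add: A.g_one h.hom_one A'.p_one)
    show "p' (h (g (dg_mult A x y))) = dg_mult A' (p' (h (g x))) (p' (h (g y)))"
      if x: "x \<in> dg_comp A i" and y: "y \<in> dg_comp A j" for x y i j
      by (simp add: A.g_mult[OF x y] h.hom_mult[OF A.g_comp[OF x] A.g_comp[OF y]]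
          A'.mult_A[OF A'.p_comp[OF hg[OF x]] A'.p_comp[OF hg[OF y]]] A'.g_p[OF hg[OF x]] A'.g_p[OF hg[OF y]])
  qed
qed

text \<open>Scalars act through \<open>\<phi>\<close> so that one statement covers both algebras
  needed: \<Lambda> \<otimes> S over R, with \<open>const\<close> as \<open>\<phi>\<close>, and the
  Koszul complex over R, with the identity.\<close>

lemma dg_algebra_koszul:
  fixes z :: "'n::{finite,linorder} \<Rightarrow> 'c::comm_ring_1" and \<phi> :: "'r::comm_ring_1 \<Rightarrow> 'c"
  assumes \<phi>: "\<And>r s. \<phi> (r + s) = \<phi> r + \<phi> s" "\<And>r s. \<phi> (r * s) = \<phi> r * \<phi> s" "\<phi> 1 = 1"
  shows "dg_algebra \<lparr>dg_comp = ext_comp, dg_scale = (\<lambda>r \<omega> T. \<phi> r * \<omega> T), dg_diff = koszul_diff z,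
    dg_mult = ext_mult, dg_one = ext_basis {} 1\<rparr>" (is "dg_algebra ?E")
proof -
  have "\<phi> 0 = 0" using \<phi>(1)[of 0 0] by simp
  then have "\<phi> (-1) = -1" using \<phi>(1)[of "-1" 1] \<phi>(3) by (simp add: eq_neg_iff_add_eq_0)
  \<comment> \<open>The signs in the dg axioms are scalars of the base ring, so they reach the
    exterior algebra as images under \<open>\<phi>\<close>.\<close>
  then have \<phi>m: "\<phi> ((-1) ^ i) = (-1) ^ i" for i by (induction i) (simp_all only: power_0 power_Suc \<phi>)
  have s: "dg_scale ?E = (\<lambda>r. ext_scale (\<phi> r))" by (simp add: ext_scale_def fun_eq_iff)
  have mod: "module (dg_scale ?E)"
    unfolding s by (rule module.intro) (simp_all add: ext_scale_simps \<phi>)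
  show ?thesis
  proof (rule dg_algebra.intro)
    show "module (dg_scale ?E)" by (rule mod)
    show "module.subspace (dg_scale ?E) (dg_comp ?E i)" for i
      by (rule module.subspaceI[OF mod]) (auto simp: ext_comp_def, metis add.right_neutral, metis mult_zero_right)
    show "dg_diff ?E (dg_mult ?E x y) =
        dg_mult ?E (dg_diff ?E x) y + dg_scale ?E ((-1) ^ i) (dg_mult ?E x (dg_diff ?E y))"
      if "x \<in> dg_comp ?E i" "y \<in> dg_comp ?E j" for x y i j
      unfolding s using that by (simp add: \<phi>m koszul_diff_leibniz)
    show "dg_mult ?E x y = dg_scale ?E ((-1) ^ (i * j)) (dg_mult ?E y x)"
      if "x \<in> dg_comp ?E i" "y \<in> dg_comp ?E j" for x y i j
      unfolding s using that by (simp add: \<phi>m ext_mult_graded_commute[of x i y j])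
    show "dg_mult ?E x (dg_one ?E) = x" if "x \<in> dg_comp ?E i" for x i
    proof -
      have "ext_basis {} 1 \<in> ext_comp 0" by (auto simp: ext_comp_def ext_basis_def)
      from ext_mult_graded_commute[OF _ this, of x i] that show ?thesis
        by (simp add: ext_mult_scalar ext_scale_simps)
    qed
    show "dg_one ?E \<in> dg_comp ?E 0" by (auto simp: ext_comp_def ext_basis_def)
  qed (unfold s, simp_all add: koszul_diff_comp_Suc koszul_diff_comp_0 koszul_diff_add koszul_diff_scale
      koszul_diff_square ext_mult_comp ext_mult_add_left ext_mult_add_right ext_mult_scale_left
      ext_mult_scale_right ext_mult_assoc ext_mult_scalar ext_scale_simps ext_mult_odd_square)
qed

section \<open>The truncated algebras\<close>

lemma const_simps [simp]:
  "const 0 = 0" "const (1::'c::comm_ring_1) = 1" "const (a + b) = const a + const (b::'c)"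
  "const (a * b) = const a * const (b::'c)" "const (- a) = - const (a::'c)" "const (of_nat k) = (of_nat k :: _ \<Rightarrow>\<^sub>0 'c)"
  by (simp_all add: const_def single_add mult_single single_uminus)

lemma shuffle_sign_cases: "shuffle_sign T U = (1::'c) \<or> shuffle_sign T U = (-1::'c::comm_ring_1)"
  by (cases "even (card {(t, u). t \<in> T \<and> u \<in> U \<and> u < t})") (simp_all add: shuffle_sign_def)

definition part :: "(nat \<Rightarrow> bool) \<Rightarrow> (('n::finite \<Rightarrow>\<^sub>0 nat) \<Rightarrow>\<^sub>0 'c::comm_ring_1, 'n) ext
    \<Rightarrow> (('n \<Rightarrow>\<^sub>0 nat) \<Rightarrow>\<^sub>0 'c, 'n) ext"
  where "part P \<omega> = (\<lambda>T. poly_part P (\<omega> T))"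

lemma trunc_eq_part: "trunc c = part (\<lambda>m. m < c)"
  by (simp add: fun_eq_iff trunc_def part_def)

lemma part_add: "part P (\<omega> + \<eta>) = part P \<omega> + part P \<eta>"
  by (rule ext) (simp add: part_def poly_part_add)

lemma part_zero [simp]: "part P 0 = 0"
  by (rule ext) (simp add: part_def)

lemma part_sum: "part P (\<Sum>a\<in>A. f a) = (\<Sum>a\<in>A. part P (f a))"
  by (rule ext) (simp add: part_def sum_fun_apply poly_part_sum)

lemma part_scale_const: "part P (ext_scale (const r) \<omega>) = ext_scale (const r) (part P \<omega>)"
  by (rule ext) (simp add: part_def ext_scale_def poly_part_const_mult)

lemma part_part: "part P (part Q \<omega>) = part (\<lambda>m. P m \<and> Q m) \<omega>"
  by (rule ext) (simp add: part_def poly_part_part)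

lemma part_basis: "part P (ext_basis T q) = ext_basis T (poly_part P q)"
  by (rule ext) (simp add: part_def ext_basis_def)

lemma part_comp:
  assumes "\<omega> \<in> ext_comp i" shows "part P \<omega> \<in> ext_comp i"
  unfolding ext_comp_def
proof clarify
  fix T assume "part P \<omega> T \<noteq> 0"
  then have "\<omega> T \<noteq> 0" unfolding part_def by (metis poly_part_zero)
  then show "card T = i" using assms unfolding ext_comp_def by blast
qed

lemma part_eq_iff:
  fixes \<omega> :: "(('n::finite \<Rightarrow>\<^sub>0 nat) \<Rightarrow>\<^sub>0 'c::comm_ring_1, 'n) ext"
  shows "part P \<omega> = \<omega> \<longleftrightarrow> (\<forall>T. \<forall>\<mu>\<in>Poly_Mapping.keys (\<omega> T). P (deg \<mu>))"
proof
  assume *: "part P \<omega> = \<omega>"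
  have "P (deg \<mu>)" if "\<mu> \<in> Poly_Mapping.keys (part P \<omega> T)" for T \<mu>
    using that by (simp add: part_def keys_poly_part)
  then show "\<forall>T. \<forall>\<mu>\<in>Poly_Mapping.keys (\<omega> T). P (deg \<mu>)" unfolding * by blast
next
  assume *: "\<forall>T. \<forall>\<mu>\<in>Poly_Mapping.keys (\<omega> T). P (deg \<mu>)"
  show "part P \<omega> = \<omega>"
    unfolding part_def by (rule ext, rule poly_part_id) (use * in blast)
qed

lemma poly_part_sign:
  fixes q :: "('n::finite \<Rightarrow>\<^sub>0 nat) \<Rightarrow>\<^sub>0 'c::comm_ring_1"
  shows "poly_part P (pre_sign v T * q) = pre_sign v T * poly_part P q"
  using pre_sign_cases[of v T, where 'c = "('n \<Rightarrow>\<^sub>0 nat) \<Rightarrow>\<^sub>0 'c"] by (auto simp: poly_part_minus)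

lemma part_wedge: "part P (wedge v \<omega>) = wedge v (part P \<omega>)"
  by (rule ext) (simp add: part_def wedge_def poly_part_sign)

lemma part_de_rham:
  assumes "\<And>m. Q (Suc m) = P m"
  shows "part P (de_rham \<omega>) = de_rham (part Q \<omega>)"
proof -
  have "part P (ext_partial v \<omega>) = ext_partial v (part Q \<omega>)" for v
    by (rule ext) (simp add: part_def ext_partial_def poly_part_partial[of Q P, OF assms])
  then show ?thesis by (simp add: de_rham_def part_sum part_wedge)
qed

lemma part_kappa: "part P (kappa \<omega>) = kappa (part (\<lambda>m. P (Suc m)) \<omega>)"
  by (rule ext) (simp add: part_def kappa_def koszul_diff_apply poly_part_sum mult.assoc poly_part_var_mult poly_part_sign)

lemma part_dkos: "part P (dkos \<omega>) = dkos (part P \<omega>)"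
  by (rule ext) (simp add: part_def dkos_def koszul_diff_apply poly_part_sum mult.assoc poly_part_const_mult poly_part_sign)

lemma trunc_mult_left: "trunc c (ext_mult (trunc c \<omega>) \<eta>) = trunc c (ext_mult \<omega> \<eta>)"
proof
  fix W
  have "poly_part (\<lambda>m. m < c) (shuffle_sign T (W - T) * poly_part (\<lambda>m. m < c) (\<omega> T) * \<eta> (W - T))
    = poly_part (\<lambda>m. m < c) (shuffle_sign T (W - T) * \<omega> T * \<eta> (W - T))" for T
    using shuffle_sign_cases[of T "W - T", where 'c = "('b, 'a) S"]
    by (auto simp: poly_part_minus poly_part_less_mult)
  then show "trunc c (ext_mult (trunc c \<omega>) \<eta>) W = trunc c (ext_mult \<omega> \<eta>) W"
    by (simp add: trunc_def ext_mult_apply poly_part_sum)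
qed

lemma trunc_mult_right: "trunc c (ext_mult \<omega> (trunc c \<eta>)) = trunc c (ext_mult \<omega> \<eta>)"
proof
  fix W
  have "poly_part (\<lambda>m. m < c) (shuffle_sign T (W - T) * \<omega> T * poly_part (\<lambda>m. m < c) (\<eta> (W - T)))
    = poly_part (\<lambda>m. m < c) (shuffle_sign T (W - T) * \<omega> T * \<eta> (W - T))" for T
    using poly_part_less_mult[of c "\<eta> (W - T)" "shuffle_sign T (W - T) * \<omega> T"] by (simp add: mult.commute)
  then show "trunc c (ext_mult \<omega> (trunc c \<eta>)) W = trunc c (ext_mult \<omega> \<eta>) W"
    by (simp add: trunc_def ext_mult_apply poly_part_sum)
qed

lemma X_simps [simp]:
  "dg_scale (X_dga c) r = ext_scale (const r)"
  "dg_diff (X_dga c) \<omega> = trunc c (kappa \<omega> + dkos \<omega>)"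
  "dg_mult (X_dga c) \<omega> \<eta> = trunc c (ext_mult \<omega> \<eta>)"
  "dg_one (X_dga c) = ext_basis {} 1"
  by (simp_all add: X_dga_def ext_scale_def fun_eq_iff)

lemma X_comp: "dg_comp (X_dga c) i = {\<omega> \<in> ext_comp i. trunc c \<omega> = \<omega>}"
  by (simp add: X_dga_def trunc_eq_part part_eq_iff)

lemma kappa_plus_dkos: "kappa \<omega> + dkos \<omega> = koszul_diff (\<lambda>v. var v + const (var v)) \<omega>"
  by (simp add: kappa_def dkos_def koszul_diff_plus)

lemma dg_algebra_X:
  assumes "1 \<le> c"
  shows "dg_algebra (X_dga c :: (('k::field, 'n::{finite,linorder}) R, ('k, 'n) LS) dga)"
proof (rule dg_algebra_retract)
  \<comment> \<open>Before truncation, \<open>kappa + dkos\<close> is the Koszul differential over S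
    of the family y_v + x_v, so the double complex needs no treatment of its own.\<close>
  let ?z = "\<lambda>v. var v + const (var v) :: ('k, 'n) S"
  let ?E = "\<lparr>dg_comp = ext_comp, dg_scale = (\<lambda>r \<omega> T. const r * \<omega> T), dg_diff = koszul_diff ?z,
    dg_mult = ext_mult, dg_one = ext_basis {} 1\<rparr> :: (('k, 'n) R, ('k, 'n) LS) dga"
  show "dg_algebra ?E" by (rule dg_algebra_koszul) simp_all
  show "dg_scale (X_dga c :: (('k, 'n) R, ('k, 'n) LS) dga) = dg_scale ?E"
    by (simp add: fun_eq_iff ext_scale_def)
  show "dg_comp (X_dga c :: (('k, 'n) R, ('k, 'n) LS) dga) i = {x \<in> dg_comp ?E i. trunc c x = x}" for i
    by (simp add: X_comp)
  show "dg_diff (X_dga c) \<omega> = trunc c (dg_diff ?E \<omega>)" for \<omega> :: "('k, 'n) LS"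
    by (simp add: kappa_plus_dkos)
  show "trunc c (dg_one ?E) = dg_one ?E"
  proof -
    have "poly_part (\<lambda>m. m < c) (1 :: ('k, 'n) S) = 1"
      using assms poly_part_id[of "1 :: ('k, 'n) S" "\<lambda>m. m < c"] by simp
    then show ?thesis by (simp add: trunc_eq_part part_basis)
  qed
  show "trunc c \<omega> \<in> dg_comp ?E i" if "\<omega> \<in> dg_comp ?E i" for i \<omega>
    using that by (simp add: trunc_eq_part part_comp)
  show "trunc c (trunc c \<omega>) = trunc c \<omega>" for \<omega> :: "('k, 'n) LS"
    by (simp add: trunc_eq_part part_part)
  show "trunc c (\<omega> + \<eta>) = trunc c \<omega> + trunc c \<eta>" for \<omega> \<eta> :: "('k, 'n) LS"
    by (simp add: trunc_eq_part part_add)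
  show "trunc c (dg_scale ?E r \<omega>) = dg_scale ?E r (trunc c \<omega>)" for r \<omega>
    using part_scale_const[of "\<lambda>m. m < c" r \<omega>] by (simp add: trunc_eq_part ext_scale_def)
  have "(Suc m < c \<and> m < c) = (Suc m < c)" for m by auto
  then show "trunc c (dg_diff ?E (trunc c \<omega>)) = trunc c (dg_diff ?E \<omega>)" for \<omega>
    by (simp flip: kappa_plus_dkos add: trunc_eq_part part_add part_kappa part_dkos part_part)
qed (simp_all add: trunc_mult_left trunc_mult_right)

text \<open>The bound drops by one along with the y-degree. Closedness therefore survives
  truncation, and moreover terms of y-degree exactly c - 1 in \<open>de_rham \<omega>\<close> become
  invisible, which \<open>i_inf_side\<close> exploits.\<close>

lemma de_rham_trunc: "de_rham (trunc c \<omega>) = part (\<lambda>m. Suc m < c) (de_rham \<omega>)"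
  by (simp add: trunc_eq_part part_de_rham[of "\<lambda>m. m < c" "\<lambda>m. Suc m < c"])

section \<open>The de Rham closed subalgebra\<close>

text \<open>The second condition is what yields a subcomplex: for c > 1 the form e_v \<otimes> 1 is
  closed, but its differential contains y_v, which is not.\<close>

definition closed_part :: "nat \<Rightarrow> nat \<Rightarrow> ('k::field, 'n::{finite,linorder}) LS set"
  where "closed_part c i =
    {\<omega> \<in> dg_comp (X_dga c) i. de_rham \<omega> = 0 \<and> de_rham (dg_diff (X_dga c) \<omega>) = 0}"

lemma de_rham_trunc_mult:
  assumes "de_rham \<omega> = 0" "de_rham \<eta> = 0" shows "de_rham (trunc c (ext_mult \<omega> \<eta>)) = 0"
  using assms by (simp add: de_rham_trunc de_rham_derivation)

lemma closed_part_subspace: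
  assumes "1 \<le> c"
  shows "module.subspace (dg_scale (X_dga c)) (closed_part c i :: ('k::field, 'n::{finite,linorder}) LS set)"
proof -
  interpret X: dg_algebra "X_dga c :: (('k, 'n) R, ('k, 'n) LS) dga" using assms by (rule dg_algebra_X)
  note sub = subspaceD[OF X.module_scale X.subspace_comp]
  have "dg_diff (X_dga c) (0 :: ('k, 'n) LS) = 0"
    by (simp add: kappa_def dkos_def trunc_eq_part)
  moreover have "dg_diff (X_dga c) (ext_scale (const r) x) = ext_scale (const r) (dg_diff (X_dga c) x)"
    if "x \<in> dg_comp (X_dga c) i" for x :: "('k, 'n) LS" and r
    using X.diff_scale[OF that, of r] by (simp del: X_simps(2))
  ultimately show ?thesis
    using sub by (intro module.subspaceI[OF X.module_scale])
      (auto simp: closed_part_def de_rham_add de_rham_scale_const X.diff_add[of _ i] ext_scale_simps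
        simp del: X_simps(2))
qed

lemma closed_part_diff:
  fixes \<omega> :: "('k::field, 'n::{finite,linorder}) LS"
  assumes "1 \<le> c" "\<omega> \<in> closed_part c (Suc i)"
  shows "dg_diff (X_dga c) \<omega> \<in> closed_part c i"
proof -
  interpret X: dg_algebra "X_dga c :: (('k, 'n) R, ('k, 'n) LS) dga" using assms(1) by (rule dg_algebra_X)
  show ?thesis using assms(2) X.diff_comp[of \<omega> i] X.diff_diff[of \<omega> "Suc i"]
    by (auto simp: closed_part_def simp del: X_simps)
qed

text \<open>By the Leibniz rule the differential of the product is a combination of products of
  forms that are all closed, two of them being differentials closed by the second condition.\<close>

lemma closed_part_mult:
  fixes \<omega> \<eta> :: "('k::field, 'n::{finite,linorder}) LS"
  assumes "1 \<le> c" "\<omega> \<in> closed_part c i" "\<eta> \<in> closed_part c j"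
  shows "dg_mult (X_dga c) \<omega> \<eta> \<in> closed_part c (i + j)"
proof -
  interpret X: dg_algebra "X_dga c :: (('k, 'n) R, ('k, 'n) LS) dga" using assms(1) by (rule dg_algebra_X)
  have *: "de_rham (dg_mult (X_dga c) \<theta> \<zeta>) = 0" if "de_rham \<theta> = 0" "de_rham \<zeta> = 0" for \<theta> \<zeta> :: "('k, 'n) LS"
    using de_rham_trunc_mult[OF that] by simp
  show ?thesis using assms(2,3) X.mult_comp[of \<omega> i \<eta> j] X.leibniz[of \<omega> i \<eta> j]
    by (auto simp: closed_part_def * de_rham_add de_rham_scale_const ext_scale_simps simp del: X_simps(2-))
qed

lemma closed_part_one:
  assumes c: "1 \<le> c"
  shows "dg_one (X_dga c) \<in> (closed_part c 0 :: ('k::field, 'n::{finite,linorder}) LS set)"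
proof -
  interpret X: dg_algebra "X_dga c :: (('k, 'n) R, ('k, 'n) LS) dga" using c by (rule dg_algebra_X)
  have "de_rham (ext_basis {} 1 :: ('k, 'n) LS) = 0" by (simp add: de_rham_scalar)
  then show ?thesis using X.one_comp X.diff_comp_0[OF X.one_comp]
    by (simp add: closed_part_def)
qed

section \<open>Bihomogeneous components\<close>

lemma LS_comp_iff: "\<omega> \<in> LS_comp i m \<longleftrightarrow> \<omega> \<in> ext_comp i \<and> part (\<lambda>k. k = m) \<omega> = \<omega>"
  by (auto simp: LS_comp_def part_eq_iff)

lemma part_LS_comp: "\<omega> \<in> ext_comp i \<Longrightarrow> part (\<lambda>k. k = m) \<omega> \<in> LS_comp i m"
  by (simp add: LS_comp_iff part_comp part_part)

lemma ext_scale_comp: "\<omega> \<in> ext_comp i \<Longrightarrow> ext_scale q \<omega> \<in> ext_comp i"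
  unfolding ext_comp_def ext_scale_def by (auto, metis mult_zero_right)

lemma ext_comp_add: "\<omega> \<in> ext_comp i \<Longrightarrow> \<eta> \<in> ext_comp i \<Longrightarrow> \<omega> + \<eta> \<in> ext_comp i"
  for \<omega> :: "('c::comm_ring_1, 'n) ext"
  unfolding ext_comp_def by (clarsimp) (metis add.right_neutral)

lemma ext_comp_zero [simp]: "0 \<in> ext_comp i"
  by (simp add: ext_comp_def)

lemma ext_comp_sum: "(\<And>a. a \<in> A \<Longrightarrow> f a \<in> ext_comp i) \<Longrightarrow> (\<Sum>a\<in>A. f a) \<in> ext_comp i"
  for f :: "'a \<Rightarrow> ('c::comm_ring_1, 'n) ext"
  by (induction A rule: infinite_finite_induct) (auto intro: ext_comp_add simp del: fun_apply_simps)

lemma wedge_comp: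
  fixes \<omega> :: "('c::comm_ring_1, 'n::{finite,linorder}) ext"
  assumes "\<omega> \<in> ext_comp i" shows "wedge v \<omega> \<in> ext_comp (Suc i)"
  unfolding ext_comp_def
proof clarify
  fix T assume "wedge v \<omega> T \<noteq> 0"
  then have "v \<in> T" "\<omega> (T - {v}) \<noteq> 0" unfolding wedge_def by (auto split: if_splits)
  then have "v \<in> T" "card (T - {v}) = i" using assms unfolding ext_comp_def by blast+
  then show "card T = Suc i" by (metis card.remove finite)
qed

lemma de_rham_comp:
  assumes "\<omega> \<in> ext_comp i" shows "de_rham \<omega> \<in> ext_comp (Suc i)"
proof -
  have "ext_partial v \<omega> \<in> ext_comp i" for v
    unfolding ext_comp_def
  proof clarify
    fix T assume "ext_partial v \<omega> T \<noteq> 0"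
    then have "\<omega> T \<noteq> 0" unfolding ext_partial_def by (metis partial_zero)
    then show "card T = i" using assms unfolding ext_comp_def by blast
  qed
  then show ?thesis unfolding de_rham_def by (intro ext_comp_sum wedge_comp)
qed

lemma LS_comp_zero [simp]: "0 \<in> LS_comp i m"
  by (simp add: LS_comp_iff)

lemma LS_comp_scale_const: "\<omega> \<in> LS_comp i m \<Longrightarrow> ext_scale (const r) \<omega> \<in> LS_comp i m"
  by (simp add: LS_comp_iff part_scale_const ext_scale_comp)

lemma LS_comp_minus: "\<omega> \<in> LS_comp i m \<Longrightarrow> - \<omega> \<in> LS_comp i m"
  using LS_comp_scale_const[of \<omega> i m "-1"] by (simp add: ext_scale_simps)

lemma kappa_LS_comp: "\<omega> \<in> LS_comp (Suc i) m \<Longrightarrow> kappa \<omega> \<in> LS_comp i (Suc m)"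
  by (simp add: LS_comp_iff part_kappa) (simp add: kappa_def koszul_diff_comp_Suc)

lemma dkos_LS_comp: "\<omega> \<in> LS_comp (Suc i) m \<Longrightarrow> dkos \<omega> \<in> LS_comp i m"
  by (simp add: LS_comp_iff part_dkos) (simp add: dkos_def koszul_diff_comp_Suc)

lemma de_rham_LS_comp: "\<omega> \<in> LS_comp i (Suc m) \<Longrightarrow> de_rham \<omega> \<in> LS_comp (Suc i) m"
  by (simp add: LS_comp_iff part_de_rham[of "\<lambda>k. k = Suc m" "\<lambda>k. k = m"] de_rham_comp)

lemma de_rham_LS_comp_0:
  assumes "\<omega> \<in> LS_comp i 0" shows "de_rham \<omega> = 0"
proof -
  have "de_rham \<omega> = part (\<lambda>_. False) (de_rham \<omega>)"
    using assms part_de_rham[of "\<lambda>k. k = 0" "\<lambda>_. False" \<omega>] by (simp add: LS_comp_iff)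
  also have "\<dots> = 0" by (rule ext) (simp add: part_def poly_part_none)
  finally show ?thesis .
qed

lemma ext_comp_gt_card: "CARD('n::finite) < i \<Longrightarrow> \<omega> \<in> ext_comp i \<Longrightarrow> (\<omega> :: ('c::zero, 'n) ext) = 0"
  unfolding ext_comp_def by (rule ext, clarsimp) (metis card_mono finite top_greatest not_less)

lemma LS_comp_gt_card:
  assumes "CARD('n) < i" "\<omega> \<in> LS_comp i m"
  shows "(\<omega> :: ('k::field, 'n::{finite,linorder}) LS) = 0"
  by (rule ext_comp_gt_card[OF assms(1)]) (use assms(2) in \<open>simp add: LS_comp_iff\<close>)

lemma kappa_zero [simp]: "kappa 0 = 0" and dkos_zero [simp]: "dkos 0 = 0"
  by (simp_all add: kappa_def dkos_def)

lemma kappa_dkos: "kappa (dkos \<omega>) = - dkos (kappa \<omega>)"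
  unfolding kappa_def dkos_def by (rule koszul_diff_anticommute)

lemma kappa_kappa: "kappa (kappa \<omega>) = 0"
  unfolding kappa_def by (rule koszul_diff_square)

lemma de_rham_homotopy:
  assumes "\<omega> \<in> LS_comp i m"
  shows "kappa (de_rham \<omega>) + de_rham (kappa \<omega>) = ext_scale (of_nat (i + m)) \<omega>"
proof
  fix T
  have "euler (\<omega> T) = of_nat m * \<omega> T"
    using assms by (intro euler_homogeneous) (auto simp: LS_comp_def)
  moreover have "of_nat (card T) * \<omega> T = of_nat i * \<omega> T"
    using assms unfolding LS_comp_def ext_comp_def by (cases "\<omega> T = 0") auto
  ultimately show "(kappa (de_rham \<omega>) + de_rham (kappa \<omega>)) T = ext_scale (of_nat (i + m)) \<omega> T"
    unfolding kappa_def koszul_de_rham_homotopy by (simp add: ext_scale_def distrib_right)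
qed

lemma de_rham_kappa:
  assumes "\<omega> \<in> LS_comp i m" "de_rham \<omega> = 0"
  shows "de_rham (kappa \<omega>) = ext_scale (of_nat (i + m)) \<omega>"
  using de_rham_homotopy[OF assms(1)] assms(2) by simp

section \<open>The homotopy as a rescaled de Rham differential\<close>

lemma const_mult_single: "const (a::'c::comm_ring_1) * Poly_Mapping.single \<mu> b = Poly_Mapping.single \<mu> (a * b)"
  by (simp add: const_def mult_single)

text \<open>The denominator in \<open>sigma\<close> is constant on a bihomogeneous component and can
  be pulled out. Where it vanishes in \<open>'k\<close>, both sides are 0 by the convention for
  division by zero.\<close>

lemma sigma_eq:
  fixes \<omega> :: "('k::field, 'n::{finite,linorder}) LS"
  assumes "\<omega> \<in> LS_comp i m"
  shows "sigma \<omega> = ext_scale (const (const (1 / of_nat (i + m)))) (de_rham \<omega>)"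
proof -
  let ?N = "const (const (1 / of_nat (i + m))) :: ('k, 'n) S"
  have "(\<Sum>\<mu>\<in>Poly_Mapping.keys (\<omega> T). \<Sum>v\<in>Poly_Mapping.keys \<mu>.
      ext_mult (ext_basis {v} 1)
        (ext_basis T (Poly_Mapping.single (\<mu> - Poly_Mapping.single v 1)
          (const (of_nat (Poly_Mapping.lookup \<mu> v) / of_nat (card T + deg \<mu>))
            * Poly_Mapping.lookup (\<omega> T) \<mu>))))
    = (\<Sum>v\<in>UNIV. wedge v (ext_basis T (?N * partial v (\<omega> T))))" for T
  proof (cases "\<omega> T = 0")
    case False
    have T: "card T = i" using False assms by (auto simp: LS_comp_def ext_comp_def)
    have m: "deg \<mu> = m" if "\<mu> \<in> Poly_Mapping.keys (\<omega> T)" for \<mu> using assms that by (auto simp: LS_comp_def)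
    have "(\<Sum>v\<in>Poly_Mapping.keys \<mu>. ext_mult (ext_basis {v} 1)
        (ext_basis T (Poly_Mapping.single (\<mu> - Poly_Mapping.single v 1)
          (const (of_nat (Poly_Mapping.lookup \<mu> v) / of_nat (card T + deg \<mu>))
            * Poly_Mapping.lookup (\<omega> T) \<mu>))))
      = (\<Sum>v\<in>UNIV. wedge v (ext_basis T (?N * Poly_Mapping.single (\<mu> - Poly_Mapping.single v 1)
          (of_nat (Poly_Mapping.lookup \<mu> v) * Poly_Mapping.lookup (\<omega> T) \<mu>))))"
      if \<mu>: "\<mu> \<in> Poly_Mapping.keys (\<omega> T)" for \<mu>
    proof (rule sum.mono_neutral_cong_left)
      fix v
      have "const (of_nat (Poly_Mapping.lookup \<mu> v) / of_nat (i + m))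
          = (const (1 / of_nat (i + m)) * of_nat (Poly_Mapping.lookup \<mu> v) :: ('k, 'n) R)"
        unfolding const_simps(6)[symmetric] const_simps(4)[symmetric] by simp
      then have "Poly_Mapping.single (\<mu> - Poly_Mapping.single v 1)
          (const (of_nat (Poly_Mapping.lookup \<mu> v) / of_nat (i + m)) * Poly_Mapping.lookup (\<omega> T) \<mu>)
        = ?N * Poly_Mapping.single (\<mu> - Poly_Mapping.single v 1)
          (of_nat (Poly_Mapping.lookup \<mu> v) * Poly_Mapping.lookup (\<omega> T) \<mu>)"
        by (simp only: const_mult_single mult.assoc)
      then show "ext_mult (ext_basis {v} 1)
        (ext_basis T (Poly_Mapping.single (\<mu> - Poly_Mapping.single v 1)
          (const (of_nat (Poly_Mapping.lookup \<mu> v) / of_nat (card T + deg \<mu>))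
            * Poly_Mapping.lookup (\<omega> T) \<mu>)))
        = wedge v (ext_basis T (?N * Poly_Mapping.single (\<mu> - Poly_Mapping.single v 1)
          (of_nat (Poly_Mapping.lookup \<mu> v) * Poly_Mapping.lookup (\<omega> T) \<mu>)))"
        unfolding T m[OF \<mu>] by (simp only: ext_mult_generator ext_scale_simps(7))
    qed (auto simp: in_keys_iff)
    then have "(\<Sum>\<mu>\<in>Poly_Mapping.keys (\<omega> T). \<Sum>v\<in>Poly_Mapping.keys \<mu>.
      ext_mult (ext_basis {v} 1)
        (ext_basis T (Poly_Mapping.single (\<mu> - Poly_Mapping.single v 1)
          (const (of_nat (Poly_Mapping.lookup \<mu> v) / of_nat (card T + deg \<mu>))
            * Poly_Mapping.lookup (\<omega> T) \<mu>))))
      = (\<Sum>v\<in>UNIV. \<Sum>\<mu>\<in>Poly_Mapping.keys (\<omega> T). wedge v (ext_basis T (?N * Poly_Mapping.single (\<mu> - Poly_Mapping.single v 1)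
          (of_nat (Poly_Mapping.lookup \<mu> v) * Poly_Mapping.lookup (\<omega> T) \<mu>))))"
      by (subst sum.swap) simp
    also have "\<dots> = (\<Sum>v\<in>UNIV. wedge v (ext_basis T (?N * partial v (\<omega> T))))"
    proof (rule sum.cong[OF refl])
      fix v
      have "ext_basis T (\<Sum>a\<in>A. f a) = (\<Sum>a\<in>A. ext_basis T (f a))" for A and f :: "('n \<Rightarrow>\<^sub>0 nat) \<Rightarrow> ('k, 'n) S"
        by (rule ext) (simp add: ext_basis_def sum_fun_apply)
      then show "(\<Sum>\<mu>\<in>Poly_Mapping.keys (\<omega> T). wedge v (ext_basis T (?N * Poly_Mapping.single (\<mu> - Poly_Mapping.single v 1)
          (of_nat (Poly_Mapping.lookup \<mu> v) * Poly_Mapping.lookup (\<omega> T) \<mu>))))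
        = wedge v (ext_basis T (?N * partial v (\<omega> T)))"
        by (simp add: partial_def sum_distrib_left wedge_sum)
    qed
    finally show ?thesis .
  qed simp
  then have "sigma \<omega> = (\<Sum>T\<in>UNIV. \<Sum>v\<in>UNIV. wedge v (ext_basis T (?N * partial v (\<omega> T))))"
    unfolding sigma_def by simp
  also have "\<dots> = (\<Sum>v\<in>UNIV. wedge v (\<Sum>T\<in>UNIV. ext_basis T (ext_scale ?N (ext_partial v \<omega>) T)))"
    by (subst sum.swap) (simp add: wedge_sum ext_scale_def ext_partial_def)
  also have "\<dots> = ext_scale ?N (de_rham \<omega>)"
    by (simp add: ext_basis_sum[symmetric] wedge_scale de_rham_def ext_scale_sum)
  finally show ?thesis .
qed

lemma sigma_zero [simp]: "sigma 0 = 0"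
  using sigma_eq[of 0 0 0] by (simp add: ext_scale_simps)

lemma sigma_LS_comp: "\<omega> \<in> LS_comp i (Suc m) \<Longrightarrow> sigma \<omega> \<in> LS_comp (Suc i) m"
  by (simp add: sigma_eq de_rham_LS_comp LS_comp_scale_const)

lemma de_rham_sigma: "\<omega> \<in> LS_comp i m \<Longrightarrow> de_rham (sigma \<omega>) = 0"
  by (simp add: sigma_eq de_rham_scale_const de_rham_square ext_scale_simps)

text \<open>Every use of the assumption on the characteristic passes through here, with
  \<open>c + CARD('n)\<close> for \<open>b\<close> and a total degree for \<open>N\<close>.\<close>

lemma of_nat_neq_0:
  assumes "CHAR('k::field) = 0 \<or> CHAR('k) \<ge> b" "0 < N" "N < b"
  shows "(of_nat N :: 'k) \<noteq> 0"
  using assms by (auto simp: of_nat_eq_0_iff_char_dvd dest: dvd_imp_le)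

lemma scale_of_nat_inverse:
  fixes \<omega> :: "('k::field, 'n::{finite,linorder}) LS"
  assumes "(of_nat N :: 'k) \<noteq> 0"
  shows "ext_scale (const (const (1 / of_nat N))) (ext_scale (of_nat N) \<omega>) = \<omega>"
    "ext_scale (of_nat N) (ext_scale (const (const (1 / of_nat N))) \<omega>) = \<omega>"
proof -
  have "const (const (1 / of_nat N)) * of_nat N = (const (const (1 / of_nat N * of_nat N :: 'k)) :: ('k, 'n) S)"
    by (simp only: const_simps)
  then have "const (const (1 / of_nat N :: 'k)) * of_nat N = (1 :: ('k, 'n) S)"
    using assms by simp
  then show "ext_scale (const (const (1 / of_nat N))) (ext_scale (of_nat N) \<omega>) = \<omega>"
    "ext_scale (of_nat N) (ext_scale (const (const (1 / of_nat N))) \<omega>) = \<omega>"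
    by (simp_all add: ext_scale_simps mult.commute)
qed

lemma de_rham_eq_sigma:
  fixes \<omega> :: "('k::field, 'n::{finite,linorder}) LS"
  assumes "\<omega> \<in> LS_comp i m" "(of_nat (i + m) :: 'k) \<noteq> 0"
  shows "de_rham \<omega> = ext_scale (of_nat (i + m)) (sigma \<omega>)"
  using sigma_eq[OF assms(1)] scale_of_nat_inverse(2)[OF assms(2), of "de_rham \<omega>"]
  by (simp del: of_nat_add)

lemma kappa_scale: "kappa (ext_scale q \<omega>) = ext_scale q (kappa \<omega>)"
  by (simp add: kappa_def koszul_diff_scale)

text \<open>The square of \<open>kappa\<close> is 0, so one term of the homotopy formula drops out
  on images of \<open>kappa\<close>: there \<open>sigma\<close> is a section of
  \<open>kappa\<close>.\<close>

lemma kappa_sigma_kappa: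
  fixes \<omega> :: "('k::field, 'n::{finite,linorder}) LS"
  assumes "\<omega> \<in> LS_comp (Suc i) m" "(of_nat (Suc i + m) :: 'k) \<noteq> 0"
  shows "kappa (sigma (kappa \<omega>)) = kappa \<omega>"
proof -
  have k: "kappa \<omega> \<in> LS_comp i (Suc m)" using assms(1) by (rule kappa_LS_comp)
  have "kappa (de_rham (kappa \<omega>)) = ext_scale (of_nat (i + Suc m)) (kappa \<omega>)"
    using de_rham_homotopy[OF k] by (simp add: kappa_kappa)
  then show ?thesis
    using scale_of_nat_inverse(1)[of "i + Suc m" "kappa \<omega>"] assms(2) by (simp add: sigma_eq[OF k] kappa_scale)
qed

text \<open>Here closedness removes the other term of the homotopy formula, so that
  \<open>sigma\<close> is a left inverse of \<open>kappa\<close> on closed forms.\<close>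

lemma sigma_kappa:
  fixes \<omega> :: "('k::field, 'n::{finite,linorder}) LS"
  assumes "\<omega> \<in> LS_comp (Suc i) m" "de_rham \<omega> = 0" "(of_nat (Suc i + m) :: 'k) \<noteq> 0"
  shows "sigma (kappa \<omega>) = \<omega>"
  using de_rham_kappa[OF assms(1,2)] scale_of_nat_inverse(1)[of "i + Suc m" \<omega>] assms(3)
  by (simp add: sigma_eq[OF kappa_LS_comp[OF assms(1)]])

lemma part_less_sum: "trunc c \<omega> = (\<Sum>m<c. part (\<lambda>k. k = m) \<omega>)"
proof (induction c)
  case 0
  show ?case by (rule ext) (simp add: trunc_def poly_part_none)
next
  case (Suc c)
  have "trunc (Suc c) \<omega> = trunc c \<omega> + part (\<lambda>k. k = c) \<omega>"
    by (rule ext, rule poly_mapping_eqI) (auto simp: trunc_def part_def lookup_poly_part lookup_add)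
  then show ?case using Suc by (simp del: fun_apply_simps)
qed

section \<open>The complexes \<open>L\<^sub>c\<close> and closed forms\<close>

lemma kappa_ext_comp: "\<omega> \<in> ext_comp (Suc i) \<Longrightarrow> kappa \<omega> \<in> ext_comp i"
  and kappa_ext_comp_0: "\<omega> \<in> ext_comp 0 \<Longrightarrow> kappa \<omega> = 0"
  and dkos_ext_comp_0: "\<omega> \<in> ext_comp 0 \<Longrightarrow> dkos \<omega> = 0"
  by (simp_all add: kappa_def dkos_def koszul_diff_comp_Suc koszul_diff_comp_0)

lemma kappa_add: "kappa (\<omega> + \<eta>) = kappa \<omega> + kappa \<eta>"
  and kappa_sum: "kappa (\<Sum>a\<in>A. f a) = (\<Sum>a\<in>A. kappa (f a))"
  and dkos_sum: "dkos (\<Sum>a\<in>A. f a) = (\<Sum>a\<in>A. dkos (f a))"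
  by (simp_all add: kappa_def dkos_def koszul_diff_add koszul_diff_sum)

text \<open>The selector \<open>Suc k = m\<close>, rather than \<open>k = m - 1\<close>, makes the
  contribution of \<open>kappa\<close> empty for \<open>m = 0\<close>.\<close>

lemma part_shift_diff:
  assumes "m < c"
  shows "part (\<lambda>k. k = m) (dg_diff (X_dga c) \<omega>) = kappa (part (\<lambda>k. Suc k = m) \<omega>) + dkos (part (\<lambda>k. k = m) \<omega>)"
proof -
  have "(k = m \<and> k < c) = (k = m)" for k using assms by auto
  then show ?thesis by (simp add: trunc_eq_part part_part part_add part_kappa part_dkos)
qed

text \<open>The last equation stops below \<open>c\<close>: in y-degree c the differential has been
  truncated away, so the top component enters only through \<open>dkos\<close>.\<close>

lemma closed_part_parts:
  assumes "\<omega> \<in> closed_part c i"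
  shows "\<omega> \<in> ext_comp i" "trunc c \<omega> = \<omega>" "de_rham (part (\<lambda>k. k = m) \<omega>) = 0"
    "Suc m < c \<Longrightarrow> de_rham (kappa (part (\<lambda>k. k = m) \<omega>)) + de_rham (dkos (part (\<lambda>k. k = Suc m) \<omega>)) = 0"
proof -
  show c: "\<omega> \<in> ext_comp i" "trunc c \<omega> = \<omega>" using assms by (simp_all add: closed_part_def X_comp)
  show "de_rham (part (\<lambda>k. k = m) \<omega>) = 0"
    using assms part_de_rham[of "\<lambda>k. k = m" "\<lambda>k. Suc k = m" \<omega>] by (simp add: closed_part_def)
  have "de_rham (part (\<lambda>k. k = Suc m) (dg_diff (X_dga c) \<omega>)) = 0"
    using assms part_de_rham[of "\<lambda>k. k = Suc m" "\<lambda>k. k = m" "dg_diff (X_dga c) \<omega>"]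
    by (simp add: closed_part_def del: X_simps)
  then show "Suc m < c \<Longrightarrow> de_rham (kappa (part (\<lambda>k. k = m) \<omega>)) + de_rham (dkos (part (\<lambda>k. k = Suc m) \<omega>)) = 0"
    by (simp add: part_shift_diff de_rham_add del: X_simps)
qed

text \<open>Component m is closed, so \<delta>\<kappa> multiplies it by i + 1 + m. This is also the
  denominator of \<open>sigma\<close> on \<open>dkos\<close> of component m + 1, which has bidegree
  (i, m + 1).\<close>

lemma closed_part_recursion:
  fixes \<omega> :: "('k::field, 'n::{finite,linorder}) LS"
  assumes "\<omega> \<in> closed_part c (Suc i)" "Suc m < c" "(of_nat (Suc i + m) :: 'k) \<noteq> 0"
  shows "part (\<lambda>k. k = m) \<omega> = - sigma (dkos (part (\<lambda>k. k = Suc m) \<omega>))"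
proof -
  note z = closed_part_parts[OF assms(1)]
  have p: "part (\<lambda>k. k = m) \<omega> \<in> LS_comp (Suc i) m" "part (\<lambda>k. k = Suc m) \<omega> \<in> LS_comp (Suc i) (Suc m)"
    using z(1) by (simp_all add: part_LS_comp)
  have "ext_scale (of_nat (Suc i + m)) (part (\<lambda>k. k = m) \<omega>) = - de_rham (dkos (part (\<lambda>k. k = Suc m) \<omega>))"
    using z(4)[OF assms(2)] de_rham_kappa[OF p(1) z(3)] by (simp add: eq_neg_iff_add_eq_0)
  then have "ext_scale (const (const (1 / of_nat (Suc i + m)))) (ext_scale (of_nat (Suc i + m)) (part (\<lambda>k. k = m) \<omega>))
    = - sigma (dkos (part (\<lambda>k. k = Suc m) \<omega>))"
    unfolding sigma_eq[OF dkos_LS_comp[OF p(2)]] by (simp add: ext_scale_simps)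
  then show ?thesis unfolding scale_of_nat_inverse(1)[OF assms(3)] .
qed

lemma p_inf_eq: "p_inf c \<omega> = (eps (\<omega> {}), kappa (part (\<lambda>m. m = c - 1) \<omega>))"
  by (simp add: p_inf_def part_def)

lemma i_inf_eq: "i_inf c (r, \<alpha>) = ext_basis {} (const r) + (\<Sum>j<c. ((\<lambda>\<omega>. - sigma (dkos \<omega>)) ^^ j) (sigma \<alpha>))"
  by (simp add: i_inf_def)

lemma iterate_zero: "((\<lambda>\<omega>. - sigma (dkos \<omega>)) ^^ j) 0 = 0"
  by (induction j) (simp_all del: fun_apply_simps)

lemma i_inf_scalar: "i_inf c (r, 0) = ext_basis {} (const r)"
  by (simp add: i_inf_eq iterate_zero)

lemma closed_part_zero: "1 \<le> c \<Longrightarrow> 0 \<in> (closed_part c i :: ('k::field, 'n::{finite,linorder}) LS set)"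
  by (simp add: closed_part_def X_comp trunc_eq_part)

text \<open>All summands of \<open>i_inf\<close> are closed and bihomogeneous. When \<delta> is
  applied to the differential, the \<kappa>-part of each summand after the first cancels the d-part
  of its predecessor. What remains sits in y-degree c - 1, out of sight of the truncated
  differential.\<close>

lemma i_inf_side:
  fixes \<alpha> :: "('k::field, 'n::{finite,linorder}) LS"
  assumes ch: "CHAR('k) = 0 \<or> CHAR('k) \<ge> c + CARD('n)" and c: "1 \<le> c" and \<alpha>: "\<alpha> \<in> L_mod i c"
  shows "i_inf c (0, \<alpha>) \<in> closed_part c (Suc i)" "kappa (part (\<lambda>m. m = c - 1) (i_inf c (0, \<alpha>))) = \<alpha>"
proof -
  obtain \<beta> where \<beta>: "\<beta> \<in> LS_comp (Suc i) (c - 1)" "\<alpha> = kappa \<beta>"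
    using \<alpha> by (auto simp: L_mod_def)
  have "i_inf c (0, \<alpha>) \<in> closed_part c (Suc i) \<and> kappa (part (\<lambda>m. m = c - 1) (i_inf c (0, \<alpha>))) = \<alpha>"
  \<comment> \<open>Above exterior degree n everything is 0. Otherwise i < n, and the integers to be
    inverted, at most i + c, stay below c + n.\<close>
  proof (cases "CARD('n) < Suc i")
    case True
    then have "\<alpha> = 0" using LS_comp_gt_card[OF True \<beta>(1)] \<beta>(2) by simp
    then show ?thesis by (simp add: i_inf_scalar closed_part_zero[OF c])
  next
    case False
    then have inv: "(of_nat N :: 'k) \<noteq> 0" if "0 < N" "N \<le> i + c" for N
      using that by (intro of_nat_neq_0[OF ch]) auto
    define h where "h j = ((\<lambda>\<omega>. - sigma (dkos \<omega>)) ^^ j) (sigma \<alpha>)" for j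
    define \<omega> where "\<omega> = i_inf c (0, \<alpha>)"
    have \<omega>: "\<omega> = (\<Sum>j<c. h j)" by (simp add: \<omega>_def i_inf_eq h_def)
    have h_Suc: "h (Suc j) = - sigma (dkos (h j))" for j by (simp add: h_def)
    have \<alpha>c: "\<alpha> \<in> LS_comp i c" using kappa_LS_comp[OF \<beta>(1)] \<beta>(2) c by simp
    have h: "h j \<in> LS_comp (Suc i) (c - 1 - j) \<and> de_rham (h j) = 0" if "j < c" for j
      using that
    proof (induction j)
      case 0
      show ?case using \<alpha>c c sigma_LS_comp[of \<alpha> i "c - 1"] de_rham_sigma[OF \<alpha>c] by (simp add: h_def)
    next
      case (Suc j)
      then have dk: "dkos (h j) \<in> LS_comp i (Suc (c - 1 - Suc j))"
        using dkos_LS_comp[of "h j" i "c - 1 - j"] by (simp add: Suc_diff_Suc)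
      show ?case unfolding h_Suc
        using LS_comp_minus[OF sigma_LS_comp[OF dk]] de_rham_sigma[OF dk]
        by (simp del: fun_apply_simps add: de_rham_minus)
    qed
    have h0: "kappa (h 0) = \<alpha>"
      using kappa_sigma_kappa[OF \<beta>(1)] inv[of "i + c"] c \<beta>(2) by (simp add: h_def)
    have part_h: "part P (h j) = (if P (c - 1 - j) then h j else 0)" if "j < c" for P j
    proof -
      have "part P (h j) = part P (part (\<lambda>k. k = c - 1 - j) (h j))" using h[OF that] by (simp add: LS_comp_iff)
      also have "\<dots> = (if P (c - 1 - j) then part (\<lambda>k. k = c - 1 - j) (h j) else 0)"
        by (rule ext, rule poly_mapping_eqI) (auto simp: part_def lookup_poly_part)
      finally show ?thesis using h[OF that] by (simp add: LS_comp_iff)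
    qed
    \<comment> \<open>The scalar is the total degree (i + 1) + (c - 1 - j) of \<open>h j\<close>, so
      \<open>F j\<close> is \<delta>\<kappa> of the j-th summand; the sums of fact 1 and fact 2
      telescope in these terms.\<close>
    define F where "F j = ext_scale (of_nat (i + c - j)) (h j)" for j
    have 1: "de_rham (kappa (h j)) = F j" if "j < c" for j
    proof -
      have "Suc i + (c - 1 - j) = i + c - j" using that by simp
      then show ?thesis using de_rham_kappa[of "h j" "Suc i" "c - 1 - j"] h[OF that] unfolding F_def by metis
    qed
    have 2: "de_rham (dkos (h j)) = (if Suc j < c then - F (Suc j) else 0)" if "j < c" for j
    proof (cases "Suc j < c")
      case True
      have "dkos (h j) \<in> LS_comp i (c - 1 - j)" using h[OF that] by (simp add: dkos_LS_comp)
      from de_rham_eq_sigma[OF this] inv[of "i + (c - 1 - j)"] True c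
      have "de_rham (dkos (h j)) = ext_scale (of_nat (i + (c - 1 - j))) (sigma (dkos (h j)))" by simp
      then show ?thesis using True by (simp add: F_def h_Suc ext_scale_simps)
    next
      case False
      \<comment> \<open>The last summand has y-degree 0, and \<delta> kills forms with coefficients
        in R, so the telescope has no loose end on this side.\<close>
      then have "c - 1 - j = 0" using that by simp
      then have "dkos (h j) \<in> LS_comp i 0" using h[OF that] dkos_LS_comp[of "h j" i 0] by simp
      then show ?thesis using False by (simp add: de_rham_LS_comp_0)
    qed
    obtain c' where c': "c = Suc c'" using c by (cases c) auto
    have "de_rham (kappa \<omega> + dkos \<omega>) = (\<Sum>j<c. F j) + (\<Sum>j<c. if Suc j < c then - F (Suc j) else 0)"
      unfolding \<omega> by (simp add: kappa_sum dkos_sum de_rham_add de_rham_sum 1 2)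
    also have "(\<Sum>j<c. F j) = F 0 + (\<Sum>j<c'. F (Suc j))" unfolding c' by (rule sum.lessThan_Suc_shift)
    also have "(\<Sum>j<c. if Suc j < c then - F (Suc j) else 0) = - (\<Sum>j<c'. F (Suc j))"
      unfolding c' by (simp add: sum_negf)
    finally have "de_rham (kappa \<omega> + dkos \<omega>) = ext_scale (const (of_nat (i + c))) (h 0)" by (simp del: fun_apply_simps add: F_def)
    \<comment> \<open>The surviving multiple of \<open>h 0\<close> has y-degree c - 1, just outside
      the bound \<open>Suc m < c\<close>.\<close>
    then have "de_rham (dg_diff (X_dga c) \<omega>)
      = ext_scale (const (of_nat (i + c))) (part (\<lambda>m. Suc m < c) (h 0))"
      by (simp only: X_simps de_rham_trunc part_scale_const)
    then have "de_rham (dg_diff (X_dga c) \<omega>) = 0"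
      using part_h[of 0 "\<lambda>m. Suc m < c"] c by (simp add: ext_scale_simps(9) del: X_simps)
    moreover have "de_rham \<omega> = 0" unfolding \<omega> by (simp add: de_rham_sum h)
    moreover have "\<omega> \<in> ext_comp (Suc i)" unfolding \<omega> using h by (intro ext_comp_sum) (auto simp: LS_comp_iff)
    moreover have "trunc c \<omega> = \<omega>" unfolding \<omega> trunc_eq_part part_sum by (rule sum.cong) (auto simp: part_h)
    moreover have "part (\<lambda>m. m = c - 1) \<omega> = (\<Sum>j<c. if j = 0 then h 0 else 0)"
      unfolding \<omega> part_sum by (rule sum.cong) (auto simp: part_h)
    ultimately show ?thesis using h0 c unfolding \<omega>_def by (simp add: closed_part_def X_comp)
  qed
  then show "i_inf c (0, \<alpha>) \<in> closed_part c (Suc i)" "kappa (part (\<lambda>m. m = c - 1) (i_inf c (0, \<alpha>))) = \<alpha>"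
    by simp_all
qed

text \<open>\<open>sigma_kappa\<close> recovers the top component from its image under
  \<open>kappa\<close>, and each further iterate is the next step of
  \<open>closed_part_recursion\<close>. So the j-th summand is the component of y-degree c - 1 -
  j.\<close>

lemma i_inf_kappa:
  fixes \<omega> :: "('k::field, 'n::{finite,linorder}) LS"
  assumes ch: "CHAR('k) = 0 \<or> CHAR('k) \<ge> c + CARD('n)" and c: "1 \<le> c" and \<omega>: "\<omega> \<in> closed_part c (Suc i)"
  shows "i_inf c (0, kappa (part (\<lambda>m. m = c - 1) \<omega>)) = \<omega>"
proof (cases "CARD('n) < Suc i")
  case True
  then have "\<omega> = 0" using ext_comp_gt_card[OF True closed_part_parts(1)[OF \<omega>]] by simp
  then show ?thesis by (simp add: i_inf_scalar)
next
  case False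
  then have inv: "(of_nat N :: 'k) \<noteq> 0" if "0 < N" "N \<le> i + c" for N
    using that by (intro of_nat_neq_0[OF ch]) auto
  note z = closed_part_parts[OF \<omega>]
  have "((\<lambda>\<omega>. - sigma (dkos \<omega>)) ^^ j) (sigma (kappa (part (\<lambda>m. m = c - 1) \<omega>))) = part (\<lambda>m. m = c - Suc j) \<omega>"
    if "j < c" for j
    using that
  proof (induction j)
    case 0
    show ?case
      using sigma_kappa[OF part_LS_comp[OF z(1)] z(3)] inv[of "i + c"] c by simp
  next
    case (Suc j)
    then show ?case
      using closed_part_recursion[OF \<omega>, of "c - Suc (Suc j)"] inv[of "Suc i + (c - Suc (Suc j))"]
      by (simp add: Suc_diff_Suc)
  qed
  then have "i_inf c (0, kappa (part (\<lambda>m. m = c - 1) \<omega>)) = (\<Sum>j<c. part (\<lambda>m. m = c - Suc j) \<omega>)"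
    by (simp add: i_inf_eq)
  also have "\<dots> = trunc c \<omega>"
    unfolding part_less_sum by (rule sum.nat_diff_reindex)
  finally show ?thesis using z(2) by simp
qed

text \<open>On \<Lambda>^0 the map \<open>kappa\<close> vanishes, so for a closed component of
  y-degree m the homotopy formula reads 0 = m times the component. Only y-degree 0 survives.\<close>

lemma closed_part_0:
  fixes \<omega> :: "('k::field, 'n::{finite,linorder}) LS"
  assumes ch: "CHAR('k) = 0 \<or> CHAR('k) \<ge> c + CARD('n)" and c: "1 \<le> c" and \<omega>: "\<omega> \<in> closed_part c 0"
  shows "\<exists>r. \<omega> = ext_basis {} (const r)" "0 < m \<Longrightarrow> part (\<lambda>k. k = m) \<omega> = 0"
proof -
  note z = closed_part_parts[OF \<omega>]
  have 0: "part (\<lambda>k. k = m) \<omega> = 0" if "0 < m" "m < c" for m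
  proof -
    have p: "part (\<lambda>k. k = m) \<omega> \<in> LS_comp 0 m" using z(1) by (rule part_LS_comp)
    then have "kappa (part (\<lambda>k. k = m) \<omega>) = 0" by (intro kappa_ext_comp_0) (simp add: LS_comp_iff)
    then have *: "ext_scale (of_nat m) (part (\<lambda>k. k = m) \<omega>) = 0"
      using de_rham_kappa[OF p z(3)] by simp
    have "(of_nat m :: 'k) \<noteq> 0" using that by (intro of_nat_neq_0[OF ch]) auto
    from scale_of_nat_inverse(1)[OF this, of "part (\<lambda>k. k = m) \<omega>"] show ?thesis
      unfolding * by (simp add: ext_scale_simps)
  qed
  show "part (\<lambda>k. k = m) \<omega> = 0" if "0 < m"
  proof (cases "m < c")
    case False
    have "part (\<lambda>k. k = m) (trunc c \<omega>) = 0"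
      by (rule ext, rule poly_mapping_eqI) (use False in \<open>auto simp: part_def trunc_def lookup_poly_part\<close>)
    then show ?thesis using z(2) by simp
  qed (use 0 that in simp)
  obtain c' where c': "c = Suc c'" using c by (cases c) auto
  have "\<omega> = (\<Sum>m<c. part (\<lambda>k. k = m) \<omega>)" using z(2) part_less_sum by metis
  also have "\<dots> = part (\<lambda>k. k = 0) \<omega>" using 0 unfolding c' sum.lessThan_Suc_shift by simp
  finally have \<omega>0: "\<omega> = part (\<lambda>k. k = 0) \<omega>" .
  have "\<omega> T = ext_basis {} (const (Poly_Mapping.lookup (\<omega> {}) 0)) T" for T
  proof (cases "T = {}")
    case True
    have "\<omega> {} = poly_part (\<lambda>k. k = 0) (\<omega> {})"
      using fun_cong[OF \<omega>0, of "{}"] unfolding part_def .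
    also have "\<dots> = const (Poly_Mapping.lookup (\<omega> {}) 0)"
      by (rule poly_mapping_eqI) (auto simp: lookup_poly_part const_def lookup_single when_def deg_eq_0_iff)
    finally show ?thesis unfolding True ext_basis_def by (subst if_P[OF refl])
  next
    case False
    then have "\<omega> T = 0" using z(1) by (auto simp: ext_comp_def)
    then show ?thesis using False by (simp add: ext_basis_def)
  qed
  then show "\<exists>r. \<omega> = ext_basis {} (const r)" by blast
qed

section \<open>Evaluation and powers of the maximal ideal\<close>

lemma eps_superset:
  assumes "finite A" "Poly_Mapping.keys q \<subseteq> A"
  shows "eps q = (\<Sum>\<mu>\<in>A. Poly_Mapping.lookup q \<mu> * (\<Prod>v\<in>UNIV. var v ^ Poly_Mapping.lookup \<mu> v))"
  unfolding eps_def by (rule sum.mono_neutral_left) (use assms in \<open>auto simp: in_keys_iff\<close>)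

lemma eps_add: "eps (p + q) = eps p + eps q"
proof -
  let ?A = "Poly_Mapping.keys p \<union> Poly_Mapping.keys q"
  have "eps r = (\<Sum>\<mu>\<in>?A. Poly_Mapping.lookup r \<mu> * (\<Prod>v\<in>UNIV. var v ^ Poly_Mapping.lookup \<mu> v))"
    if "r \<in> {p, q, p + q}" for r
    using that keys_add[of p q] by (intro eps_superset) auto
  then show ?thesis by (simp add: lookup_add distrib_right sum.distrib)
qed

lemma eps_single: "eps (Poly_Mapping.single \<mu> a) = a * (\<Prod>v\<in>UNIV. var v ^ Poly_Mapping.lookup \<mu> v)"
  by (subst eps_superset[of "{\<mu>}"]) auto

lemma eps_zero [simp]: "eps 0 = 0"
  by (simp add: eps_def)

lemma eps_sum: "eps (\<Sum>a\<in>A. f a) = (\<Sum>a\<in>A. eps (f a))"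
  by (induction A rule: infinite_finite_induct) (auto simp: eps_add)

lemma eps_const_mult: "eps (const r * q) = r * eps q"
  by (induction q rule: poly_induct) (simp_all add: const_mult_single eps_single distrib_left eps_add mult.assoc)

lemma eps_const [simp]: "eps (const r) = r"
  by (simp add: const_def eps_single)

lemma eps_minus: "eps (- q) = - eps q"
  using eps_const_mult[of "-1" q] by simp

lemma eps_var_mult:
  fixes q :: "('k::field, 'n::finite) S"
  shows "eps (var v * q) = var v * eps q"
proof (induction q rule: poly_induct)
  case (single \<mu> a)
  have "(\<Prod>w\<in>UNIV. var w ^ Poly_Mapping.lookup (Poly_Mapping.single v 1 + \<mu>) w)
    = (\<Prod>w\<in>UNIV. if w = v then var v else 1) * (\<Prod>w\<in>UNIV. var w ^ Poly_Mapping.lookup \<mu> w :: ('k, 'n) R)"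
    unfolding prod.distrib[symmetric] by (rule prod.cong) (auto simp: lookup_add lookup_single when_def)
  then have "(\<Prod>w\<in>UNIV. var w ^ Poly_Mapping.lookup (Poly_Mapping.single v 1 + \<mu>) w)
    = var v * (\<Prod>w\<in>UNIV. var w ^ Poly_Mapping.lookup \<mu> w :: ('k, 'n) R)" by simp
  moreover have "var v * Poly_Mapping.single \<mu> a = Poly_Mapping.single (Poly_Mapping.single v 1 + \<mu>) a"
    by (simp add: var_def mult_single)
  ultimately show ?case by (simp only: eps_single mult.left_commute)
qed (simp add: distrib_left eps_add)

text \<open>The two Koszul differentials differ only in the coefficients y_t and x_t, which
  \<open>eps\<close> identifies. This links the equations between neighbouring components in
  \<open>p_inf_diff\<close>.\<close>

lemma eps_kappa: "eps (kappa \<omega> {}) = eps (dkos \<omega> {})"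
  by (simp add: kappa_def dkos_def koszul_diff_apply eps_sum eps_var_mult eps_const_mult)

lemma poly_part_eq_iff: "poly_part P q = q \<longleftrightarrow> (\<forall>\<mu>\<in>Poly_Mapping.keys q. P (deg \<mu>))"
  using keys_poly_part[of P q] poly_part_id[of q P] by fastforce

lemma module_mult: "module ((*) :: 'r::comm_ring_1 \<Rightarrow> 'r \<Rightarrow> 'r)"
  by (rule module.intro) (simp_all add: algebra_simps)

text \<open>The evaluations of forms of degree c. This description of the c-th power of the maximal
  ideal matches the image of the last map of L_c; the recursive one does not.\<close>

definition eps_power :: "nat \<Rightarrow> ('k::field, 'n::finite) R set"
  where "eps_power c = eps ` {q. poly_part (\<lambda>m. m = c) q = q}"

lemma eps_power_subspace: "module.subspace (*) (eps_power c :: ('k::field, 'n::finite) R set)"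
proof (rule module.subspaceI[OF module_mult])
  show "0 \<in> (eps_power c :: ('k, 'n) R set)"
    unfolding eps_power_def by (rule image_eqI[of _ _ 0]) simp_all
  show "x + y \<in> eps_power c" if "x \<in> eps_power c" "y \<in> eps_power c" for x y :: "('k, 'n) R"
    using that unfolding eps_power_def by (auto simp: eps_add[symmetric] poly_part_add intro!: imageI)
  show "r * x \<in> eps_power c" if "x \<in> eps_power c" for r x :: "('k, 'n) R"
    using that unfolding eps_power_def by (auto simp: eps_const_mult[symmetric] poly_part_const_mult intro!: imageI)
qed

lemma ideal_power_eq: "ideal_power max_ideal c = (eps_power c :: ('k::field, 'n::finite) R set)"
proof (induction c)
  case 0
  have "r \<in> eps_power 0" for r :: "('k, 'n) R"
    unfolding eps_power_def
    by (rule image_eqI[of _ _ "const r"]) (simp, simp add: const_def poly_part_single)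
  then show ?case by auto
next
  case (Suc c)
  let ?G = "{u * v | u v. u \<in> max_ideal \<and> v \<in> (eps_power c :: ('k, 'n) R set)}"
  have "module.span (*) ?G = eps_power (Suc c)"
  proof
    show "module.span (*) ?G \<subseteq> eps_power (Suc c)"
    proof (rule module.span_minimal[OF module_mult _ eps_power_subspace], clarify)
      fix u v :: "('k, 'n) R" assume u: "u \<in> max_ideal" and v: "v \<in> eps_power c"
      obtain q where q: "v = eps q" "poly_part (\<lambda>m. m = c) q = q" using v by (auto simp: eps_power_def)
      \<comment> \<open>For fixed v the multipliers sending it into \<open>eps_power (Suc c)\<close>
        form an ideal, so it is enough to test the variables.\<close>
      have "max_ideal \<subseteq> {u. u * v \<in> eps_power (Suc c)}"
        unfolding max_ideal_def ideal_gen_def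
      proof (rule module.span_minimal[OF module_mult])
        show "module.subspace (*) {u. u * v \<in> eps_power (Suc c)}"
          using subspaceD(1-3)[OF module_mult eps_power_subspace[of "Suc c"]]
          by (intro module.subspaceI[OF module_mult]) (auto simp: distrib_right mult.assoc)
        show "range var \<subseteq> {u. u * v \<in> eps_power (Suc c)}"
          using q by (auto simp: eps_power_def eps_var_mult[symmetric] poly_part_var_mult intro!: imageI)
      qed
      then show "u * v \<in> eps_power (Suc c)" using u by blast
    qed
    show "eps_power (Suc c) \<subseteq> module.span (*) ?G"
    proof
      fix x :: "('k, 'n) R" assume "x \<in> eps_power (Suc c)"
      then obtain q where q: "x = eps q" "poly_part (\<lambda>m. m = Suc c) q = q" by (auto simp: eps_power_def)
      \<comment> \<open>A monomial of degree c + 1 contains some variable; splitting it off leaves a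
        monomial of degree c that carries the coefficient.\<close>
      have "eps (Poly_Mapping.single \<mu> a) \<in> ?G" if \<mu>: "\<mu> \<in> Poly_Mapping.keys q" for \<mu> a
      proof -
        have d: "deg \<mu> = Suc c" using q(2) \<mu> by (simp add: poly_part_eq_iff)
        then obtain v where v: "Poly_Mapping.lookup \<mu> v \<noteq> 0"
          unfolding deg_def by (metis nat.distinct(1) sum.neutral)
        let ?\<nu> = "\<mu> - Poly_Mapping.single v 1"
        have "Poly_Mapping.single \<mu> a = var v * Poly_Mapping.single ?\<nu> a"
          using monomial_minus_add[OF v] by (simp add: var_def mult_single add.commute)
        moreover have "eps (Poly_Mapping.single ?\<nu> a) \<in> eps_power c"
          unfolding eps_power_def using d deg_minus_single[OF v] by (intro imageI) (simp add: poly_part_single)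
        moreover have "var v \<in> (max_ideal :: ('k, 'n) R set)"
          unfolding max_ideal_def ideal_gen_def by (rule module.span_base[OF module_mult]) simp
        ultimately show ?thesis by (auto simp: eps_var_mult)
      qed
      then have "(\<Sum>\<mu>\<in>Poly_Mapping.keys q. eps (Poly_Mapping.single \<mu> (Poly_Mapping.lookup q \<mu>))) \<in> module.span (*) ?G"
        by (intro module.span_sum[OF module_mult] module.span_base[OF module_mult]) blast
      then show "x \<in> module.span (*) ?G"
        unfolding q(1) eps_sum[symmetric] poly_sum_single[symmetric] .
    qed
  qed
  then show ?case by (simp add: ideal_gen_def Suc)
qed

lemma ideal_power_antimono:
  assumes "a \<le> b" shows "ideal_power max_ideal b \<subseteq> (ideal_power max_ideal a :: ('k::field, 'n::finite) R set)"
  using assms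
proof (induction rule: dec_induct)
  case (step c)
  have "ideal_power max_ideal (Suc c) \<subseteq> (ideal_power max_ideal c :: ('k, 'n) R set)"
    using subspaceD(3)[OF module_mult eps_power_subspace[of c]]
    by (auto simp: ideal_gen_def ideal_power_eq intro!: module.span_minimal[OF module_mult _ eps_power_subspace])
  then show ?case using step by blast
qed simp

lemma residue_eq_iff:
  assumes "module.subspace (*) I"
  shows "residue I r = residue I s \<longleftrightarrow> r - s \<in> I"
proof
  note sub = subspaceD[OF module_mult assms]
  assume "residue I r = residue I s"
  moreover have "r \<in> residue I r" using sub(1) unfolding residue_def by force
  ultimately show "r - s \<in> I" by (auto simp: residue_def)
next
  note sub = subspaceD[OF module_mult assms]
  assume rs: "r - s \<in> I"
  have "r + u = s + ((r - s) + u)" "s + u = r + (u - (r - s))" for u by (simp_all add: algebra_simps)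
  then show "residue I r = residue I s" unfolding residue_def using sub(2)[OF rs] sub(5)[OF _ rs] by blast
qed

section \<open>The dg algebras \<open>L\<^sub>c\<close>\<close>

lemma L_simps [simp]:
  "dg_comp (L_dga c) 0 = UNIV \<times> {0}"
  "dg_comp (L_dga c) (Suc i) = {0} \<times> L_mod i c"
  "dg_scale (L_dga c) r (s, \<alpha>) = (r * s, ext_scale (const r) \<alpha>)"
  "dg_diff (L_dga c) (s, \<alpha>) = ((-1) ^ (c + 1) * eps (\<alpha> {}), - dkos \<alpha>)"
  "dg_mult (L_dga c) x y = p_inf c (dg_mult (X_dga c) (i_inf c x) (i_inf c y))"
  "dg_one (L_dga c) = (1, 0)"
  by (simp_all add: L_dga_def ext_scale_def)

lemma p_inf_scalar: "p_inf c (ext_basis {} (const (r :: ('k::field, 'n::{finite,linorder}) R))) = (r, 0)"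
proof -
  have "ext_basis {} (const r) \<in> (ext_comp 0 :: ('k, 'n) LS set)" by (auto simp: ext_comp_def ext_basis_def)
  then have "kappa (part (\<lambda>m. m = c - 1) (ext_basis {} (const r))) = 0"
    by (intro kappa_ext_comp_0 part_comp)
  then show ?thesis by (simp add: p_inf_eq ext_basis_def[of "{}" "const r"])
qed

text \<open>The sign of \<open>dkos\<close> comes from its anticommuting with \<open>kappa\<close>.
  The sign of \<open>eps\<close> arises in degree 1: the differential of \<omega> is then a
  constant, and the vanishing of its components in y-degrees 1 to c - 1 is a chain of c - 1
  equations joining the lowest component of \<omega> to the top one, each costing a sign.\<close>

lemma p_inf_diff:
  fixes \<omega> :: "('k::field, 'n::{finite,linorder}) LS"
  assumes ch: "CHAR('k) = 0 \<or> CHAR('k) \<ge> c + CARD('n)" and c: "1 \<le> c" and \<omega>: "\<omega> \<in> closed_part c i"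
  shows "p_inf c (dg_diff (X_dga c) \<omega>) = dg_diff (L_dga c) (p_inf c \<omega>)"
proof -
  let ?\<gamma> = "part (\<lambda>m. m = c - 1) \<omega>"
  interpret X: dg_algebra "X_dga c :: (('k, 'n) R, ('k, 'n) LS) dga" using c by (rule dg_algebra_X)
  note z = closed_part_parts[OF \<omega>]
  \<comment> \<open>In y-degree c - 1 the other contribution is itself in the image of
    \<open>kappa\<close>, so a second \<open>kappa\<close> kills it.\<close>
  have "kappa (part (\<lambda>m. m = c - 1) (dg_diff (X_dga c) \<omega>)) = - dkos (kappa ?\<gamma>)"
    using c by (simp add: part_shift_diff kappa_add kappa_kappa kappa_dkos del: X_simps)
  moreover have "eps (dg_diff (X_dga c) \<omega> {}) = (-1) ^ (c + 1) * eps (kappa ?\<gamma> {})"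
  proof (cases i)
    case 0
    then have "dg_diff (X_dga c) \<omega> = 0" using \<omega> X.diff_comp_0[of \<omega>] by (simp add: closed_part_def del: X_simps)
    moreover have "kappa ?\<gamma> = 0" using z(1) 0 by (intro kappa_ext_comp_0 part_comp) simp
    ultimately show ?thesis by (simp del: X_simps)
  next
    case (Suc j)
    note d = closed_part_diff[OF c \<omega>[unfolded Suc]]
    show ?thesis
    proof (cases j)
      case 0
      \<comment> \<open>One link of the chain: component m + 1 of the differential is 0, and under
        \<open>eps\<close> its two terms become evaluations of \<open>dkos\<close> on neighbouring
        components.\<close>
      have step: "eps (dkos (part (\<lambda>k. k = 0) \<omega>) {}) = (-1) ^ m * eps (dkos (part (\<lambda>k. k = m) \<omega>) {})" if "m < c" for m
        using that
      proof (induction m)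
        case (Suc m)
        have "kappa (part (\<lambda>k. k = m) \<omega>) + dkos (part (\<lambda>k. k = Suc m) \<omega>) = 0"
          using closed_part_0(2)[OF ch c d[unfolded 0], of "Suc m"] Suc.prems by (simp add: part_shift_diff del: X_simps)
        then have "dkos (part (\<lambda>k. k = Suc m) \<omega>) = - kappa (part (\<lambda>k. k = m) \<omega>)"
          by (simp add: eq_neg_iff_add_eq_0 add.commute)
        then show ?case using Suc by (simp add: eps_minus eps_kappa)
      qed simp
      obtain r where r: "dg_diff (X_dga c) \<omega> = ext_basis {} (const r)"
        using closed_part_0(1)[OF ch c d[unfolded 0]] by blast
      have "ext_basis {} (const r) = part (\<lambda>k. k = 0) (ext_basis {} (const r) :: ('k, 'n) LS)"
        by (simp add: part_basis const_def poly_part_single)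
      also have "\<dots> = dkos (part (\<lambda>k. k = 0) \<omega>)"
      proof -
        have n: "part (\<lambda>k. False) \<omega> = 0" by (rule ext) (simp add: part_def poly_part_none)
        show ?thesis unfolding r[symmetric] using c part_shift_diff[of 0 c \<omega>] by (simp add: n del: X_simps)
      qed
      finally have "eps (dg_diff (X_dga c) \<omega> {}) = (-1) ^ (c - 1) * eps (kappa ?\<gamma> {})"
        using step[of "c - 1"] c unfolding r by (simp add: eps_kappa)
      moreover have "(-1) ^ (c + 1) = ((-1) ^ (c - 1) :: ('k, 'n) R)" using c by (cases c) auto
      ultimately show ?thesis by (simp del: X_simps)
    next
      case (Suc l)
      \<comment> \<open>In degree 2 and above neither side has a component in \<Lambda>^0.\<close>
      have "\<eta> {} = 0" if "\<eta> \<in> ext_comp (Suc l)" for \<eta> :: "('k, 'n) LS" using that by (auto simp: ext_comp_def)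
      moreover have "dg_diff (X_dga c) \<omega> \<in> ext_comp (Suc l)" using closed_part_parts(1)[OF d] Suc by simp
      moreover have "kappa ?\<gamma> \<in> ext_comp (Suc l)" using z(1) \<open>i = Suc j\<close> Suc by (simp add: kappa_ext_comp part_comp)
      ultimately have "dg_diff (X_dga c) \<omega> {} = 0" "kappa ?\<gamma> {} = 0" by blast+
      then show ?thesis by (simp del: X_simps)
    qed
  qed
  ultimately show ?thesis unfolding p_inf_eq by (simp del: X_simps)
qed

lemma dg_transport_L:
  assumes ch: "CHAR('k::field) = 0 \<or> CHAR('k) \<ge> c + CARD('n::{finite,linorder})" and c: "1 \<le> c"
  shows "dg_transport (X_dga c) (L_dga c :: (('k, 'n) R, ('k, 'n) R \<times> ('k, 'n) LS) dga)
    (closed_part c) (p_inf c) (i_inf c)"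
proof (rule dg_transport.intro[OF dg_algebra_X[OF c] dg_transport_axioms.intro])
  show "module (dg_scale (L_dga c :: (('k, 'n) R, ('k, 'n) R \<times> ('k, 'n) LS) dga))"
    by (rule module.intro) (auto simp: ext_scale_simps algebra_simps)
  show "w \<in> dg_comp (X_dga c) i" if "w \<in> closed_part c i" for w :: "('k, 'n) LS" and i
    using that by (simp add: closed_part_def)
  show "p_inf c w \<in> dg_comp (L_dga c) i" if w: "w \<in> closed_part c i" for w :: "('k, 'n) LS" and i
  proof (cases i)
    case 0
    then show ?thesis using closed_part_0(1)[OF ch c, of w] w by (auto simp: p_inf_scalar)
  next
    case (Suc j)
    then have "w \<in> ext_comp (Suc j)" using closed_part_parts(1)[OF w] by simp
    then have "w {} = 0" "part (\<lambda>m. m = c - 1) w \<in> LS_comp (j + 1) (c - 1)"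
      by (auto simp: part_LS_comp ext_comp_def)
    then show ?thesis using Suc by (auto simp: p_inf_eq L_mod_def)
  qed
  show "i_inf c x \<in> closed_part c i" and "p_inf c (i_inf c x) = x" if x: "x \<in> dg_comp (L_dga c) i"
    for x :: "('k, 'n) R \<times> ('k, 'n) LS" and i
  proof -
    have "i_inf c x \<in> closed_part c i \<and> p_inf c (i_inf c x) = x"
    proof (cases i)
      case 0
      then obtain r where r: "x = (r, 0)" using x by auto
      have "ext_basis {} (const r) \<in> (closed_part c 0 :: ('k, 'n) LS set)"
        using subspaceD(3)[OF dg_algebra.module_scale[OF dg_algebra_X[OF c]] closed_part_subspace[OF c]
            closed_part_one[OF c], of r] by (simp add: ext_scale_simps)
      then show ?thesis by (simp add: 0 r i_inf_scalar p_inf_scalar)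
    next
      case (Suc j)
      then obtain \<alpha> where \<alpha>: "x = (0, \<alpha>)" "\<alpha> \<in> L_mod j c" using x by auto
      note s = i_inf_side[OF ch c \<alpha>(2)]
      have "i_inf c (0, \<alpha>) {} = 0" using closed_part_parts(1)[OF s(1)] by (auto simp: ext_comp_def)
      then show ?thesis using s Suc \<alpha>(1) by (simp add: p_inf_eq)
    qed
    then show "i_inf c x \<in> closed_part c i" "p_inf c (i_inf c x) = x" by auto
  qed
  show "i_inf c (p_inf c w) = w" if w: "w \<in> closed_part c i" for w :: "('k, 'n) LS" and i
  proof (cases i)
    case 0
    then show ?thesis using closed_part_0(1)[OF ch c, of w] w by (auto simp: p_inf_scalar i_inf_scalar)
  next
    case (Suc j)
    have "w {} = 0" using closed_part_parts(1)[OF w] Suc by (auto simp: ext_comp_def)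
    then show ?thesis using i_inf_kappa[OF ch c, of w j] w Suc by (simp add: p_inf_eq)
  qed
  show "p_inf c (w + v) = p_inf c w + p_inf c v" for w v :: "('k, 'n) LS"
    by (simp add: p_inf_eq eps_add part_add kappa_add)
  show "p_inf c (dg_scale (X_dga c) r w) = dg_scale (L_dga c) r (p_inf c w)" for r and w :: "('k, 'n) LS"
    by (simp add: p_inf_eq part_scale_const kappa_scale) (simp add: ext_scale_def eps_const_mult)
  show "p_inf c (dg_one (X_dga c)) = (dg_one (L_dga c) :: ('k, 'n) R \<times> ('k, 'n) LS)"
    using p_inf_scalar[of c "1 :: ('k, 'n) R"] by simp
qed (simp_all only: closed_part_subspace[OF c] closed_part_diff[OF c] closed_part_mult[OF c] closed_part_one[OF c]
  p_inf_diff[OF ch c] L_simps(5))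

section \<open>The quotient maps on closed forms, and the maps between the L_c\<close>

lemma trunc_trunc: "a \<le> b \<Longrightarrow> trunc a (trunc b \<omega>) = trunc a \<omega>"
  by (rule ext, rule poly_mapping_eqI) (auto simp: trunc_def lookup_poly_part)

lemma trunc_diff: "trunc c (kappa (trunc c \<omega>) + dkos (trunc c \<omega>)) = trunc c (kappa \<omega> + dkos \<omega>)"
proof -
  have "(Suc m < c \<and> m < c) = (Suc m < c)" for m by auto
  then show ?thesis by (simp add: trunc_eq_part part_add part_kappa part_dkos part_part)
qed

lemma dg_algebra_hom_pi:
  assumes "1 \<le> a" "a \<le> b"
  shows "dg_algebra_hom (X_dga b) (X_dga a :: (('k::field, 'n::{finite,linorder}) R, ('k, 'n) LS) dga) (pi_map b a)"
proof -
  have "trunc a (ext_basis {} 1) = (ext_basis {} 1 :: ('k, 'n) LS)"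
    using assms(1) poly_part_id[of "1 :: ('k, 'n) S" "\<lambda>m. m < a"] by (simp add: trunc_eq_part part_basis)
  moreover have "trunc a (ext_mult (trunc a \<omega>) (trunc a \<eta>)) = trunc a (ext_mult \<omega> \<eta>)" for \<omega> \<eta> :: "('k, 'n) LS"
    by (simp add: trunc_mult_left trunc_mult_right)
  moreover have "trunc a \<omega> \<in> ext_comp i" if "\<omega> \<in> ext_comp i" for \<omega> :: "('k, 'n) LS" and i
    using that by (simp add: trunc_eq_part part_comp)
  ultimately show ?thesis using assms
    by (intro dg_algebra_hom.intro dg_algebra_hom_axioms.intro dg_algebra_X)
      (auto simp: pi_map_def X_comp trunc_trunc trunc_diff, simp_all add: trunc_eq_part part_add part_scale_const)
qed

text \<open>The quotient map is a chain map and preserves closedness, so it respects the condition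
  on \<omega> and the one on its differential alike.\<close>

lemma pi_closed_part:
  fixes \<omega> :: "('k::field, 'n::{finite,linorder}) LS"
  assumes "1 \<le> a" "a \<le> b" "\<omega> \<in> closed_part b i"
  shows "pi_map b a \<omega> \<in> closed_part a i"
proof -
  interpret pi: dg_algebra_hom "X_dga b" "X_dga a :: (('k, 'n) R, ('k, 'n) LS) dga" "pi_map b a"
    using assms(1,2) by (rule dg_algebra_hom_pi)
  have *: "de_rham (pi_map b a \<eta>) = 0" if "de_rham \<eta> = 0" for \<eta> :: "('k, 'n) LS"
    using that by (simp add: pi_map_def de_rham_trunc)
  have c: "\<omega> \<in> dg_comp (X_dga b) i" "de_rham \<omega> = 0" "de_rham (dg_diff (X_dga b) \<omega>) = 0"
    using assms(3) by (simp_all add: closed_part_def)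
  show ?thesis
    using pi.hom_comp[OF c(1)] *[OF c(2)] *[OF c(3)] unfolding pi.hom_diff[OF c(1)] closed_part_def by blast
qed

lemma dg_algebra_hom_f_map:
  assumes ch: "CHAR('k::field) = 0 \<or> CHAR('k) \<ge> b + CARD('n::{finite,linorder})" and ab: "1 \<le> a" "a \<le> b"
  shows "dg_algebra_hom (L_dga b :: (('k, 'n) R, ('k, 'n) R \<times> ('k, 'n) LS) dga) (L_dga a) (f_map b a)"
  unfolding f_map_def
proof (rule dg_transport_hom)
  show "dg_transport (X_dga b) (L_dga b :: (('k, 'n) R, ('k, 'n) R \<times> ('k, 'n) LS) dga) (closed_part b) (p_inf b) (i_inf b)"
    "dg_transport (X_dga a) (L_dga a :: (('k, 'n) R, ('k, 'n) R \<times> ('k, 'n) LS) dga) (closed_part a) (p_inf a) (i_inf a)"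
    using ch ab by (auto intro!: dg_transport_L)
qed (use ab in \<open>auto intro: dg_algebra_hom_pi pi_closed_part\<close>)

text \<open>After the first quotient map the form lies in the closed part for b, where
  \<open>i_inf b\<close> undoes \<open>p_inf b\<close>. What remains is a composite of two
  truncations.\<close>

lemma f_map_compose:
  fixes x :: "('k::field, 'n::{finite,linorder}) R \<times> ('k, 'n) LS"
  assumes ch: "CHAR('k) = 0 \<or> CHAR('k) \<ge> c + CARD('n)" and abc: "1 \<le> a" "a \<le> b" "b \<le> c"
    and x: "x \<in> dg_comp (L_dga c) i"
  shows "f_map c a x = f_map b a (f_map c b x)"
proof -
  interpret C: dg_transport "X_dga c" "L_dga c :: (('k, 'n) R, ('k, 'n) R \<times> ('k, 'n) LS) dga" "closed_part c" "p_inf c" "i_inf c"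
    using ch abc by (intro dg_transport_L) auto
  interpret B: dg_transport "X_dga b" "L_dga b :: (('k, 'n) R, ('k, 'n) R \<times> ('k, 'n) LS) dga" "closed_part b" "p_inf b" "i_inf b"
    using ch abc by (intro dg_transport_L) auto
  have "pi_map c b (i_inf c x) \<in> closed_part b i"
    using pi_closed_part[OF _ _ C.g_Z[OF x], of b] abc by simp
  then show ?thesis using abc by (simp add: f_map_def B.g_p) (simp add: pi_map_def trunc_trunc)
qed

text \<open>\<open>L_mod 0 c\<close> is all of \<Lambda>^0 \<otimes> S_c: there \<open>kappa\<close>
  vanishes, so the homotopy formula gives q = \<kappa>\<sigma>q, with c as the divisor. Hence the
  boundaries in degree 0 are the evaluations of all forms of degree c.\<close>

lemma augmented_L:
  assumes ch: "CHAR('k::field) = 0 \<or> CHAR('k) \<ge> c + CARD('n::{finite,linorder})" and c: "1 \<le> c"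
  shows "augmented_to (L_dga c :: (('k, 'n) R, ('k, 'n) R \<times> ('k, 'n) LS) dga)
    (L_aug c) (residues (ideal_power max_ideal c))"
proof -
  let ?L = "L_dga c :: (('k, 'n) R, ('k, 'n) R \<times> ('k, 'n) LS) dga"
  let ?s = "(-1) ^ (c + 1) :: ('k, 'n) R"
  have "dg_diff ?L ` dg_comp ?L 1 = eps_power c \<times> {0}"
  proof
    show "dg_diff ?L ` dg_comp ?L 1 \<subseteq> eps_power c \<times> {0}"
    proof
      fix x assume "x \<in> dg_diff ?L ` dg_comp ?L 1"
      then obtain \<beta> :: "('k, 'n) LS" where \<beta>: "\<beta> \<in> LS_comp (Suc 0) (c - 1)" "x = dg_diff ?L (0, kappa \<beta>)"
        by (auto simp: L_mod_def)
      have k: "kappa \<beta> \<in> ext_comp 0" "part (\<lambda>k. k = c) (kappa \<beta>) = kappa \<beta>"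
        using kappa_LS_comp[OF \<beta>(1)] c by (simp_all add: LS_comp_iff)
      have "poly_part (\<lambda>k. k = c) (kappa \<beta> {}) = kappa \<beta> {}"
        using fun_cong[OF k(2), of "{}"] unfolding part_def .
      then have "eps (kappa \<beta> {}) \<in> eps_power c" unfolding eps_power_def by blast
      then have "?s * eps (kappa \<beta> {}) \<in> eps_power c" by (rule subspaceD(3)[OF module_mult eps_power_subspace])
      then show "x \<in> eps_power c \<times> {0}" using dkos_ext_comp_0[OF k(1)] \<beta>(2) by simp
    qed
    show "eps_power c \<times> {0} \<subseteq> dg_diff ?L ` dg_comp ?L 1"
    proof clarify
      fix x :: "('k, 'n) R" assume "x \<in> eps_power c"
      \<comment> \<open>The sign of the differential is its own inverse, so it is absorbed into the
        preimage.\<close>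
      then have "?s * x \<in> eps_power c" by (rule subspaceD(3)[OF module_mult eps_power_subspace])
      then obtain q where q: "?s * x = eps q" "poly_part (\<lambda>k. k = c) q = q" by (auto simp: eps_power_def)
      have "ext_basis {} q \<in> ext_comp 0" by (auto simp: ext_comp_def ext_basis_def)
      then have b: "ext_basis {} q \<in> LS_comp 0 c" using q(2) by (simp add: LS_comp_iff part_basis)
      have "(of_nat (0 + c) :: 'k) \<noteq> 0" using c by (intro of_nat_neq_0[OF ch]) auto
      from scale_of_nat_inverse(1)[OF this, of "ext_basis {} q"]
      have "kappa (sigma (ext_basis {} q)) = ext_basis {} q"
        using de_rham_homotopy[OF b] kappa_ext_comp_0[of "ext_basis {} q"] b
        by (simp add: sigma_eq[OF b] kappa_scale LS_comp_iff)
      moreover have "sigma (ext_basis {} q) \<in> LS_comp (0 + 1) (c - 1)"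
        using sigma_LS_comp[of "ext_basis {} q" 0 "c - 1"] b c by simp
      ultimately have m: "ext_basis {} q \<in> L_mod 0 c" unfolding L_mod_def by (metis imageI)
      have "?s * eps q = x"
        unfolding q(1)[symmetric] by (simp add: mult.assoc[symmetric] power_add[symmetric])
      moreover have "dkos (ext_basis {} q) = 0" by (simp add: dkos_def)
      ultimately have "(x, 0) = dg_diff ?L (0, ext_basis {} q)" by (simp add: ext_basis_def[of "{}" q])
      then show "(x, 0) \<in> dg_diff ?L ` dg_comp ?L 1" by (rule image_eqI) (simp add: m)
    qed
  qed
  moreover have "L_aug c ` dg_comp ?L 0 = residues (eps_power c)"
    by (auto simp: L_aug_def residues_def ideal_power_eq image_iff)
  ultimately show ?thesis
    unfolding augmented_to_def
    by (auto simp: L_aug_def ideal_power_eq residue_eq_iff[OF eps_power_subspace])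
qed

lemma lifts_f_map:
  assumes ch: "CHAR('k::field) = 0 \<or> CHAR('k) \<ge> b + CARD('n::{finite,linorder})" and ab: "1 \<le> a" "a \<le> b"
  shows "lifts (L_dga b :: (('k, 'n) R, ('k, 'n) R \<times> ('k, 'n) LS) dga) (L_aug b) (residues (ideal_power max_ideal b))
    (L_dga a :: (('k, 'n) R, ('k, 'n) R \<times> ('k, 'n) LS) dga) (L_aug a) (residues (ideal_power max_ideal a))
    (f_map b a) (nat_surj (ideal_power max_ideal a))"
proof -
  interpret f: dg_algebra_hom "L_dga b :: (('k, 'n) R, ('k, 'n) R \<times> ('k, 'n) LS) dga" "L_dga a" "f_map b a"
    using assms by (rule dg_algebra_hom_f_map)
  let ?I = "ideal_power max_ideal :: nat \<Rightarrow> ('k, 'n) R set"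
  have sub: "0 \<in> ?I c" "u \<in> ?I c \<Longrightarrow> v \<in> ?I c \<Longrightarrow> u + v \<in> ?I c" for u v c
    using subspaceD[OF module_mult eps_power_subspace[of c]] unfolding ideal_power_eq by blast+
  have "f_map b a (r, 0) = (r, 0 :: ('k, 'n) LS)" for r
  proof -
    have "poly_part (\<lambda>m. m < a) (const r :: ('k, 'n) S) = const r"
      using ab by (simp add: const_def poly_part_single)
    then show ?thesis by (simp add: f_map_def i_inf_scalar pi_map_def trunc_eq_part part_basis p_inf_scalar)
  qed
  moreover have "residue (?I a) r = nat_surj (?I a) (residue (?I b) r)" for r
  proof (intro set_eqI iffI)
    fix x assume "x \<in> residue (?I a) r"
    then obtain u where "u \<in> ?I a" "x = r + u" by (auto simp: residue_def)
    moreover have "r \<in> residue (?I b) r" using sub(1)[of b] unfolding residue_def by force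
    ultimately show "x \<in> nat_surj (?I a) (residue (?I b) r)" unfolding nat_surj_def by blast
  next
    fix x assume "x \<in> nat_surj (?I a) (residue (?I b) r)"
    then obtain u v where uv: "u \<in> ?I b" "v \<in> ?I a" "x = r + (u + v)"
      by (auto simp: nat_surj_def residue_def add.assoc)
    moreover have "u + v \<in> ?I a" using uv ideal_power_antimono[OF ab(2)] sub(2) by blast
    ultimately show "x \<in> residue (?I a) r" unfolding residue_def by blast
  qed
  ultimately have "L_aug a (f_map b a x) = nat_surj (?I a) (L_aug b x)" if "x \<in> dg_comp (L_dga b) 0"
    for x :: "('k, 'n) R \<times> ('k, 'n) LS"
    using that by (auto simp: L_aug_def)
  moreover have "CHAR('k) = 0 \<or> CHAR('k) \<ge> a + CARD('n)" using ch ab by auto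
  ultimately show ?thesis
    unfolding lifts_def using augmented_L[OF ch] augmented_L[of a] ab f.hom_comp f.hom_diff by auto
qed

section \<open>The Koszul complex\<close>

text \<open>Exponent vectors with sum 0 are both 0, so the constant coefficient is multiplicative,
  and reduction modulo the y-variables respects products.\<close>

lemma lookup_mult_zero:
  fixes p q :: "('n::finite \<Rightarrow>\<^sub>0 nat) \<Rightarrow>\<^sub>0 'c::comm_ring_1"
  shows "Poly_Mapping.lookup (p * q) 0 = Poly_Mapping.lookup p 0 * Poly_Mapping.lookup q 0"
proof (induction p rule: poly_induct)
  case (single \<mu> a)
  have "(\<mu> + \<nu> = 0) = (\<mu> = 0 \<and> \<nu> = 0)" for \<nu>
    using deg_add[of \<mu> \<nu>] by (metis add_is_0 deg_eq_0_iff)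
  then show ?case
    by (induction q rule: poly_induct)
      (auto simp: mult_single lookup_single when_def distrib_left lookup_add)
qed (simp add: distrib_right lookup_add)

text \<open>Reduction of \<Lambda> \<otimes> S modulo the y-variables. It annihilates
  \<open>kappa\<close> and turns \<open>dkos\<close> into the Koszul differential over R.\<close>

definition ext_constant :: "('k::field, 'n::{finite,linorder}) LS \<Rightarrow> (('k, 'n) R, 'n) ext"
  where "ext_constant \<omega> = (\<lambda>T. Poly_Mapping.lookup (\<omega> T) 0)"

lemma lookup_var_zero [simp]: "Poly_Mapping.lookup (var v) 0 = 0"
  by (simp add: var_def lookup_single when_def) (metis lookup_single_eq lookup_zero nat.distinct(1))

lemma lookup_const_zero [simp]: "Poly_Mapping.lookup (const r) 0 = r"
  by (simp add: const_def)

lemma lookup_sign_zero: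
  "Poly_Mapping.lookup ((-1) ^ k :: ('n::finite \<Rightarrow>\<^sub>0 nat) \<Rightarrow>\<^sub>0 'c::comm_ring_1) 0 = (-1) ^ k"
  by (induction k) (simp_all add: lookup_uminus)

lemma ext_constant_mult: "ext_constant (ext_mult \<omega> \<eta>) = ext_mult (ext_constant \<omega>) (ext_constant \<eta>)"
  by (rule ext) (simp add: ext_constant_def ext_mult_apply lookup_sum lookup_mult_zero shuffle_sign_def lookup_sign_zero)

lemma ext_constant_add: "ext_constant (\<omega> + \<eta>) = ext_constant \<omega> + ext_constant \<eta>"
  by (rule ext) (simp add: ext_constant_def lookup_add)

lemma ext_constant_kappa: "ext_constant (kappa \<omega>) = 0"
  by (rule ext) (simp add: ext_constant_def kappa_def koszul_diff_apply lookup_sum lookup_mult_zero)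

lemma ext_constant_dkos: "ext_constant (dkos \<omega>) = koszul_diff var (ext_constant \<omega>)"
  by (rule ext) (simp add: ext_constant_def dkos_def koszul_diff_apply lookup_sum lookup_mult_zero pre_sign_def lookup_sign_zero)

lemma ext_constant_trunc: "ext_constant (trunc 1 \<omega>) = ext_constant \<omega>"
  by (rule ext) (simp add: ext_constant_def trunc_def lookup_poly_part)

lemma ext_constant_comp:
  assumes "\<omega> \<in> ext_comp i" shows "ext_constant \<omega> \<in> ext_comp i"
  unfolding ext_comp_def
proof clarify
  fix T assume "ext_constant \<omega> T \<noteq> 0"
  then have "\<omega> T \<noteq> 0" unfolding ext_constant_def by (metis lookup_zero)
  then show "card T = i" using assms unfolding ext_comp_def by blast
qed

lemma dg_algebra_koszul_dga: "dg_algebra koszul_dga"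
  unfolding koszul_dga_def by (rule dg_algebra_koszul[of "\<lambda>r. r"]) simp_all

lemma dg_algebra_hom_constant:
  "dg_algebra_hom (X_dga 1) (koszul_dga :: (('k::field, 'n::{finite,linorder}) R, _) dga) ext_constant"
proof (rule dg_algebra_hom.intro[OF dg_algebra_X dg_algebra_koszul_dga dg_algebra_hom_axioms.intro])
  show "ext_constant (dg_scale (X_dga 1) r \<omega>) = dg_scale koszul_dga r (ext_constant \<omega>)" for r and \<omega> :: "('k, 'n) LS"
    by (rule ext) (simp add: koszul_dga_def ext_constant_def ext_scale_def lookup_mult_zero)
  show "ext_constant (dg_one (X_dga 1)) = (dg_one koszul_dga :: (('k, 'n) R, 'n) ext)"
    by (rule ext) (simp add: koszul_dga_def ext_constant_def ext_basis_def)
qed (simp_all add: koszul_dga_def X_comp ext_constant_comp ext_constant_add ext_constant_trunc[unfolded One_nat_def]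
    ext_constant_kappa ext_constant_dkos ext_constant_mult)

text \<open>For c = 1 only y-degree 0 is left, where \<delta> vanishes, so both closedness
  conditions hold automatically. Thus L_1 is isomorphic to all of X_1, which is the Koszul
  complex.\<close>

lemma closed_part_1: "closed_part 1 i = (dg_comp (X_dga 1) i :: ('k::field, 'n::{finite,linorder}) LS set)"
proof -
  have "de_rham (trunc 1 \<omega>) = 0" for \<omega> :: "('k, 'n) LS"
    unfolding de_rham_trunc by (rule ext) (simp add: part_def poly_part_none)
  then show ?thesis by (auto simp: closed_part_def X_comp) metis
qed

lemma bij_betw_constant:
  "bij_betw ext_constant (dg_comp (X_dga 1) i) (dg_comp (koszul_dga :: (('k::field, 'n::{finite,linorder}) R, _) dga) i)"
proof (rule bij_betw_byWitness[where f' = "\<lambda>\<eta> T. const (\<eta> T)"])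
  show "\<forall>\<omega>\<in>dg_comp (X_dga 1) i. (\<lambda>T. const (ext_constant \<omega> T)) = (\<omega> :: ('k, 'n) LS)"
  proof
    fix \<omega> :: "('k, 'n) LS" assume "\<omega> \<in> dg_comp (X_dga 1) i"
    then have "trunc 1 \<omega> = \<omega>" by (simp add: X_comp)
    moreover have "(\<lambda>T. const (ext_constant \<omega> T)) = trunc 1 \<omega>"
      by (rule ext, rule poly_mapping_eqI)
        (auto simp: ext_constant_def trunc_def lookup_poly_part const_def lookup_single when_def deg_eq_0_iff)
    ultimately show "(\<lambda>T. const (ext_constant \<omega> T)) = \<omega>" by simp
  qed
  show "ext_constant ` dg_comp (X_dga 1) i \<subseteq> dg_comp (koszul_dga :: (('k, 'n) R, _) dga) i"
    by (auto simp: koszul_dga_def X_comp ext_constant_comp)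
  show "(\<lambda>\<eta> T. const (\<eta> T)) ` dg_comp (koszul_dga :: (('k, 'n) R, _) dga) i \<subseteq> dg_comp (X_dga 1) i"
  proof clarify
    fix \<eta> :: "(('k, 'n) R, 'n) ext" assume "\<eta> \<in> dg_comp koszul_dga i"
    then have "(\<lambda>T. const (\<eta> T)) \<in> ext_comp i" unfolding koszul_dga_def ext_comp_def by (auto, metis const_simps(1))
    moreover have "trunc 1 (\<lambda>T. const (\<eta> T)) = (\<lambda>T. const (\<eta> T))"
      by (rule ext) (simp add: trunc_def const_def poly_part_single)
    ultimately show "(\<lambda>T. const (\<eta> T)) \<in> dg_comp (X_dga 1) i" by (simp add: X_comp)
  qed
qed (auto simp: ext_constant_def)

lemma L1_to_koszul_eq: "L1_to_koszul = ext_constant \<circ> i_inf 1"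
  by (simp add: fun_eq_iff L1_to_koszul_def ext_constant_def)

lemma dg_algebra_iso_koszul:
  assumes "CHAR('k::field) = 0 \<or> CHAR('k) \<ge> 1 + CARD('n::{finite,linorder})"
  shows "dg_algebra_iso (L_dga 1 :: (('k, 'n) R, ('k, 'n) R \<times> ('k, 'n) LS) dga) koszul_dga L1_to_koszul"
proof -
  interpret dg_transport "X_dga 1" "L_dga 1 :: (('k, 'n) R, ('k, 'n) R \<times> ('k, 'n) LS) dga" "closed_part 1" "p_inf 1" "i_inf 1"
    using assms by (rule dg_transport_L) simp
  have "bij_betw (i_inf 1) (dg_comp (L_dga 1 :: (('k, 'n) R, ('k, 'n) R \<times> ('k, 'n) LS) dga) i) (dg_comp (X_dga 1) i)" for i
    unfolding closed_part_1[symmetric]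
    by (rule bij_betw_byWitness[where f' = "p_inf 1"]) (use p_g g_p g_Z p_comp in blast)+
  then show ?thesis
    unfolding dg_algebra_iso_def L1_to_koszul_eq
    using dg_algebra_hom_compose[OF dg_algebra_hom_g dg_algebra_hom_constant] bij_betw_trans[OF _ bij_betw_constant]
    by blast
qed

theorem theorem5p1:
  shows
    "(\<forall>a b. 1 \<le> a \<and> a \<le> b \<and> (CHAR('k::field) = 0 \<or> CHAR('k) \<ge> b + CARD('n::{finite,linorder})) \<longrightarrow>
        dg_algebra_hom (L_dga b :: (('k, 'n) R, ('k, 'n) R \<times> ('k, 'n) LS) dga) (L_dga a) (f_map b a) \<and>
        lifts
          (L_dga b :: (('k, 'n) R, ('k, 'n) R \<times> ('k, 'n) LS) dga)
            (L_aug b) (residues (ideal_power max_ideal b))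
          (L_dga a :: (('k, 'n) R, ('k, 'n) R \<times> ('k, 'n) LS) dga)
            (L_aug a) (residues (ideal_power max_ideal a))
          (f_map b a) (nat_surj (ideal_power max_ideal a)))
     \<and> (\<forall>b. 1 \<le> b \<and> (CHAR('k) = 0 \<or> CHAR('k) \<ge> b + CARD('n)) \<longrightarrow>
        dg_algebra_iso (L_dga 1 :: (('k, 'n) R, ('k, 'n) R \<times> ('k, 'n) LS) dga)
          koszul_dga L1_to_koszul \<and>
        dg_algebra_hom (L_dga b :: (('k, 'n) R, ('k, 'n) R \<times> ('k, 'n) LS) dga)
          (L_dga 1) (f_map b 1) \<and>
        dg_algebra_hom (L_dga b :: (('k, 'n) R, ('k, 'n) R \<times> ('k, 'n) LS) dga)
          koszul_dga (L1_to_koszul \<circ> f_map b 1))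
     \<and> (\<forall>a b c. 1 \<le> a \<and> a \<le> b \<and> b \<le> c \<and> (CHAR('k) = 0 \<or> CHAR('k) \<ge> c + CARD('n)) \<longrightarrow>
        (\<forall>i. \<forall>x \<in> dg_comp (L_dga c :: (('k, 'n) R, ('k, 'n) R \<times> ('k, 'n) LS) dga) i.
          f_map c a x = f_map b a (f_map c b x)))"
proof (intro conjI allI impI ballI; (elim conjE)?)
  fix b :: nat assume b: "1 \<le> b" and ch: "CHAR('k) = 0 \<or> CHAR('k) \<ge> b + CARD('n)"
  then have "CHAR('k) = 0 \<or> CHAR('k) \<ge> 1 + CARD('n)" by auto
  then show iso: "dg_algebra_iso (L_dga 1 :: (('k, 'n) R, ('k, 'n) R \<times> ('k, 'n) LS) dga) koszul_dga L1_to_koszul"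
    by (rule dg_algebra_iso_koszul)
  show f: "dg_algebra_hom (L_dga b :: (('k, 'n) R, ('k, 'n) R \<times> ('k, 'n) LS) dga) (L_dga 1) (f_map b 1)"
    using ch b by (intro dg_algebra_hom_f_map) auto
  show "dg_algebra_hom (L_dga b :: (('k, 'n) R, ('k, 'n) R \<times> ('k, 'n) LS) dga) koszul_dga (L1_to_koszul \<circ> f_map b 1)"
    using dg_algebra_hom_compose[OF f] iso unfolding dg_algebra_iso_def by blast
qed (auto intro: dg_algebra_hom_f_map lifts_f_map f_map_compose)

end
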